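(* Let $\mathcal A$ be an index set, and for each $\alpha\in\mathcal A$ let $(X_\alpha,\delta_\alpha,m_\alpha)$ be given by one of the following (the same one for all $\alpha\in\mathcal A$): (1) a rescaled finite tree $c_\alpha T_\alpha$ with $c_\alpha>0$: $X_\alpha$ is the vertex set of $T_\alpha$, $\delta_\alpha=c_\alpha d_\alpha$ with $d_\alpha$ the graph distance in $T_\alpha$, and $m_\alpha$ is the uniform measure on the vertices; (2) a measured real tree: $(X_\alpha,\delta_\alpha,m_\alpha)=(T_\alpha,d_\alpha,\mu_\alpha)$; (3) a long dendron $D_\alpha=(T_\alpha,d_\alpha,\nu_\alpha)$: $X_\alpha=A_{D_\alpha}$, $\delta_\alpha=d_{D_\alpha}$, $m_\alpha=\nu_\alpha$. For each $\alpha$ let $\xi^{(\alpha)}_1,\xi^{(\alpha)}_2,\dots$ be i.i.d. random points of $X_\alpha$ with distribution $m_\alpha$. Then the following are equivalent. (i) The set of these rescaled trees (respectively measured real trees, long dendrons), regarded as the subset $\{\tau_\infty(X_\alpha,\delta_\alpha,m_\alpha):\alpha\in\mathcal A\}$ of $\mathfrak T$, is relatively compact in $\mathfrak T$. (ii) The set of measures $\{\tau_\infty(X_\alpha,\delta_\alpha,m_\alpha):\alpha\in\mathcal A\}\subseteq\mathcal P(M_\infty)$ is tight. (iii) The set of random infinite matrices $\bigl\{\bigl(\delta_\alpha(\xi^{(\alpha)}_i,\xi^{(\alpha)}_j)\mathbf 1\{i\ne j\}\bigr)_{i,j\ge1}:\alpha\in\mathcal A\bigr\}$ in $M_\infty$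 is tight. (iv) The set of real random variables $\{\delta_\alpha(\xi^{(\alpha)}_1,\xi^{(\alpha)}_2):\alpha\in\mathcal A\}$ is tight. (v) There exist $x_\alpha\in X_\alpha$, $\alpha\in\mathcal A$, such that the set of real random variables $\{\delta_\alpha(\xi^{(\alpha)}_1,x_\alpha):\alpha\in\mathcal A\}$ is tight.
   Context: For a Polish space $X$, $\mathcal P(X)$ is the space of Borel probability measures on $X$ with the weak topology. $M_\infty$ is the Polish space of infinite real matrices $(a_{ij})_{i,j\ge1}$ with the product topology. For a probability space $(X,\mu)$ with a measurable function $d:X^2\to\mathbb R$, $\tau_\infty(X,d,\mu)\in\mathcal P(M_\infty)$ is the distribution of the random matrix $(d(\xi_i,\xi_j)\mathbf 1\{i\neq j\})_{i,j\ge1}$, where $\xi_1,\xi_2,\dots$ are i.i.d. with distribution $\mu$. For a finite tree $T$ and $c>0$, $cT$ denotes the vertex set of $T$ with metric $c$ times graph distance and the uniform probability measure on the vertices; $\tau_\infty(cT)$ is defined accordingly. $\mathfrak T$ is the closure in $\mathcal P(M_\infty)$ of $\{\tau_\infty(cT): T \text{ a finite tree}, c>0\}$. It is a Polish space, and $\tau_\infty$ of every measured real tree and of every long dendron belongs to $\mathfrak T$. A real tree is a complete non-empty metric space $(T,d)$ such that for any distinct $x,y\in T$ there is a unique isometric map $\gamma:[0,d(x,y)]\to T$ with $\gamma(0)=x$, $\gamma(d(x,y))=y$, and moreover for every $s\in(0,d(x,y))$, $x$ and $y$ are in different components of $T\setminus\{\gamma(s)\}$. A measured real tree $(T,d,\mu)$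 is a separable real tree with a Borel probability measure $\mu$. A branch of $T$ is a connected component of $T\setminus\{p\}$ for some $p\in T$. A long dendron $D=(T,d,\nu)$ is a real tree $(T,d)$ together with a Borel probability measure $\nu$ on $A_D:=T\times[0,\infty)$ such that $\nu(B\times[0,\infty))>0$ for every branch $B$ of $T$ (the base $T$ is then necessarily separable); $d_D((x,a),(y,b)):=d(x,y)+a+b$ on $A_D$, and $\tau_\infty(D):=\tau_\infty(A_D,d_D,\nu)$. A set in a metric space is relatively compact if every sequence in it has a convergent subsequence (with limit in the space). A family of random variables $Z_\alpha$ in a metric space $X$ (or the family of their distributions) is tight if for every $\varepsilon>0$ there is a compact $K_\varepsilon\subseteq X$ with $\mathbb P(Z_\alpha\notin K_\varepsilon)<\varepsilon$ for all $\alpha$. *)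

theory Defs
  imports "HOL-Probability.Probability"
begin

section \<open>Spaces of probability measures and tightness\<close>

definition prob_measures :: "'a::topological_space measure set" where
  "prob_measures = {\<mu>. prob_space \<mu> \<and> sets \<mu> = sets borel}"

text \<open>The functions \<open>\<mu> \<mapsto> \<integral>f d\<mu>\<close> with \<open>f\<close> bounded and continuous
  generate the topology (so its carrier is \<^const>\<open>prob_measures\<close>: take \<open>f = 0\<close>, \<open>U = UNIV\<close>).\<close>

definition weak_topology :: "'a::topological_space measure topology" where
  "weak_topology = topology_generated_by
     {{\<mu> \<in> prob_measures. (\<integral>x. f x \<partial>\<mu>) \<in> U} | (f :: 'a \<Rightarrow> real) (U :: real set).
        continuous_on UNIV f \<and> bounded (range f) \<and> open U}"

definition relatively_compact_in :: "'a topology \<Rightarrow> 'a set \<Rightarrow> bool" where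
  "relatively_compact_in X S \<longleftrightarrow> S \<subseteq> topspace X \<and>
     (\<forall>s :: nat \<Rightarrow> 'a. range s \<subseteq> S \<longrightarrow>
        (\<exists>l r. strict_mono r \<and> limitin X (s \<circ> r) l sequentially))"

definition tight_measures :: "'a::topological_space measure set \<Rightarrow> bool" where
  "tight_measures S \<longleftrightarrow>
     (\<forall>\<epsilon>>0. \<exists>K. compact K \<and> (\<forall>\<mu>\<in>S. measure \<mu> (space \<mu> - K) < \<epsilon>))"

text \<open>Each variable of the family may live on its own probability space.\<close>

definition tight_variables ::
  "'i set \<Rightarrow> ('i \<Rightarrow> 'w measure) \<Rightarrow> ('i \<Rightarrow> 'w \<Rightarrow> 'a::topological_space) \<Rightarrow> bool" where
  "tight_variables I \<Omega> Z \<longleftrightarrow>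
     (\<forall>\<epsilon>>0. \<exists>K. compact K \<and> (\<forall>\<alpha>\<in>I. \<P>(\<omega> in \<Omega> \<alpha>. Z \<alpha> \<omega> \<notin> K) < \<epsilon>))"

definition iid_sequence :: "'w measure \<Rightarrow> 'x measure \<Rightarrow> (nat \<Rightarrow> 'w \<Rightarrow> 'x) \<Rightarrow> bool" where
  "iid_sequence \<Omega> m \<xi> \<longleftrightarrow> prob_space \<Omega> \<and>
     prob_space.indep_vars \<Omega> (\<lambda>_. m) \<xi> UNIV \<and> (\<forall>i. distr \<Omega> m (\<xi> i) = m)"

section \<open>The law of the random distance matrix\<close>

text \<open>The space of infinite matrices is \<^typ>\<open>nat \<Rightarrow> nat \<Rightarrow> real\<close> with its product topology.
  Rows, columns and sample points are numbered from 0. The diagonal is set to 0 explicitly because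
  the function \<open>d\<close> of a long dendron need not vanish there.\<close>

definition dist_matrix :: "('x \<Rightarrow> 'x \<Rightarrow> real) \<Rightarrow> (nat \<Rightarrow> 'x) \<Rightarrow> nat \<Rightarrow> nat \<Rightarrow> real" where
  "dist_matrix d x = (\<lambda>i j. if i = j then 0 else d (x i) (x j))"

definition tau_infinity :: "('x \<Rightarrow> 'x \<Rightarrow> real) \<Rightarrow> 'x measure \<Rightarrow> (nat \<Rightarrow> nat \<Rightarrow> real) measure" where
  "tau_infinity d \<mu> = distr (Pi\<^sub>M UNIV (\<lambda>_::nat. \<mu>)) borel (dist_matrix d)"

section \<open>Finite trees\<close>

text \<open>Simple graphs are given by a vertex set \<open>V\<close> and a set \<open>E\<close> of two-element subsets of \<open>V\<close>;
  a walk is the list of its vertices.\<close>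

definition walk :: "'a set \<Rightarrow> 'a set set \<Rightarrow> 'a \<Rightarrow> 'a list \<Rightarrow> 'a \<Rightarrow> bool" where
  "walk V E u p v \<longleftrightarrow> p \<noteq> [] \<and> hd p = u \<and> last p = v \<and> set p \<subseteq> V \<and>
     successively (\<lambda>x y. {x, y} \<in> E) p"

definition graph_cycle :: "'a set \<Rightarrow> 'a set set \<Rightarrow> 'a list \<Rightarrow> bool" where
  "graph_cycle V E p \<longleftrightarrow> length p \<ge> 3 \<and> distinct p \<and> walk V E (hd p) p (last p) \<and>
     {last p, hd p} \<in> E"

definition finite_tree :: "'a set \<Rightarrow> 'a set set \<Rightarrow> bool" where
  "finite_tree V E \<longleftrightarrow> finite V \<and> V \<noteq> {} \<and>
     (\<forall>e\<in>E. \<exists>u\<in>V. \<exists>v\<in>V. u \<noteq> v \<and> e = {u, v}) \<and>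
     (\<forall>u\<in>V. \<forall>v\<in>V. \<exists>p. walk V E u p v) \<and>
     (\<nexists>p. graph_cycle V E p)"

definition graph_dist :: "'a set \<Rightarrow> 'a set set \<Rightarrow> 'a \<Rightarrow> 'a \<Rightarrow> nat" where
  "graph_dist V E u v = (LEAST n. \<exists>p. walk V E u p v \<and> length p = Suc n)"

definition rescaled_dist :: "real \<Rightarrow> 'a set \<Rightarrow> 'a set set \<Rightarrow> 'a \<Rightarrow> 'a \<Rightarrow> real" where
  "rescaled_dist c V E u v = c * real (graph_dist V E u v)"

text \<open>The space \<open>\<TT>\<close> of tree limits. Every finite tree is isomorphic to one whose vertices are
  natural numbers, so these suffice.\<close>

definition tree_limits :: "(nat \<Rightarrow> nat \<Rightarrow> real) measure topology" where
  "tree_limits = subtopology weak_topology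
     (weak_topology closure_of
       {tau_infinity (rescaled_dist c V E) (uniform_count_measure V) | c (V :: nat set) E.
          finite_tree V E \<and> c > 0})"

section \<open>Measured real trees and long dendrons\<close>

definition borel_of :: "'a topology \<Rightarrow> 'a measure" where
  "borel_of X = sigma (topspace X) {U. openin X U}"

text \<open>Functions in \<open>\<rightarrow>\<^sub>E\<close> are fixed outside \<open>{0..d x y}\<close>, so that uniqueness below
  is uniqueness of maps on this interval.\<close>

definition geodesic ::
  "'a set \<Rightarrow> ('a \<Rightarrow> 'a \<Rightarrow> real) \<Rightarrow> 'a \<Rightarrow> 'a \<Rightarrow> (real \<Rightarrow> 'a) \<Rightarrow> bool" where
  "geodesic T d x y \<gamma> \<longleftrightarrow> \<gamma> \<in> {0..d x y} \<rightarrow>\<^sub>E T \<and>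
     (\<forall>s\<in>{0..d x y}. \<forall>t\<in>{0..d x y}. d (\<gamma> s) (\<gamma> t) = \<bar>s - t\<bar>) \<and>
     \<gamma> 0 = x \<and> \<gamma> (d x y) = y"

definition real_tree :: "'a set \<Rightarrow> ('a \<Rightarrow> 'a \<Rightarrow> real) \<Rightarrow> bool" where
  "real_tree T d \<longleftrightarrow> Metric_space T d \<and> Metric_space.mcomplete T d \<and> T \<noteq> {} \<and>
     (\<forall>x\<in>T. \<forall>y\<in>T. x \<noteq> y \<longrightarrow>
        (\<exists>!\<gamma>. geodesic T d x y \<gamma>) \<and>
        (\<forall>\<gamma>. geodesic T d x y \<gamma> \<longrightarrow> (\<forall>s\<in>{0<..<d x y}.
           \<not> connected_component_of (subtopology (Metric_space.mtopology T d) (T - {\<gamma> s})) x y)))"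

definition measured_real_tree :: "'a set \<Rightarrow> ('a \<Rightarrow> 'a \<Rightarrow> real) \<Rightarrow> 'a measure \<Rightarrow> bool" where
  "measured_real_tree T d \<mu> \<longleftrightarrow> real_tree T d \<and>
     separable_space (Metric_space.mtopology T d) \<and>
     prob_space \<mu> \<and> sets \<mu> = sets (borel_of (Metric_space.mtopology T d))"

definition branches :: "'a set \<Rightarrow> ('a \<Rightarrow> 'a \<Rightarrow> real) \<Rightarrow> 'a set set" where
  "branches T d =
     (\<Union>p\<in>T. connected_components_of (subtopology (Metric_space.mtopology T d) (T - {p})))"

definition dendron_space :: "'a set \<Rightarrow> ('a \<times> real) set" where
  "dendron_space T = T \<times> {0..}"

definition dendron_dist :: "('a \<Rightarrow> 'a \<Rightarrow> real) \<Rightarrow> 'a \<times> real \<Rightarrow> 'a \<times> real \<Rightarrow> real" where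
  "dendron_dist d = (\<lambda>(x, a) (y, b). d x y + a + b)"

definition long_dendron :: "'a set \<Rightarrow> ('a \<Rightarrow> 'a \<Rightarrow> real) \<Rightarrow> ('a \<times> real) measure \<Rightarrow> bool" where
  "long_dendron T d \<nu> \<longleftrightarrow> real_tree T d \<and> prob_space \<nu> \<and>
     sets \<nu> = sets (borel_of (prod_topology (Metric_space.mtopology T d) (top_of_set {0..}))) \<and>
     (\<forall>B\<in>branches T d. measure \<nu> (B \<times> {0..}) > 0)"

section \<open>The five conditions\<close>

text \<open>Rescaled finite trees and real trees with points of type \<open>'a\<close> have sample space of type
  \<open>'a\<close>, long dendrons of type \<open>'a \<times> real\<close>; hence a predicate polymorphic in the sample space.\<close>

definition tightness_conditions_equivalent ::
  "'i set \<Rightarrow> ('i \<Rightarrow> 'x set) \<Rightarrow> ('i \<Rightarrow> 'x \<Rightarrow> 'x \<Rightarrow> real) \<Rightarrow> ('i \<Rightarrow> 'x measure) \<Rightarrow>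
   ('i \<Rightarrow> 'w measure) \<Rightarrow> ('i \<Rightarrow> nat \<Rightarrow> 'w \<Rightarrow> 'x) \<Rightarrow> bool" where
  "tightness_conditions_equivalent I X \<delta> m \<Omega> \<xi> \<longleftrightarrow>
    (let
       laws = (\<lambda>\<alpha>. tau_infinity (\<delta> \<alpha>) (m \<alpha>)) ` I;
       i   = relatively_compact_in tree_limits laws;
       ii  = tight_measures laws;
       iii = tight_variables I \<Omega> (\<lambda>\<alpha> \<omega>. dist_matrix (\<delta> \<alpha>) (\<lambda>k. \<xi> \<alpha> k \<omega>));
       iv  = tight_variables I \<Omega> (\<lambda>\<alpha> \<omega>. \<delta> \<alpha> (\<xi> \<alpha> 0 \<omega>) (\<xi> \<alpha> 1 \<omega>));
       v   = (\<exists>x. (\<forall>\<alpha>\<in>I. x \<alpha> \<in> X \<alpha>) \<and>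
                  tight_variables I \<Omega> (\<lambda>\<alpha> \<omega>. \<delta> \<alpha> (\<xi> \<alpha> 0 \<omega>) (x \<alpha>)))
     in (i \<longleftrightarrow> ii) \<and> (ii \<longleftrightarrow> iii) \<and> (iii \<longleftrightarrow> iv) \<and> (iv \<longleftrightarrow> v))"

end

theory Submission
  imports Defs
begin

text \<open>All off-diagonal entries of the random matrix have the law of \<open>\<delta>(\<xi>\<^sub>1, \<xi>\<^sub>2)\<close>, so each of the conditions
  amounts to uniform tails of this one variable.

  For compactness, Schoenberg's space-filling curve is a map from \<open>\<real>\<close> onto the matrices which is continuous
  off a null set and has a Borel right inverse. Pulling a tight sequence of laws back along it reduces
  Prokhorov's theorem to Helly's selection theorem on \<open>\<real>\<close>.

  A real tree or long dendron has a law in \<open>\<TT>\<close> because its Gromov product with respect to a root is an ultrametric: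
  after restriction to finitely many points of a dense sequence and rounding down to multiples of \<open>1/n\<close> it
  describes a finite combinatorial tree. Hanging many leaves on suitable copies of the points makes the
  uniform measure on the vertices approximate the given one, and the distance matrices converge almost
  surely when the vertices are chosen through independent uniform variables on \<open>(0, 1)\<close>. The base of a
  long dendron is separable since at each height only countably many disjoint branches have mass.\<close>

section \<open>Weak convergence of laws of random matrices\<close>

text \<open>Compactness can only fail by entries escaping to infinity. \<open>squash\<close> shrinks
  every entry into (0, 1), so the coded laws live on [0, 1] and always have convergent subsequences;
  an escaping entry then shows as mass of the limit at parameters where a coordinate of the curve
  equals 0 or 1, and tightness of the entries excludes exactly this.

  The obstacle to approximation by finite trees is that two independent samples from an atom (x, a)
  of a long dendron are at distance \<open>2 * a\<close>, not 0. Hence the height \<open>h x\<close>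
  and the self-product \<open>g x x\<close> are kept apart, and an atom is spread over many blocks
  of leaves that meet only at level \<open>g x x\<close>. Moreover, a vertex of the finite tree
  determines the uniform variable behind it only up to a vanishing error, so the sampled point has
  to be a locally constant function of that variable. This is why laws on countably many points come
  before general ones.\<close>

lemma prob_measures_iff: "\<mu> \<in> prob_measures \<longleftrightarrow> prob_space \<mu> \<and> sets \<mu> = sets borel"
  by (simp add: prob_measures_def)

lemma openin_weak_topology_basic:
  fixes f :: "'a::topological_space \<Rightarrow> real"
  assumes "continuous_on UNIV f" "bounded (range f)" "open U"
  shows "openin weak_topology {\<mu> \<in> prob_measures. (\<integral>x. f x \<partial>\<mu>) \<in> U}"
  unfolding weak_topology_def using assms by (intro topology_generated_by_Basis) blast

lemma topspace_weak_topology: "topspace weak_topology = prob_measures"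
proof
  show "topspace weak_topology \<subseteq> (prob_measures :: 'a measure set)"
    unfolding weak_topology_def topology_generated_by_topspace by blast
  have "openin weak_topology {\<mu> \<in> prob_measures. integral\<^sup>L \<mu> (\<lambda>x::'a. 0) \<in> (UNIV :: real set)}"
    by (intro openin_weak_topology_basic) auto
  then show "(prob_measures :: 'a measure set) \<subseteq> topspace weak_topology"
    using openin_subset by fastforce
qed

text \<open>Subbasic neighbourhoods of \<open>l\<close> are preimages of open sets under integration
  of a bounded continuous function, and being eventually inside passes to finite intersections and
  to unions; so in the induction over the generated topology only the subbasic case has
  content.\<close>

lemma limitin_weak_topology:
  fixes s :: "'i \<Rightarrow> 'a::topological_space measure"
  shows "limitin weak_topology s l F \<longleftrightarrow>
    l \<in> prob_measures \<and> (\<forall>\<^sub>F i in F. s i \<in> prob_measures) \<and>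
    (\<forall>f :: 'a \<Rightarrow> real. continuous_on UNIV f \<and> bounded (range f) \<longrightarrow>
       ((\<lambda>i. integral\<^sup>L (s i) f) \<longlongrightarrow> integral\<^sup>L l f) F)"
    (is "?L \<longleftrightarrow> ?R")
proof
  assume L: ?L
  then have l: "l \<in> prob_measures"
    by (simp add: limitin_def topspace_weak_topology)
  moreover have "\<forall>\<^sub>F i in F. s i \<in> prob_measures"
    using L l topspace_weak_topology unfolding limitin_def
    by (metis openin_topspace)
  moreover have "((\<lambda>i. integral\<^sup>L (s i) f) \<longlongrightarrow> integral\<^sup>L l f) F"
    if f: "continuous_on UNIV f" "bounded (range f)" for f :: "'a \<Rightarrow> real"
  proof (rule topological_tendstoI)
    fix U :: "real set" assume "open U" "integral\<^sup>L l f \<in> U"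
    then have "\<forall>\<^sub>F i in F. s i \<in> {\<mu> \<in> prob_measures. (\<integral>x. f x \<partial>\<mu>) \<in> U}"
      using L l openin_weak_topology_basic[OF f, of U]
      by (intro limitinD[of weak_topology s l F]) auto
    then show "\<forall>\<^sub>F i in F. (\<integral>x. f x \<partial>s i) \<in> U"
      by eventually_elim auto
  qed
  ultimately show ?R by blast
next
  assume R: ?R
  have "\<forall>\<^sub>F i in F. s i \<in> U" if "openin weak_topology U" "l \<in> U" for U
    using that unfolding weak_topology_def openin_topology_generated_by_iff
  proof (induction rule: generate_topology_on.induct)
    case (Basis U)
    then obtain f V where U: "U = {\<mu> \<in> prob_measures. (\<integral>x. f x \<partial>\<mu>) \<in> V}"
      and f: "continuous_on UNIV f" "bounded (range f)" "open (V :: real set)"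
      by blast
    have "\<forall>\<^sub>F i in F. (\<integral>x. f x \<partial>s i) \<in> V"
      using R f Basis U by (intro topological_tendstoD) auto
    then show ?case
      using R unfolding U by (auto elim: eventually_elim2)
  next
    case (UN K)
    then obtain k where "k \<in> K" "l \<in> k" by blast
    then show ?case
      using UN.IH[of k] by (auto elim: eventually_mono)
  qed (auto intro: eventually_conj)
  then show ?L
    using R by (auto simp: limitin_def topspace_weak_topology)
qed

lemma borel_measurable_matrixI:
  fixes f :: "'a \<Rightarrow> 'i::countable \<Rightarrow> 'j::countable \<Rightarrow> 'b::second_countable_topology"
  assumes "\<And>i j. (\<lambda>x. f x i j) \<in> borel_measurable M"
  shows "f \<in> borel_measurable M"
  by (intro measurable_coordinatewise_then_product assms)

lemma continuous_on_entry:
  "continuous_on UNIV (\<lambda>A :: 'i \<Rightarrow> 'j \<Rightarrow> 'b::topological_space. A i j)"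
  by (intro continuous_on_product_coordinates continuous_on_product_then_coordinatewise)

lemma borel_measurable_entry:
  "(\<lambda>A :: 'i \<Rightarrow> 'j \<Rightarrow> 'b::topological_space. A i j) \<in> borel_measurable borel"
  by (intro borel_measurable_continuous_onI continuous_on_entry)

lemma tendsto_coordinatewiseI:
  fixes f :: "'a \<Rightarrow> 'i \<Rightarrow> 'b::topological_space"
  assumes "\<And>i. ((\<lambda>x. f x i) \<longlongrightarrow> l i) F"
  shows "(f \<longlongrightarrow> l) F"
proof -
  have "limitin (product_topology (\<lambda>_. euclidean) UNIV) f l F"
    using assms by (simp add: limitin_componentwise)
  then show ?thesis
    by (simp only: euclidean_product_topology limitin_canonical_iff)
qed

lemma tendsto_matrixI:
  fixes f :: "'a \<Rightarrow> 'i \<Rightarrow> 'j \<Rightarrow> 'b::topological_space"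
  assumes "\<And>i j. ((\<lambda>x. f x i j) \<longlongrightarrow> l i j) F"
  shows "(f \<longlongrightarrow> l) F"
  by (intro tendsto_coordinatewiseI assms)

lemma topspace_tree_limits:
  "topspace tree_limits = weak_topology closure_of
     {tau_infinity (rescaled_dist c V E) (uniform_count_measure V) |c (V :: nat set) E. finite_tree V E \<and> c > 0}"
  by (simp add: tree_limits_def Int_absorb1 closure_of_subset_topspace)

text \<open>Every law other than that of a finite tree enters the space in this way: discrete laws
  as limits of finite trees, general laws as limits of discrete ones, and the limit in the
  compactness argument.\<close>

lemma tree_limits_sequentially_closed:
  assumes "limitin weak_topology s l sequentially" "\<And>n. s n \<in> topspace tree_limits"
  shows "l \<in> topspace tree_limits"
  using limitin_closedin[OF assms(1) closedin_closure_of] assms(2)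
  unfolding topspace_tree_limits by auto

lemma sets_large_entry:
  "{A :: 'i \<Rightarrow> 'j \<Rightarrow> real. R < \<bar>A i j\<bar>} \<in> sets borel"
  using borel_measurable_less[OF borel_measurable_const[of R] borel_measurable_abs[OF borel_measurable_entry]]
  by simp

section \<open>A space-filling curve onto the space of matrices\<close>

text \<open>Schoenberg's construction: \<open>plateau\<close> is 2-periodic, vanishes on \<open>[0, 1/3]\<close> and equals 1 on
  \<open>[2/3, 1]\<close>, so \<open>plateau (3 ^ m * t)\<close> reads off the digit of index \<open>m\<close> of a point \<open>t\<close> of the Cantor set.\<close>

definition plateau :: "real \<Rightarrow> real" where
  "plateau t = max 0 (min 1 (1/2 - cos (pi * t)))"

lemma plateau_bounds: "0 \<le> plateau t" "plateau t \<le> 1"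
  by (auto simp: plateau_def)

lemma continuous_on_plateau:
  fixes g :: "real \<Rightarrow> real"
  assumes "continuous_on S g"
  shows "continuous_on S (\<lambda>x. plateau (g x))"
  unfolding plateau_def
  by (intro continuous_on_max continuous_on_min continuous_on_diff continuous_on_const
      continuous_on_cos continuous_on_mult assms)

lemma plateau_periodic: "plateau (2 * of_int n + t) = plateau t"
proof -
  have "cos (pi * (2 * of_int n + t)) = cos (pi * t + 2 * pi * of_int n)"
    by (simp add: algebra_simps)
  also have "\<dots> = cos (pi * t)"
    by (simp add: cos_add cos_int_2pin sin_int_2pin)
  finally show ?thesis by (simp add: plateau_def)
qed

lemma plateau_eq_0: assumes "0 \<le> t" "t \<le> 1/3" shows "plateau t = 0"
proof -
  have "cos (pi/3) \<le> cos (pi * t)"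
    using assms by (intro cos_monotone_0_pi_le) auto
  then show ?thesis by (simp add: plateau_def cos_60)
qed

lemma plateau_eq_1: assumes "2/3 \<le> t" "t \<le> 1" shows "plateau t = 1"
proof -
  have "cos (pi * t) \<le> cos (pi - pi/3)"
    using assms by (intro cos_monotone_0_pi_le) (auto simp: field_simps)
  also have "\<dots> = - (1/2)"
    unfolding cos_diff cos_60 by simp
  finally show ?thesis by (simp add: plateau_def)
qed

definition cantor_point :: "(nat \<Rightarrow> real) \<Rightarrow> real" where
  "cantor_point a = (\<Sum>m. 2 * a m / 3 ^ Suc m)"

context
  fixes a :: "nat \<Rightarrow> real"
  assumes a: "\<And>m. a m \<in> {0, 1}"
begin

lemma summable_cantor: "summable (\<lambda>m. 2 * a m / 3 ^ Suc m)"
proof (rule summable_comparison_test')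
  show "summable (\<lambda>m. 2/3 * (1/3) ^ m :: real)"
    by (intro summable_mult summable_geometric) simp
  show "norm (2 * a m / 3 ^ Suc m) \<le> 2/3 * (1/3) ^ m" if "m \<ge> 0" for m
    using a[of m] by (auto simp: power_one_over field_simps)
qed

lemma cantor_point_bounds: "0 \<le> cantor_point a" "cantor_point a \<le> 1"
proof -
  show "0 \<le> cantor_point a"
    unfolding cantor_point_def
  proof (intro suminf_nonneg summable_cantor)
    show "0 \<le> 2 * a m / 3 ^ Suc m" for m
      using a[of m] by auto
  qed
  have "cantor_point a \<le> (\<Sum>m. 2/3 * (1/3) ^ m)"
    unfolding cantor_point_def
  proof (intro suminf_le summable_cantor)
    show "2 * a m / 3 ^ Suc m \<le> 2/3 * (1/3) ^ m" for m
      using a[of m] by (auto simp: power_one_over field_simps)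
    show "summable (\<lambda>m. 2/3 * (1/3) ^ m :: real)"
      by (intro summable_mult summable_geometric) simp
  qed
  also have "\<dots> = 1"
    by (subst suminf_mult) (auto simp: suminf_geometric)
  finally show "cantor_point a \<le> 1" .
qed

text \<open>The ternary digits move one place to the left. The digit \<open>2 * a 0\<close> that
  leaves the fraction is even, which matches the period of \<open>plateau\<close>.\<close>

lemma cantor_point_shift: "3 * cantor_point a = 2 * a 0 + cantor_point (\<lambda>m. a (Suc m))"
proof -
  have "cantor_point a = 2 * a 0 / 3 + (\<Sum>m. 2 * a (Suc m) / 3 ^ Suc (Suc m))"
    unfolding cantor_point_def using suminf_split_head[OF summable_cantor] by simp
  also have "(\<Sum>m. 2 * a (Suc m) / 3 ^ Suc (Suc m)) = (\<Sum>m. (2 * a (Suc m) / 3 ^ Suc m) / 3)"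
    by (simp add: field_simps)
  also have "\<dots> = cantor_point (\<lambda>m. a (Suc m)) / 3"
  proof -
    have "summable (\<lambda>m. 3 * (2 * a (Suc m) / 3 ^ Suc (Suc m)))"
      by (intro summable_mult summable_cantor[THEN summable_Suc_iff[THEN iffD2]])
    then have "summable (\<lambda>m. 2 * a (Suc m) / 3 ^ Suc m)"
      by simp
    then show ?thesis unfolding cantor_point_def by (rule suminf_divide)
  qed
  finally show ?thesis by simp
qed

end

text \<open>Multiplying by 3 peels off one digit. The integer left over is even and stays even under
  the remaining factor \<open>3 ^ m\<close>, so periodicity hides it. In the base case the point
  lies in the left or the right third of [0, 1] according to \<open>a 0\<close>.\<close>

lemma plateau_cantor_point:
  assumes "\<And>m. a m \<in> {0, 1}"
  shows "plateau (3 ^ m * cantor_point a) = a m"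
  using assms
proof (induction m arbitrary: a)
  case 0
  let ?b = "\<lambda>m. a (Suc m)"
  have b: "\<And>m. ?b m \<in> {0, 1}" using 0 by blast
  have "cantor_point a = (2 * a 0 + cantor_point ?b) / 3"
    using cantor_point_shift[of a] 0 by simp
  then show ?case
    using cantor_point_bounds[of ?b, OF b] 0[of 0] plateau_eq_0[of "cantor_point a"]
      plateau_eq_1[of "cantor_point a"] by auto
next
  case (Suc m)
  let ?b = "\<lambda>m. a (Suc m)"
  have b: "\<And>m. ?b m \<in> {0, 1}" using Suc.prems by blast
  obtain n :: int where n: "a 0 = of_int n"
    using Suc.prems[of 0] by (metis insertE of_int_0 of_int_1 singletonD)
  have "3 ^ Suc m * cantor_point a = 3 ^ m * (3 * cantor_point a)"
    by simp
  also have "\<dots> = 2 * of_int (3 ^ m * n) + 3 ^ m * cantor_point ?b"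
    using cantor_point_shift[of a] Suc.prems by (simp add: n algebra_simps)
  finally have "plateau (3 ^ Suc m * cantor_point a) = plateau (3 ^ m * cantor_point ?b)"
    by (simp only: plateau_periodic)
  then show ?case
    using Suc.IH[OF b] by simp
qed

section \<open>Binary expansions and the coordinates of the curve\<close>

definition digit :: "real \<Rightarrow> nat \<Rightarrow> real" where
  "digit y k = of_int (\<lfloor>2 ^ Suc k * y\<rfloor> mod 2)"

lemma digit_01: "digit y k \<in> {0, 1}"
  by (auto simp: digit_def)

text \<open>Keeping \<open>n\<close> binary digits is rounding down to a multiple of
  \<open>1 / 2 ^ n\<close>: halving the integer part of \<open>2 ^ Suc n * y\<close> gives that of
  \<open>2 ^ n * y\<close>, and the remainder is the next digit.\<close>

lemma digit_partial_sums:
  assumes "0 \<le> y" "y < 1"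
  shows "(\<Sum>k<n. digit y k / 2 ^ Suc k) = of_int \<lfloor>2 ^ n * y\<rfloor> / 2 ^ n"
proof (induction n)
  case 0
  have "\<lfloor>y\<rfloor> = 0" using assms by (simp add: floor_eq_iff)
  then show ?case by simp
next
  case (Suc n)
  have "\<lfloor>2 ^ n * y\<rfloor> = \<lfloor>2 ^ Suc n * y\<rfloor> div 2"
    using floor_divide_real_eq_div[of 2 "2 ^ Suc n * y"] by simp
  moreover have "\<lfloor>2 ^ Suc n * y\<rfloor> = 2 * (\<lfloor>2 ^ Suc n * y\<rfloor> div 2) + \<lfloor>2 ^ Suc n * y\<rfloor> mod 2"
    by simp
  ultimately have "real_of_int \<lfloor>2 ^ Suc n * y\<rfloor> = 2 * of_int \<lfloor>2 ^ n * y\<rfloor> + digit y n"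
    unfolding digit_def by (metis of_int_add of_int_mult of_int_numeral)
  then show ?case
    using Suc by (simp add: field_simps)
qed

lemma digit_sums:
  assumes "0 \<le> y" "y < 1"
  shows "(\<lambda>k. digit y k / 2 ^ Suc k) sums y"
  unfolding sums_def digit_partial_sums[OF assms]
proof (rule tendsto_sandwich)
  show "\<forall>\<^sub>F n in sequentially. y - (1/2) ^ n \<le> of_int \<lfloor>2 ^ n * y\<rfloor> / 2 ^ n"
  proof (rule always_eventually, rule allI)
    fix n
    have "2 ^ n * y - 1 \<le> of_int \<lfloor>2 ^ n * y\<rfloor>" by linarith
    then have "(2 ^ n * y - 1) / 2 ^ n \<le> of_int \<lfloor>2 ^ n * y\<rfloor> / 2 ^ n"
      by (rule divide_right_mono) simp
    then show "y - (1/2) ^ n \<le> of_int \<lfloor>2 ^ n * y\<rfloor> / 2 ^ n"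
      by (simp add: power_one_over diff_divide_distrib)
  qed
  show "\<forall>\<^sub>F n in sequentially. of_int \<lfloor>2 ^ n * y\<rfloor> / 2 ^ n \<le> y"
  proof (rule always_eventually, rule allI)
    fix n
    have "of_int \<lfloor>2 ^ n * y\<rfloor> \<le> 2 ^ n * y" by linarith
    then show "of_int \<lfloor>2 ^ n * y\<rfloor> / 2 ^ n \<le> y"
      by (simp add: field_simps)
  qed
  have "(\<lambda>n. y - (1/2) ^ n) \<longlonglongrightarrow> y - 0"
    by (intro tendsto_intros LIMSEQ_power_zero) auto
  then show "(\<lambda>n. y - (1/2) ^ n) \<longlonglongrightarrow> y" by simp
qed auto

text \<open>Coordinate (i, j) of Schoenberg's curve. The digit positions of the Cantor set are split
  into infinitely many infinite subsequences, one for each pair (i, j), and each is read as a binary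
  expansion.\<close>

definition curve :: "nat \<Rightarrow> nat \<Rightarrow> real \<Rightarrow> real" where
  "curve i j t = (\<Sum>k. plateau (3 ^ prod_encode (prod_encode (i, j), k) * t) / 2 ^ Suc k)"

lemma plateau_series_bound: "norm (plateau t / 2 ^ Suc k) \<le> 1/2 * (1/2) ^ k"
  using plateau_bounds[of t] by (simp add: power_one_over field_simps)

lemma summable_half_powers: "summable (\<lambda>k. 1/2 * (1/2) ^ k :: real)"
  by (intro summable_mult summable_geometric) simp

lemma suminf_half_powers: "(\<Sum>k. 1/2 * (1/2) ^ k :: real) = 1"
  by (subst suminf_mult) (auto simp: suminf_geometric)

lemma continuous_on_curve: "continuous_on UNIV (curve i j)"
proof -
  have "uniform_limit UNIV (\<lambda>n t. \<Sum>k<n. plateau (3 ^ prod_encode (prod_encode (i, j), k) * t) / 2 ^ Suc k)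
    (curve i j) sequentially"
    unfolding curve_def
    by (intro Weierstrass_m_test[OF plateau_series_bound summable_half_powers])
  then show ?thesis
    by (rule uniform_limit_theorem[rotated])
      (auto intro!: continuous_intros continuous_on_plateau always_eventually)
qed

lemma curve_bounds: "0 \<le> curve i j t" "curve i j t \<le> 1"
proof -
  have sm: "summable (\<lambda>k. plateau (3 ^ prod_encode (prod_encode (i, j), k) * t) / 2 ^ Suc k)"
    by (rule summable_comparison_test'[OF summable_half_powers plateau_series_bound])
  show "0 \<le> curve i j t"
    unfolding curve_def by (intro suminf_nonneg sm) (simp add: plateau_bounds)
  have "curve i j t \<le> (\<Sum>k. 1/2 * (1/2) ^ k)"
    unfolding curve_def
  proof (intro suminf_le sm summable_half_powers)
    show "plateau (3 ^ prod_encode (prod_encode (i, j), k) * t) / 2 ^ Suc k \<le> 1/2 * (1/2) ^ k" for k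
      using plateau_series_bound[of "3 ^ prod_encode (prod_encode (i, j), k) * t" k]
        plateau_bounds[of "3 ^ prod_encode (prod_encode (i, j), k) * t"] by simp
  qed
  then show "curve i j t \<le> 1" unfolding suminf_half_powers .
qed

section \<open>Coding matrices by real numbers\<close>

definition squash :: "real \<Rightarrow> real" where
  "squash r = 1/2 + arctan r / pi"

text \<open>The end points 0 and 1 would have to go to infinity. Division by zero inside
  \<open>tan\<close> yields the value 0 there, and these are the discontinuities that a limit law
  has to avoid.\<close>

definition unsquash :: "real \<Rightarrow> real" where
  "unsquash y = tan (pi * (y - 1/2))"

lemma squash_bounds: "0 < squash r" "squash r < 1"
  using arctan_bounded[of r] by (auto simp: squash_def field_simps)

lemma squash_mono: "r \<le> s \<Longrightarrow> squash r \<le> squash s"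
  by (simp add: squash_def divide_right_mono arctan_monotone')

lemma squash_minus: "squash (- r) = 1 - squash r"
  by (simp add: squash_def arctan_minus)

lemma unsquash_squash: "unsquash (squash r) = r"
  by (simp add: squash_def unsquash_def tan_arctan)

lemma isCont_unsquash: assumes "0 < y" "y < 1" shows "isCont unsquash y"
proof -
  have "pi * (y - 1/2) < pi * (1/2)" "pi * (y - 1/2) > pi * (-1/2)"
    using assms by (intro mult_strict_left_mono; simp)+
  then have "cos (pi * (y - 1/2)) > 0"
    by (intro cos_gt_zero_pi) auto
  then show ?thesis
    unfolding unsquash_def by (intro isCont_tan' continuous_intros) auto
qed

text \<open>The binary digits of all squashed entries are interleaved as the digits of one Cantor
  point; the nested \<open>prod_decode\<close> undoes the position
  \<open>prod_encode (prod_encode (i, j), k)\<close> at which \<open>curve\<close> looks. Reading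
  off binary digits is discontinuous, so this right inverse of \<open>matrix_decode\<close> is only
  Borel.\<close>

definition matrix_code :: "(nat \<Rightarrow> nat \<Rightarrow> real) \<Rightarrow> real" where
  "matrix_code A = cantor_point (\<lambda>m. digit (squash
     (A (fst (prod_decode (fst (prod_decode m)))) (snd (prod_decode (fst (prod_decode m))))))
     (snd (prod_decode m)))"

definition matrix_decode :: "real \<Rightarrow> nat \<Rightarrow> nat \<Rightarrow> real" where
  "matrix_decode t = (\<lambda>i j. unsquash (curve i j t))"

lemma matrix_code_bounds: "0 \<le> matrix_code A" "matrix_code A \<le> 1"
  unfolding matrix_code_def by (rule cantor_point_bounds, rule digit_01)+

lemma curve_matrix_code: "curve i j (matrix_code A) = squash (A i j)"
proof -
  have "curve i j (matrix_code A) = (\<Sum>k. digit (squash (A i j)) k / 2 ^ Suc k)"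
    unfolding curve_def matrix_code_def
    by (simp add: plateau_cantor_point[OF digit_01])
  then show ?thesis
    using digit_sums[of "squash (A i j)"] squash_bounds[of "A i j"] by (simp add: sums_iff)
qed

lemma matrix_decode_code: "matrix_decode (matrix_code A) = A"
  by (simp add: matrix_decode_def curve_matrix_code unsquash_squash)

lemma measurable_curve [measurable]: "curve i j \<in> borel_measurable borel"
  by (intro borel_measurable_continuous_onI continuous_on_curve)

lemma measurable_unsquash [measurable]: "unsquash \<in> borel_measurable borel"
  unfolding unsquash_def tan_def
  by (intro borel_measurable_divide borel_measurable_sin borel_measurable_cos borel_measurable_times
      borel_measurable_diff borel_measurable_const) simp_all

lemma measurable_squash [measurable]: "squash \<in> borel_measurable borel"
  unfolding squash_def
  by (intro borel_measurable_continuous_onI continuous_intros) auto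

lemma measurable_digit [measurable]: "(\<lambda>y. digit y k) \<in> borel_measurable borel"
proof -
  have "(\<lambda>y::real. \<lfloor>2 ^ Suc k * y\<rfloor>) \<in> borel \<rightarrow>\<^sub>M count_space UNIV"
    by (intro measurable_compose[OF _ measurable_real_floor] borel_measurable_times borel_measurable_const) simp
  then show ?thesis
    unfolding digit_def by (rule measurable_compose) simp
qed

lemma measurable_matrix_code [measurable]: "matrix_code \<in> borel_measurable borel"
proof -
  have "(\<lambda>A. digit (squash (A i j)) k) \<in> borel_measurable borel" for i j k
    by (intro measurable_compose[OF _ measurable_digit]
        measurable_compose[OF borel_measurable_entry measurable_squash])
  then show ?thesis
    unfolding matrix_code_def cantor_point_def
    by (intro borel_measurable_suminf borel_measurable_divide borel_measurable_times
        borel_measurable_const)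
qed

lemma measurable_matrix_decode [measurable]: "matrix_decode \<in> borel_measurable borel"
  unfolding matrix_decode_def
  by (rule borel_measurable_matrixI)
    (rule measurable_compose[OF measurable_curve measurable_unsquash])

lemma isCont_matrix_decode:
  assumes "\<And>i j. 0 < curve i j t \<and> curve i j t < 1"
  shows "isCont matrix_decode t"
  unfolding isCont_def
proof (rule tendsto_matrixI)
  fix i j
  have "isCont (curve i j) t"
    using continuous_on_curve by (simp add: continuous_on_eq_continuous_at)
  then have "isCont (\<lambda>t. unsquash (curve i j t)) t"
    using isCont_o2 isCont_unsquash assms by blast
  then show "((\<lambda>t. matrix_decode t i j) \<longlongrightarrow> matrix_decode t i j) (at t)"
    by (simp add: matrix_decode_def isCont_def)
qed

section \<open>Prokhorov's theorem for laws of matrices\<close>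

lemma integrable_bounded:
  fixes f :: "'a::topological_space \<Rightarrow> real"
  assumes "\<mu> \<in> prob_measures" "f \<in> borel_measurable borel" "\<And>x. \<bar>f x\<bar> \<le> B"
  shows "integrable \<mu> f"
proof -
  interpret prob_space \<mu> using assms(1) by (simp add: prob_measures_iff)
  have "f \<in> borel_measurable \<mu>"
    using assms by (simp add: prob_measures_iff cong: measurable_cong_sets)
  then show ?thesis
    using assms(3) by (intro integrable_const_bound[of _ B]) auto
qed

text \<open>The laws are carried to [0, 1] by \<open>matrix_code\<close>, where a weak limit
  \<open>M\<close> exists, and \<open>M\<close> is carried back by \<open>matrix_decode\<close>.
  Since decoding undoes coding, the integral of \<open>f\<close> against an original law is the
  integral of \<open>f (matrix_decode t)\<close> against the coded one, and this integrand is
  continuous up to a null set of \<open>M\<close>.\<close>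

lemma tight_imp_convergent_subsequence:
  fixes \<mu> :: "nat \<Rightarrow> (nat \<Rightarrow> nat \<Rightarrow> real) measure"
  assumes \<mu>: "\<And>n. \<mu> n \<in> prob_measures"
    and tight_entries: "\<And>i j \<epsilon>. 0 < \<epsilon> \<Longrightarrow> \<exists>R. \<forall>n. measure (\<mu> n) {A. R < \<bar>A i j\<bar>} \<le> \<epsilon>"
  obtains r l where "strict_mono r" "limitin weak_topology (\<mu> \<circ> r) l sequentially"
proof -
  have prob: "prob_space (\<mu> n)" and sets: "sets (\<mu> n) = sets borel" for n
    using \<mu>[of n] by (auto simp: prob_measures_iff)
  have space: "space (\<mu> n) = UNIV" for n
    using sets_eq_imp_space_eq[OF sets[of n]] by simp
  have code: "matrix_code \<in> borel_measurable (\<mu> n)" for n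
    by (simp add: sets cong: measurable_cong_sets)
  define \<nu> where "\<nu> n = distr (\<mu> n) borel matrix_code" for n
  have \<nu>: "real_distribution (\<nu> n)" for n
    unfolding \<nu>_def by (rule prob_space.real_distribution_distr[OF prob code])
  \<comment> \<open>Any bounded interval around [0, 1] shows tightness on the line. It starts at -1
    because \<open>tight\<close> uses intervals open on the left and the code may be 0.\<close>
  have "measure (\<nu> n) {-1<..1} > 1 - \<epsilon>" if "\<epsilon> > 0" for n and \<epsilon> :: real
  proof -
    have "-1 < matrix_code A" for A
      using matrix_code_bounds(1)[of A] by linarith
    then have "matrix_code -` {-1<..1} = UNIV"
      by (auto simp: matrix_code_bounds)
    then have "measure (\<nu> n) {-1<..1} = 1"
      unfolding \<nu>_def using prob_space.prob_space[OF prob[of n]] code[of n]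
      by (simp add: measure_distr space)
    then show ?thesis using that by simp
  qed
  then have "tight \<nu>"
    unfolding tight_def using \<nu> by (metis neg_less_iff_less zero_less_one less_trans neg_less_0_iff_less)
  then obtain r M where r: "strict_mono r" and M: "real_distribution M"
    and conv: "weak_conv_m (\<nu> \<circ> r) M"
    using tight_imp_convergent_subsubsequence[of \<nu> id] by (auto simp: strict_mono_id)
  interpret M: real_distribution M by fact
  have \<nu>r: "real_distribution ((\<nu> \<circ> r) n)" for n by (simp add: \<nu>)
  have integral_\<nu>: "integral\<^sup>L (\<nu> n) g = integral\<^sup>L (\<mu> n) (\<lambda>A. g (matrix_code A))"
    if "g \<in> borel_measurable borel" for g :: "real \<Rightarrow> real" and n
    unfolding \<nu>_def by (rule integral_distr[OF code that])
  \<comment> \<open>Mass of \<open>M\<close> where a coordinate of the curve is 0 or 1 would be mass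
    that the entry (i, j) loses to infinity.\<close>
  have null: "measure M {t. curve i j t \<in> {0, 1}} = 0" for i j
  proof (rule antisym, rule field_le_epsilon)
    fix \<epsilon> :: real assume "0 < \<epsilon>"
    then obtain R where R: "measure (\<mu> n) {A. R < \<bar>A i j\<bar>} \<le> \<epsilon>" for n
      using tight_entries by blast
    \<comment> \<open>An entry of modulus at most \<open>R\<close> is squashed into
      [\<eta>, 1 - \<eta>].\<close>
    define \<eta> where "\<eta> = squash (- R)"
    have \<eta>: "0 < \<eta>" by (simp add: \<eta>_def squash_bounds)
    \<comment> \<open>A continuous bump that is 1 where the coordinate is 0 or 1 and vanishes where
      it lies in [\<eta>, 1 - \<eta>]. Under the coded laws its integral is bounded by the tail of
      the entry, under \<open>M\<close> it bounds the mass in question, and weak convergence links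
      the two.\<close>
    define u where "u t = max 0 (1 - min (curve i j t) (1 - curve i j t) / \<eta>)" for t
    have u_cont: "continuous_on UNIV u"
      unfolding u_def using \<eta> by (intro continuous_intros continuous_on_curve) auto
    then have u_meas: "u \<in> borel_measurable borel"
      by (rule borel_measurable_continuous_onI)
    have u01: "0 \<le> u t" "u t \<le> 1" for t
      using curve_bounds[of i j t] \<eta> by (auto simp: u_def)
    have big: "{A. R < \<bar>A i j\<bar>} \<in> sets borel"
      by (rule sets_large_entry)
    have "integral\<^sup>L (\<nu> n) u \<le> \<epsilon>" for n
    proof -
      have uR: "u (matrix_code A) \<le> indicator {A. R < \<bar>A i j\<bar>} A" for A
      proof (cases "R < \<bar>A i j\<bar>")
        case False
        then have "squash (- R) \<le> squash (A i j)" "squash (A i j) \<le> squash R"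
          by (auto intro!: squash_mono)
        then have "1 \<le> min (squash (A i j)) (1 - squash (A i j)) / \<eta>"
          using \<eta> squash_minus[of R] by (simp add: \<eta>_def)
        then show ?thesis using False by (simp add: u_def curve_matrix_code)
      qed (use u01 in auto)
      have "integral\<^sup>L (\<nu> n) u = integral\<^sup>L (\<mu> n) (\<lambda>A. u (matrix_code A))"
        by (rule integral_\<nu>[OF u_meas])
      also have "\<dots> \<le> integral\<^sup>L (\<mu> n) (indicator {A. R < \<bar>A i j\<bar>})"
      proof (rule integral_mono)
        have "(\<lambda>A. u (matrix_code A)) \<in> borel_measurable borel"
          by (rule measurable_compose[OF measurable_matrix_code u_meas])
        then show "integrable (\<mu> n) (\<lambda>A. u (matrix_code A))"
          using u01 by (intro integrable_bounded[where B=1] \<mu>) auto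
        show "integrable (\<mu> n) (indicator {A. R < \<bar>A i j\<bar>} :: _ \<Rightarrow> real)"
          using big by (intro integrable_bounded[where B=1] \<mu> borel_measurable_indicator)
            (auto simp: indicator_def)
      qed (rule uR)
      also have "\<dots> = measure (\<mu> n) {A. R < \<bar>A i j\<bar>}"
        using big by (simp add: sets space)
      finally show ?thesis using R[of n] by simp
    qed
    moreover have "(\<lambda>n. integral\<^sup>L ((\<nu> \<circ> r) n) u) \<longlonglongrightarrow> integral\<^sup>L M u"
      using u_cont u01
      by (intro weak_conv_imp_integral_bdd_continuous_conv[OF \<nu>r M conv, of u 1])
        (auto simp: continuous_on_eq_continuous_at)
    ultimately have "integral\<^sup>L M u \<le> \<epsilon>"
      by (intro LIMSEQ_le_const2[of "\<lambda>n. integral\<^sup>L ((\<nu> \<circ> r) n) u"]) auto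
    moreover have "measure M {t. curve i j t \<in> {0, 1}} \<le> integral\<^sup>L M u"
    proof -
      have Z: "{t. curve i j t \<in> {0, 1}} \<in> sets borel"
        using measurable_sets[OF measurable_curve, of "{0,1}" i j] by (simp add: vimage_def)
      then have "measure M {t. curve i j t \<in> {0, 1}} = integral\<^sup>L M (indicator {t. curve i j t \<in> {0, 1}})"
        by simp
      also have "\<dots> \<le> integral\<^sup>L M u"
        using Z u_meas u01 \<eta>
        by (intro integral_mono M.integrable_const_bound[of _ 1])
          (auto simp: indicator_def u_def simp del: max.absorb1 max.absorb2)
      finally show ?thesis .
    qed
    ultimately show "measure M {t. curve i j t \<in> {0, 1}} \<le> 0 + \<epsilon>" by simp
  qed simp
  define l where "l = distr M borel matrix_decode"
  have "l \<in> prob_measures"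
    by (simp add: l_def prob_measures_iff M.prob_space_distr)
  moreover have "(\<lambda>n. integral\<^sup>L ((\<mu> \<circ> r) n) f) \<longlonglongrightarrow> integral\<^sup>L l f"
    if f: "continuous_on UNIV f" "bounded (range f)" for f :: "_ \<Rightarrow> real"
  proof -
    obtain B where B: "\<bar>f A\<bar> \<le> B" for A
      using f(2) by (auto simp: bounded_iff)
    have f_meas: "f \<in> borel_measurable borel"
      by (rule borel_measurable_continuous_onI[OF f(1)])
    let ?g = "\<lambda>t. f (matrix_decode t)"
    have g_meas: "?g \<in> borel_measurable borel"
      by (rule measurable_compose[OF measurable_matrix_decode f_meas])
    have "emeasure M (\<Union>i j. {t. curve i j t \<in> {0, 1}}) = 0"
    proof -
      have "{t. curve i j t \<in> {0, 1}} \<in> null_sets M" for i j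
        using null[of i j] measurable_sets[OF measurable_curve, of "{0,1}" i j]
        by (intro null_setsI) (simp_all add: M.emeasure_eq_measure vimage_def)
      then show ?thesis by (intro null_setsD1 null_sets_UN) auto
    qed
    moreover have "{t. \<not> isCont ?g t} \<subseteq> (\<Union>i j. {t. curve i j t \<in> {0, 1}})"
    proof (rule subsetI, rule ccontr)
      fix t assume t: "t \<in> {t. \<not> isCont ?g t}" "t \<notin> (\<Union>i j. {t. curve i j t \<in> {0, 1}})"
      then have "0 < curve i j t \<and> curve i j t < 1" for i j
        using curve_bounds[of i j t] by (auto simp: less_le)
      then have "isCont matrix_decode t" by (rule isCont_matrix_decode)
      then have "isCont ?g t"
        using f(1) by (auto intro!: isCont_o2[of t matrix_decode f] simp: continuous_on_eq_continuous_at)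
      with t show False by simp
    qed
    moreover have "(\<Union>i j. {t. curve i j t \<in> {0, 1}}) \<in> sets M"
      using measurable_sets[OF measurable_curve, of "{0,1}"]
      by (auto simp: vimage_def intro!: sets.countable_UN)
    ultimately have "emeasure M {t. \<not> isCont ?g t} = 0"
      by (metis emeasure_mono le_zero_eq)
    then have "(\<lambda>n. integral\<^sup>L ((\<nu> \<circ> r) n) ?g) \<longlonglongrightarrow> integral\<^sup>L M ?g"
      using B g_meas
      by (intro weak_conv_imp_bdd_ae_continuous_conv[OF \<nu>r M conv, of ?g B]) auto
    moreover have "integral\<^sup>L M ?g = integral\<^sup>L l f"
      unfolding l_def by (rule integral_distr[symmetric, OF _ f_meas]) simp
    ultimately show ?thesis
      by (simp add: integral_\<nu>[OF g_meas] matrix_decode_code)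
  qed
  ultimately have "limitin weak_topology (\<mu> \<circ> r) l sequentially"
    unfolding limitin_weak_topology using \<mu> by simp
  with r that show ?thesis by blast
qed

section \<open>Laws of random distance matrices\<close>

abbreviation iid_power :: "'x measure \<Rightarrow> (nat \<Rightarrow> 'x) measure" where
  "iid_power m \<equiv> Pi\<^sub>M UNIV (\<lambda>_. m)"

lemma product_prob_space_const: "prob_space m \<Longrightarrow> product_prob_space (\<lambda>_. m)"
  by (simp add: product_prob_space_def product_prob_space_axioms_def product_sigma_finite_def
      prob_space_imp_sigma_finite)

lemma prob_space_iid_power: "prob_space m \<Longrightarrow> prob_space (iid_power m)"
  by (rule prob_space_PiM)

text \<open>Finite-dimensional rectangles determine the product law. Writing them as sets of full
  sequences instead of \<open>prod_emb\<close> avoids restrictions to finite index sets later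
  on.\<close>

lemma iid_power_eqI:
  assumes m: "prob_space m" and M: "sets M = sets (iid_power m)"
    and eq: "\<And>J A. finite J \<Longrightarrow> (\<And>j. j \<in> J \<Longrightarrow> A j \<in> sets m) \<Longrightarrow>
      emeasure M {x \<in> space M. \<forall>j\<in>J. x j \<in> A j} = (\<Prod>j\<in>J. emeasure m (A j))"
  shows "M = iid_power m"
proof -
  interpret product_prob_space "\<lambda>_. m" UNIV using m by (rule product_prob_space_const)
  have "prod_emb UNIV (\<lambda>_. m) J (Pi\<^sub>E J A) = {x \<in> space M. \<forall>j\<in>J. x j \<in> A j}" for J :: "nat set" and A
    unfolding sets_eq_imp_space_eq[OF M] by (auto simp: prod_emb_def space_PiM)
  then show ?thesis
    by (intro PiM_eq M) (simp add: eq)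
qed

lemma emeasure_iid_power:
  assumes "prob_space m" "finite J" "\<And>j. j \<in> J \<Longrightarrow> A j \<in> sets m"
  shows "emeasure (iid_power m) {x \<in> space (iid_power m). \<forall>j\<in>J. x j \<in> A j} = (\<Prod>j\<in>J. emeasure m (A j))"
proof -
  interpret product_prob_space "\<lambda>_. m" UNIV using assms(1) by (rule product_prob_space_const)
  show ?thesis using assms by (intro emeasure_PiM_Collect) auto
qed

lemma measurable_coordinate: "(\<lambda>x. x i) \<in> iid_power m \<rightarrow>\<^sub>M m"
  by (rule measurable_component_singleton) simp

lemma measurable_map_iid_power:
  assumes \<phi>: "\<phi> \<in> m \<rightarrow>\<^sub>M m'"
  shows "(\<lambda>x i. \<phi> (x i)) \<in> iid_power m \<rightarrow>\<^sub>M iid_power m'"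
  by (rule measurable_PiM_single')
    (auto intro!: measurable_compose[OF measurable_coordinate \<phi>]
      simp: space_PiM measurable_space[OF \<phi>] PiE_iff)

lemma distr_iid_power:
  assumes m: "prob_space m" and \<phi>: "\<phi> \<in> m \<rightarrow>\<^sub>M m'"
  shows "distr (iid_power m) (iid_power m') (\<lambda>x i. \<phi> (x i)) = iid_power (distr m m' \<phi>)"
proof (rule iid_power_eqI)
  note map = measurable_map_iid_power[OF \<phi>]
  show "prob_space (distr m m' \<phi>)" by (rule prob_space.prob_space_distr[OF m \<phi>])
  show "sets (distr (iid_power m) (iid_power m') (\<lambda>x i. \<phi> (x i))) = sets (iid_power (distr m m' \<phi>))"
    by (simp cong: sets_PiM_cong)
  fix J :: "nat set" and A
  assume J: "finite J" and A: "\<And>j. j \<in> J \<Longrightarrow> A j \<in> sets (distr m m' \<phi>)"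
  let ?B = "{y \<in> space (iid_power m'). \<forall>j\<in>J. y j \<in> A j}"
  have B: "?B \<in> sets (iid_power m')"
    using J A by (intro sets.sets_Collect_finite_All sets_Collect_single) auto
  have "emeasure (distr (iid_power m) (iid_power m') (\<lambda>x i. \<phi> (x i))) ?B =
      emeasure (iid_power m) ((\<lambda>x i. \<phi> (x i)) -` ?B \<inter> space (iid_power m))"
    by (rule emeasure_distr[OF map B])
  also have "(\<lambda>x i. \<phi> (x i)) -` ?B \<inter> space (iid_power m) =
      {x \<in> space (iid_power m). \<forall>j\<in>J. x j \<in> \<phi> -` A j \<inter> space m}"
    using measurable_space[OF map] by (auto simp: space_PiM)
  also have "emeasure (iid_power m) \<dots> = (\<Prod>j\<in>J. emeasure m (\<phi> -` A j \<inter> space m))"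
    using A by (intro emeasure_iid_power m J measurable_sets[OF \<phi>]) auto
  also have "\<dots> = (\<Prod>j\<in>J. emeasure (distr m m' \<phi>) (A j))"
    using A by (intro prod.cong emeasure_distr[OF \<phi>, symmetric]) auto
  finally show "emeasure (distr (iid_power m) (iid_power m') (\<lambda>x i. \<phi> (x i)))
      {x \<in> space (distr (iid_power m) (iid_power m') (\<lambda>x i. \<phi> (x i))). \<forall>j\<in>J. x j \<in> A j} =
      (\<Prod>j\<in>J. emeasure (distr m m' \<phi>) (A j))" by simp
qed

lemma distr_iid_power_pair:
  assumes m: "prob_space m" and ij: "i \<noteq> j"
  shows "distr (iid_power m) (m \<Otimes>\<^sub>M m) (\<lambda>x. (x i, x j)) = m \<Otimes>\<^sub>M m"
proof (rule pair_measure_eqI[symmetric])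
  show "sigma_finite_measure m" "sigma_finite_measure m"
    using m by (auto intro: prob_space_imp_sigma_finite)
  have meas: "(\<lambda>x. (x i, x j)) \<in> iid_power m \<rightarrow>\<^sub>M m \<Otimes>\<^sub>M m"
    by (intro measurable_Pair measurable_coordinate)
  fix A B assume AB: "A \<in> sets m" "B \<in> sets m"
  have "emeasure (distr (iid_power m) (m \<Otimes>\<^sub>M m) (\<lambda>x. (x i, x j))) (A \<times> B) =
      emeasure (iid_power m) {x \<in> space (iid_power m). \<forall>k\<in>{i, j}. x k \<in> (if k = i then A else B)}"
    using AB ij by (subst emeasure_distr[OF meas]) (auto intro!: arg_cong2[where f=emeasure])
  also have "\<dots> = (\<Prod>k\<in>{i, j}. emeasure m (if k = i then A else B))"
    using AB by (intro emeasure_iid_power m) auto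
  also have "\<dots> = emeasure m A * emeasure m B"
    using ij by simp
  finally show "emeasure m A * emeasure m B =
      emeasure (distr (iid_power m) (m \<Otimes>\<^sub>M m) (\<lambda>x. (x i, x j))) (A \<times> B)" by simp
qed simp

lemma iid_sequence_law:
  assumes "iid_sequence \<Omega> m \<xi>"
  shows "(\<lambda>\<omega> k. \<xi> k \<omega>) \<in> \<Omega> \<rightarrow>\<^sub>M iid_power m"
    and "distr \<Omega> (iid_power m) (\<lambda>\<omega> k. \<xi> k \<omega>) = iid_power m"
proof -
  interpret prob_space \<Omega> using assms by (simp add: iid_sequence_def)
  have indep: "indep_vars (\<lambda>_. m) \<xi> UNIV" and law: "\<And>i. distr \<Omega> m (\<xi> i) = m"
    using assms by (auto simp: iid_sequence_def)
  then have rv: "random_variable m (\<xi> i)" for i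
    by (simp add: indep_vars_def)
  show "(\<lambda>\<omega> k. \<xi> k \<omega>) \<in> \<Omega> \<rightarrow>\<^sub>M iid_power m"
    using rv by (intro measurable_PiM_single') (auto dest: measurable_space)
  show "distr \<Omega> (iid_power m) (\<lambda>\<omega> k. \<xi> k \<omega>) = iid_power m"
    using indep_vars_iff_distr_eq_PiM[of UNIV \<xi> "\<lambda>_. m"] rv indep law by (simp add: restrict_UNIV)
qed

text \<open>The frame for every law that occurs: besides the given spaces it is instantiated with
  kernels on (0, 1) and on \<open>nat\<close>. Joint measurability makes the \<open>distr\<close> in
  \<open>tau_infinity\<close> a genuine image law.\<close>

locale sample_kernel = prob_space m for m :: "'x measure" +
  fixes \<delta> :: "'x \<Rightarrow> 'x \<Rightarrow> real"
  assumes measurable_kernel: "(\<lambda>(x, y). \<delta> x y) \<in> borel_measurable (m \<Otimes>\<^sub>M m)"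
begin

lemma measurable_dist_matrix: "dist_matrix \<delta> \<in> borel_measurable (iid_power m)"
proof (rule borel_measurable_matrixI)
  fix i j
  show "(\<lambda>x. dist_matrix \<delta> x i j) \<in> borel_measurable (iid_power m)"
  proof (cases "i = j")
    case False
    have "(\<lambda>x. (x i, x j)) \<in> iid_power m \<rightarrow>\<^sub>M m \<Otimes>\<^sub>M m"
      by (intro measurable_Pair measurable_coordinate)
    from measurable_compose[OF this measurable_kernel] show ?thesis
      using False by (simp add: dist_matrix_def)
  qed (simp add: dist_matrix_def)
qed

lemma tau_infinity_prob: "tau_infinity \<delta> m \<in> prob_measures"
  unfolding tau_infinity_def prob_measures_iff
  using prob_space.prob_space_distr[OF prob_space_iid_power measurable_dist_matrix]
  by (simp add: prob_space_axioms)

lemma integral_tau_infinity: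
  fixes f :: "_ \<Rightarrow> real"
  assumes "f \<in> borel_measurable borel"
  shows "integral\<^sup>L (tau_infinity \<delta> m) f = integral\<^sup>L (iid_power m) (\<lambda>x. f (dist_matrix \<delta> x))"
  unfolding tau_infinity_def by (rule integral_distr[OF measurable_dist_matrix assms])

lemma tau_infinity_sample:
  assumes "iid_sequence \<Omega> m \<xi>"
  shows "(\<lambda>\<omega>. dist_matrix \<delta> (\<lambda>k. \<xi> k \<omega>)) \<in> borel_measurable \<Omega>"
    and "tau_infinity \<delta> m = distr \<Omega> borel (\<lambda>\<omega>. dist_matrix \<delta> (\<lambda>k. \<xi> k \<omega>))"
proof -
  show "(\<lambda>\<omega>. dist_matrix \<delta> (\<lambda>k. \<xi> k \<omega>)) \<in> borel_measurable \<Omega>"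
    using measurable_compose[OF iid_sequence_law(1)[OF assms] measurable_dist_matrix] .
  have "tau_infinity \<delta> m = distr (distr \<Omega> (iid_power m) (\<lambda>\<omega> k. \<xi> k \<omega>)) borel (dist_matrix \<delta>)"
    by (simp add: tau_infinity_def iid_sequence_law(2)[OF assms])
  also have "\<dots> = distr \<Omega> borel (\<lambda>\<omega>. dist_matrix \<delta> (\<lambda>k. \<xi> k \<omega>))"
    by (subst distr_distr[OF measurable_dist_matrix iid_sequence_law(1)[OF assms]]) (simp add: comp_def)
  finally show "tau_infinity \<delta> m = distr \<Omega> borel (\<lambda>\<omega>. dist_matrix \<delta> (\<lambda>k. \<xi> k \<omega>))" .
qed

lemma measure_tau_infinity_entry:
  assumes "i \<noteq> j" "B \<in> sets borel"
  shows "measure (tau_infinity \<delta> m) {A. A i j \<in> B} =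
    measure (m \<Otimes>\<^sub>M m) {p \<in> space (m \<Otimes>\<^sub>M m). \<delta> (fst p) (snd p) \<in> B}"
proof -
  have pair: "(\<lambda>x. (x i, x j)) \<in> iid_power m \<rightarrow>\<^sub>M m \<Otimes>\<^sub>M m"
    by (intro measurable_Pair measurable_coordinate)
  have 1: "{A :: nat \<Rightarrow> nat \<Rightarrow> real. A i j \<in> B} \<in> sets borel"
    using measurable_sets[OF borel_measurable_entry assms(2), of i j] by (simp add: vimage_def)
  have 2: "{p \<in> space (m \<Otimes>\<^sub>M m). \<delta> (fst p) (snd p) \<in> B} \<in> sets (m \<Otimes>\<^sub>M m)"
    using measurable_sets[OF measurable_kernel assms(2)]
    by (simp add: vimage_def case_prod_beta Int_def conj_commute)
  have "measure (tau_infinity \<delta> m) {A. A i j \<in> B} =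
      measure (iid_power m) (dist_matrix \<delta> -` {A. A i j \<in> B} \<inter> space (iid_power m))"
    unfolding tau_infinity_def by (rule measure_distr[OF measurable_dist_matrix 1])
  also have "dist_matrix \<delta> -` {A. A i j \<in> B} \<inter> space (iid_power m) =
      (\<lambda>x. (x i, x j)) -` {p \<in> space (m \<Otimes>\<^sub>M m). \<delta> (fst p) (snd p) \<in> B} \<inter> space (iid_power m)"
    using assms(1) by (auto simp: dist_matrix_def space_pair_measure space_PiM)
  also have "measure (iid_power m) \<dots> =
      measure (distr (iid_power m) (m \<Otimes>\<^sub>M m) (\<lambda>x. (x i, x j)))
        {p \<in> space (m \<Otimes>\<^sub>M m). \<delta> (fst p) (snd p) \<in> B}"
    by (rule measure_distr[OF pair 2, symmetric])
  finally show ?thesis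
    by (simp add: distr_iid_power_pair[OF prob_space_axioms assms(1)])
qed

end

text \<open>Applying \<phi> to each term of an i.i.d. sequence gives an i.i.d. sequence of the image
  law. Read from right to left, this realises laws on different spaces over one source of
  randomness.\<close>

lemma tau_infinity_comp:
  assumes m: "prob_space m" and \<phi>: "\<phi> \<in> m \<rightarrow>\<^sub>M m'" and "sample_kernel (distr m m' \<phi>) \<delta>"
  shows "tau_infinity (\<lambda>x y. \<delta> (\<phi> x) (\<phi> y)) m = tau_infinity \<delta> (distr m m' \<phi>)"
proof -
  interpret K: sample_kernel "distr m m' \<phi>" \<delta> by fact
  note map = measurable_map_iid_power[OF \<phi>]
  have "dist_matrix \<delta> \<in> borel_measurable (iid_power m')"
    using K.measurable_dist_matrix by (simp cong: measurable_cong_sets sets_PiM_cong)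
  then have "distr (distr (iid_power m) (iid_power m') (\<lambda>x i. \<phi> (x i))) borel (dist_matrix \<delta>) =
      distr (iid_power m) borel (\<lambda>x. dist_matrix \<delta> (\<lambda>i. \<phi> (x i)))"
    using map by (simp add: distr_distr comp_def)
  moreover have "dist_matrix \<delta> (\<lambda>i. \<phi> (x i)) = dist_matrix (\<lambda>x y. \<delta> (\<phi> x) (\<phi> y)) x" for x
    by (simp add: dist_matrix_def)
  ultimately show ?thesis
    by (simp add: tau_infinity_def distr_iid_power[OF m \<phi>])
qed

text \<open>Two different coordinates of the sample have law \<open>m \<Otimes>\<^sub>M m\<close>,
  so each off-diagonal entry converges almost surely. The countably many entries do so together,
  which is convergence in the product topology, and dominated convergence handles bounded continuous
  functions of the matrix.\<close>

lemma limitin_tau_infinity: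
  assumes \<kappa>: "\<And>n :: nat. sample_kernel m (\<kappa> n)" "sample_kernel m \<delta>"
    and conv: "AE p in m \<Otimes>\<^sub>M m. (\<lambda>n. \<kappa> n (fst p) (snd p)) \<longlonglongrightarrow> \<delta> (fst p) (snd p)"
  shows "limitin weak_topology (\<lambda>n. tau_infinity (\<kappa> n) m) (tau_infinity \<delta> m) sequentially"
  unfolding limitin_weak_topology
proof (intro conjI allI impI)
  have m: "prob_space m"
    using \<kappa>(2) by (simp add: sample_kernel_def)
  interpret \<kappa>: sample_kernel m "\<kappa> n" for n by fact
  interpret \<delta>: sample_kernel m \<delta> by fact
  show "tau_infinity \<delta> m \<in> prob_measures" "\<forall>\<^sub>F n in sequentially. tau_infinity (\<kappa> n) m \<in> prob_measures"
    by (simp_all add: \<delta>.tau_infinity_prob \<kappa>.tau_infinity_prob)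
  fix f :: "(nat \<Rightarrow> nat \<Rightarrow> real) \<Rightarrow> real"
  assume f: "continuous_on UNIV f \<and> bounded (range f)"
  then obtain B where B: "\<And>A. norm (f A) \<le> B"
    by (auto simp: bounded_iff)
  have f_meas: "f \<in> borel_measurable borel"
    using f by (intro borel_measurable_continuous_onI) simp
  interpret P: prob_space "iid_power m"
    by (rule prob_space_iid_power[OF m])
  have entry: "AE x in iid_power m. (\<lambda>n. dist_matrix (\<kappa> n) x i j) \<longlonglongrightarrow> dist_matrix \<delta> x i j" for i j
  proof (cases "i = j")
    case False
    have pair: "(\<lambda>x. (x i, x j)) \<in> iid_power m \<rightarrow>\<^sub>M m \<Otimes>\<^sub>M m"
      by (intro measurable_Pair measurable_coordinate)
    have "AE p in distr (iid_power m) (m \<Otimes>\<^sub>M m) (\<lambda>x. (x i, x j)).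
        (\<lambda>n. \<kappa> n (fst p) (snd p)) \<longlonglongrightarrow> \<delta> (fst p) (snd p)"
      unfolding distr_iid_power_pair[OF m False] by (rule conv)
    from AE_distrD[OF pair this] show ?thesis
      using False by (simp add: dist_matrix_def)
  qed (simp add: dist_matrix_def)
  then have "AE x in iid_power m. \<forall>i j. (\<lambda>n. dist_matrix (\<kappa> n) x i j) \<longlonglongrightarrow> dist_matrix \<delta> x i j"
    by (simp add: AE_all_countable)
  then have AE_conv: "AE x in iid_power m. (\<lambda>n. f (dist_matrix (\<kappa> n) x)) \<longlonglongrightarrow> f (dist_matrix \<delta> x)"
  proof eventually_elim
    case (elim x)
    then have "(\<lambda>n. dist_matrix (\<kappa> n) x) \<longlonglongrightarrow> dist_matrix \<delta> x"
      by (intro tendsto_matrixI) simp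
    moreover have "isCont f (dist_matrix \<delta> x)"
      using f by (simp add: continuous_on_eq_continuous_at)
    ultimately show ?case by (rule isCont_tendsto_compose[rotated])
  qed
  have "(\<lambda>n. integral\<^sup>L (iid_power m) (\<lambda>x. f (dist_matrix (\<kappa> n) x)))
      \<longlonglongrightarrow> integral\<^sup>L (iid_power m) (\<lambda>x. f (dist_matrix \<delta> x))"
    using B AE_conv
    by (intro integral_dominated_convergence[where w="\<lambda>_. B"])
      (auto intro: measurable_compose[OF \<kappa>.measurable_dist_matrix f_meas]
        measurable_compose[OF \<delta>.measurable_dist_matrix f_meas])
  then show "(\<lambda>n. integral\<^sup>L (tau_infinity (\<kappa> n) m) f) \<longlonglongrightarrow> integral\<^sup>L (tau_infinity \<delta> m) f"
    by (simp add: \<kappa>.integral_tau_infinity[OF f_meas] \<delta>.integral_tau_infinity[OF f_meas])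
qed

section \<open>Tightness\<close>

text \<open>Both terms on the right of the triangle inequality have \<open>z\<close> as second
  argument, the shape of the sections below. The value \<open>\<delta> x x\<close> is left free: at
  a point (x, a) of a long dendron it is \<open>2 * a\<close>.\<close>

locale distance_kernel = sample_kernel +
  assumes nonneg: "x \<in> space m \<Longrightarrow> y \<in> space m \<Longrightarrow> 0 \<le> \<delta> x y"
    and triangle: "x \<in> space m \<Longrightarrow> y \<in> space m \<Longrightarrow> z \<in> space m \<Longrightarrow> \<delta> x y \<le> \<delta> x z + \<delta> y z"

definition pair_tail :: "('x \<Rightarrow> 'x \<Rightarrow> real) \<Rightarrow> 'x measure \<Rightarrow> real \<Rightarrow> real" where
  "pair_tail \<delta> m R = measure (m \<Otimes>\<^sub>M m) {p \<in> space (m \<Otimes>\<^sub>M m). R < \<delta> (fst p) (snd p)}"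

context distance_kernel
begin

sublocale PP: pair_prob_space m m ..

lemma sets_pair_tail: "{p \<in> space (m \<Otimes>\<^sub>M m). R < \<delta> (fst p) (snd p)} \<in> sets (m \<Otimes>\<^sub>M m)"
  using measurable_sets[OF measurable_kernel, of "{R<..}"]
  by (simp add: vimage_def case_prod_beta Int_def conj_commute)

lemma measurable_section: "z \<in> space m \<Longrightarrow> (\<lambda>x. \<delta> x z) \<in> borel_measurable m"
  using measurable_compose[OF measurable_Pair2' measurable_kernel] by simp

lemma sets_section: "z \<in> space m \<Longrightarrow> {y \<in> space m. R < \<delta> y z} \<in> sets m"
  using measurable_sets[OF measurable_section, of z "{R<..}"]
  by (simp add: vimage_def Int_def conj_commute)

lemma pair_tail_nonneg: "0 \<le> pair_tail \<delta> m R"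
  by (simp add: pair_tail_def)

lemma measure_tau_infinity_tail:
  assumes "i \<noteq> j"
  shows "measure (tau_infinity \<delta> m) {A. R < \<bar>A i j\<bar>} = pair_tail \<delta> m R"
proof -
  have "measure (tau_infinity \<delta> m) {A. A i j \<in> {r. R < \<bar>r\<bar>}} =
      measure (m \<Otimes>\<^sub>M m) {p \<in> space (m \<Otimes>\<^sub>M m). \<delta> (fst p) (snd p) \<in> {r. R < \<bar>r\<bar>}}"
    using borel_measurable_less[OF borel_measurable_const[of R] borel_measurable_abs[OF measurable_ident_sets]]
    by (intro measure_tau_infinity_entry assms) (simp add: space_borel)
  also have "{p \<in> space (m \<Otimes>\<^sub>M m). \<delta> (fst p) (snd p) \<in> {r. R < \<bar>r\<bar>}} =
      {p \<in> space (m \<Otimes>\<^sub>M m). R < \<delta> (fst p) (snd p)}"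
    using nonneg by (auto simp: space_pair_measure)
  finally show ?thesis by (simp add: pair_tail_def)
qed

lemma measure_tau_infinity_tail_le:
  assumes "0 \<le> R"
  shows "measure (tau_infinity \<delta> m) {A. R < \<bar>A i j\<bar>} \<le> pair_tail \<delta> m R"
proof (cases "i = j")
  case True
  have "measure (tau_infinity \<delta> m) {A. R < \<bar>A i j\<bar>} =
      measure (iid_power m) (dist_matrix \<delta> -` {A. R < \<bar>A i j\<bar>} \<inter> space (iid_power m))"
    unfolding tau_infinity_def by (rule measure_distr[OF measurable_dist_matrix sets_large_entry])
  also have "dist_matrix \<delta> -` {A. R < \<bar>A i j\<bar>} \<inter> space (iid_power m) = {}"
    using True assms by (auto simp: dist_matrix_def)
  finally show ?thesis by (simp add: pair_tail_nonneg)
qed (simp add: measure_tau_infinity_tail)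

lemma pair_tail_antimono:
  assumes "R \<le> S"
  shows "pair_tail \<delta> m S \<le> pair_tail \<delta> m R"
  unfolding pair_tail_def using assms
  by (intro PP.P.finite_measure_mono sets_pair_tail) auto

lemma measure_cylinder:
  assumes "B \<in> sets m"
  shows "measure (m \<Otimes>\<^sub>M m) (B \<times> space m) = measure m B"
    and "measure (m \<Otimes>\<^sub>M m) (space m \<times> B) = measure m B"
  using assms by (simp_all add: measure_def emeasure_pair_measure_Times emeasure_space_1)

text \<open>If two points are more than \<open>2 * R\<close> apart, one of them is more than
  \<open>R\<close> away from \<open>z\<close>. This leads from (v) to (iv).\<close>

lemma pair_tail_le_section:
  assumes z: "z \<in> space m"
  shows "pair_tail \<delta> m (2 * R) \<le> 2 * measure m {y \<in> space m. R < \<delta> y z}"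
proof -
  let ?B = "{y \<in> space m. R < \<delta> y z}"
  have "pair_tail \<delta> m (2 * R) \<le> measure (m \<Otimes>\<^sub>M m) (?B \<times> space m \<union> space m \<times> ?B)"
    unfolding pair_tail_def
  proof (rule PP.P.finite_measure_mono)
    show "{p \<in> space (m \<Otimes>\<^sub>M m). 2 * R < \<delta> (fst p) (snd p)} \<subseteq> ?B \<times> space m \<union> space m \<times> ?B"
      using triangle[OF _ _ z] by (force simp: space_pair_measure)
    show "?B \<times> space m \<union> space m \<times> ?B \<in> sets (m \<Otimes>\<^sub>M m)"
      using sets_section[OF z] by (intro sets.Un pair_measureI) auto
  qed
  also have "\<dots> \<le> measure (m \<Otimes>\<^sub>M m) (?B \<times> space m) + measure (m \<Otimes>\<^sub>M m) (space m \<times> ?B)"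
    using sets_section[OF z] by (intro measure_Un_le pair_measureI) auto
  also have "\<dots> = 2 * measure m ?B"
    by (simp add: measure_cylinder sets_section[OF z])
  finally show ?thesis .
qed

text \<open>By Fubini and Markov's inequality, the points violating the bound for a given \<open>n\<close> have mass at most
  \<open>(1/2) ^ (n + 2)\<close>; these masses add up to less than 1.\<close>

lemma exists_good_point:
  assumes R: "\<And>n. pair_tail \<delta> m (R n) \<le> (1/4) ^ (n + 2)"
  shows "\<exists>z\<in>space m. \<forall>n. measure m {y \<in> space m. R n < \<delta> y z} < (1/2) ^ (n + 2)"
proof -
  define Q where "Q n = {p \<in> space (m \<Otimes>\<^sub>M m). R n < \<delta> (fst p) (snd p)}" for n
  have Q: "Q n \<in> sets (m \<Otimes>\<^sub>M m)" for n
    unfolding Q_def by (rule sets_pair_tail)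
  define bad where "bad n = {z \<in> space m. ennreal ((1/2) ^ (n + 2)) \<le> emeasure m ((\<lambda>y. (y, z)) -` Q n)}" for n
  have meas: "(\<lambda>z. emeasure m ((\<lambda>y. (y, z)) -` Q n)) \<in> borel_measurable m" for n
    by (rule PP.measurable_emeasure_Pair2[OF Q])
  have bad: "bad n \<in> sets m" for n
    unfolding bad_def by (rule borel_measurable_le[OF borel_measurable_const meas])
  have bad_le: "measure m (bad n) \<le> (1/2) ^ (n + 2)" for n
  proof -
    have "ennreal ((1/2) ^ (n + 2) * measure m (bad n)) =
        (\<integral>\<^sup>+z. ennreal ((1/2) ^ (n + 2)) * indicator (bad n) z \<partial>m)"
      unfolding nn_integral_cmult_indicator[OF bad] emeasure_eq_measure
      by (rule ennreal_mult) auto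
    also have "\<dots> \<le> (\<integral>\<^sup>+z. emeasure m ((\<lambda>y. (y, z)) -` Q n) \<partial>m)"
      by (intro nn_integral_mono) (auto simp: indicator_def bad_def)
    also have "\<dots> = emeasure (m \<Otimes>\<^sub>M m) (Q n)"
      by (rule PP.emeasure_pair_measure_alt2[OF Q, symmetric])
    also have "\<dots> \<le> ennreal ((1/4) ^ (n + 2))"
      using R[of n] by (simp add: PP.P.emeasure_eq_measure Q_def pair_tail_def)
    finally have "(1/2) ^ (n + 2) * measure m (bad n) \<le> (1/4) ^ (n + 2)"
      by (subst (asm) ennreal_le_iff) auto
    \<comment> \<open>The square root of the bound on the pair tail serves twice: as the threshold
      for the section and as the bound on the mass of bad points.\<close>
    also have "(1/4 :: real) ^ (n + 2) = (1/2) ^ (n + 2) * (1/2) ^ (n + 2)"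
      by (simp flip: power_mult_distrib)
    finally show ?thesis by (rule mult_left_le_imp_le) simp
  qed
  \<comment> \<open>1/4 + 1/8 + ... = 1/2: the shift by 2 in the exponent leaves room for a point
    that is good for every \<open>n\<close>.\<close>
  have sums: "(\<lambda>n. (1/2 :: real) ^ (n + 2)) sums (1/2)"
    using sums_mult[OF geometric_sums[of "1/2 :: real"], of "1/4"]
    by (simp add: power_add power2_eq_square field_simps)
  have "measure m (\<Union>n. bad n) \<le> (\<Sum>n. measure m (bad n))"
  proof (rule finite_measure_subadditive_countably)
    show "summable (\<lambda>n. measure m (bad n))"
      using bad_le by (intro summable_comparison_test'[OF sums_summable[OF sums]]) auto
  qed (use bad in auto)
  also have "\<dots> \<le> (\<Sum>n. (1/2) ^ (n + 2))"
    using bad_le sums_summable[OF sums]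
    by (intro suminf_le summable_comparison_test'[OF sums_summable[OF sums]]) auto
  also have "\<dots> = 1/2" using sums by (rule sums_unique[symmetric])
  finally have "\<not> space m \<subseteq> (\<Union>n. bad n)"
    using finite_measure_mono[of "space m" "\<Union>n. bad n"] bad prob_space by (auto intro!: sets.countable_UN)
  then obtain z where z: "z \<in> space m" "\<And>n. z \<notin> bad n" by blast
  have "measure m {y \<in> space m. R n < \<delta> y z} < (1/2) ^ (n + 2)" for n
  proof -
    have "(\<lambda>y. (y, z)) -` Q n = {y \<in> space m. R n < \<delta> y z}"
      using z(1) by (auto simp: Q_def space_pair_measure)
    then have "emeasure m {y \<in> space m. R n < \<delta> y z} < ennreal ((1/2) ^ (n + 2))"
      using z(2)[of n] z(1) by (simp add: bad_def not_le)
    then show ?thesis by (simp add: emeasure_eq_measure ennreal_less_iff)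
  qed
  with z(1) show ?thesis by blast
qed

lemma prob_sample_pair:
  assumes "iid_sequence \<Omega> m \<xi>"
  shows "measure \<Omega> {\<omega> \<in> space \<Omega>. R < \<delta> (\<xi> 0 \<omega>) (\<xi> 1 \<omega>)} = pair_tail \<delta> m R"
proof -
  have set: "{A :: nat \<Rightarrow> nat \<Rightarrow> real. A 0 1 \<in> {R<..}} \<in> sets borel"
    using measurable_sets[OF borel_measurable_entry, of "{R<..}" 0 1]
    by (simp add: vimage_def del: One_nat_def)
  have "pair_tail \<delta> m R = measure (tau_infinity \<delta> m) {A. A 0 1 \<in> {R<..}}"
    by (subst measure_tau_infinity_entry) (auto simp: pair_tail_def)
  also have "\<dots> = measure \<Omega> ((\<lambda>\<omega>. dist_matrix \<delta> (\<lambda>k. \<xi> k \<omega>)) -` {A. A 0 1 \<in> {R<..}} \<inter> space \<Omega>)"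
    unfolding tau_infinity_sample(2)[OF assms] by (rule measure_distr[OF tau_infinity_sample(1)[OF assms] set])
  also have "(\<lambda>\<omega>. dist_matrix \<delta> (\<lambda>k. \<xi> k \<omega>)) -` {A. A 0 1 \<in> {R<..}} \<inter> space \<Omega> =
      {\<omega> \<in> space \<Omega>. R < \<delta> (\<xi> 0 \<omega>) (\<xi> 1 \<omega>)}"
    by (auto simp: dist_matrix_def)
  finally show ?thesis ..
qed

lemma prob_sample_section:
  assumes iid: "iid_sequence \<Omega> m \<xi>" and z: "z \<in> space m"
  shows "measure \<Omega> {\<omega> \<in> space \<Omega>. R < \<delta> (\<xi> 0 \<omega>) z} = measure m {y \<in> space m. R < \<delta> y z}"
proof -
  have law: "distr \<Omega> m (\<xi> 0) = m" and "prob_space.indep_vars \<Omega> (\<lambda>_. m) \<xi> UNIV" and "prob_space \<Omega>"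
    using iid by (auto simp: iid_sequence_def)
  then have \<xi>: "\<xi> 0 \<in> \<Omega> \<rightarrow>\<^sub>M m"
    by (simp add: prob_space.indep_vars_def)
  have "measure m {y \<in> space m. R < \<delta> y z} = measure (distr \<Omega> m (\<xi> 0)) {y \<in> space m. R < \<delta> y z}"
    by (simp add: law)
  also have "\<dots> = measure \<Omega> (\<xi> 0 -` {y \<in> space m. R < \<delta> y z} \<inter> space \<Omega>)"
    by (rule measure_distr[OF \<xi> sets_section[OF z]])
  also have "\<xi> 0 -` {y \<in> space m. R < \<delta> y z} \<inter> space \<Omega> = {\<omega> \<in> space \<Omega>. R < \<delta> (\<xi> 0 \<omega>) z}"
    using measurable_space[OF \<xi>] by auto
  finally show ?thesis ..
qed

lemma sample_in_space:
  assumes "iid_sequence \<Omega> m \<xi>" "\<omega> \<in> space \<Omega>"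
  shows "\<xi> k \<omega> \<in> space m"
  using measurable_space[OF iid_sequence_law(1)[OF assms(1)] assms(2)] by (auto simp: space_PiM)

lemma measurable_sample:
  assumes "iid_sequence \<Omega> m \<xi>"
  shows "\<xi> k \<in> \<Omega> \<rightarrow>\<^sub>M m"
  using measurable_compose[OF iid_sequence_law(1)[OF assms] measurable_coordinate] .

end

section \<open>Compact sets of matrices and the equivalence for families of kernels\<close>

lemma compact_matrix_box:
  fixes R :: "nat \<Rightarrow> nat \<Rightarrow> real"
  shows "compact {A :: nat \<Rightarrow> nat \<Rightarrow> real. \<forall>i j. \<bar>A i j\<bar> \<le> R i j}"
proof -
  \<comment> \<open>Tychonoff's theorem is applied to a row and then to the sequence of rows, as the
    matrix type is an iterated function type.\<close>
  have row: "compact {a :: nat \<Rightarrow> real. \<forall>j. \<bar>a j\<bar> \<le> r j}" for r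
  proof -
    have "compactin (product_topology (\<lambda>_. euclidean) UNIV) (PiE UNIV (\<lambda>j. {- r j .. r j}))"
      by (simp add: compactin_PiE)
    moreover have "PiE UNIV (\<lambda>j. {- r j .. r j}) = {a. \<forall>j. \<bar>a j\<bar> \<le> r j}"
      by (auto simp: PiE_iff abs_le_iff minus_le_iff)
    ultimately show ?thesis
      by (simp add: euclidean_product_topology flip: compactin_euclidean_iff)
  qed
  have "compactin (product_topology (\<lambda>_. euclidean) UNIV) (PiE UNIV (\<lambda>i. {a :: nat \<Rightarrow> real. \<forall>j. \<bar>a j\<bar> \<le> R i j}))"
    by (simp add: compactin_PiE row)
  moreover have "PiE UNIV (\<lambda>i. {a. \<forall>j. \<bar>a j\<bar> \<le> R i j}) = {A. \<forall>i j. \<bar>A i j\<bar> \<le> R i j}"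
    by (auto simp: PiE_iff)
  ultimately show ?thesis
    by (simp add: euclidean_product_topology flip: compactin_euclidean_iff)
qed

lemma compact_real_bounded:
  fixes K :: "real set"
  assumes "compact K" obtains R where "\<And>x. x \<in> K \<Longrightarrow> \<bar>x\<bar> \<le> R"
  using compact_imp_bounded[OF assms] by (auto simp: bounded_iff)

text \<open>What the three kinds of spaces have in common. The deep assumption is
  \<open>tree_limit\<close>; it is part of condition (i), which requires the laws to lie in the
  carrier of the topology.\<close>

locale kernel_family =
  fixes I :: "'i set" and X :: "'i \<Rightarrow> 'x set" and \<delta> :: "'i \<Rightarrow> 'x \<Rightarrow> 'x \<Rightarrow> real" and m :: "'i \<Rightarrow> 'x measure"
    and \<Omega> :: "'i \<Rightarrow> 'w measure" and \<xi> :: "'i \<Rightarrow> nat \<Rightarrow> 'w \<Rightarrow> 'x"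
  assumes kernel: "\<alpha> \<in> I \<Longrightarrow> distance_kernel (m \<alpha>) (\<delta> \<alpha>)"
    and iid: "\<alpha> \<in> I \<Longrightarrow> iid_sequence (\<Omega> \<alpha>) (m \<alpha>) (\<xi> \<alpha>)"
    and space_eq: "\<alpha> \<in> I \<Longrightarrow> space (m \<alpha>) = X \<alpha>"
    and tree_limit: "\<alpha> \<in> I \<Longrightarrow> tau_infinity (\<delta> \<alpha>) (m \<alpha>) \<in> topspace tree_limits"
begin

abbreviation "law \<alpha> \<equiv> tau_infinity (\<delta> \<alpha>) (m \<alpha>)"

abbreviation "section_tail \<alpha> z R \<equiv> measure (m \<alpha>) {y \<in> space (m \<alpha>). R < \<delta> \<alpha> y z}"

abbreviation "sample_tail Z \<alpha> R \<equiv> measure (\<Omega> \<alpha>) {\<omega> \<in> space (\<Omega> \<alpha>). (R :: real) < Z \<alpha> \<omega>}"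

definition uniform_tails :: bool where
  "uniform_tails \<longleftrightarrow> (\<forall>\<epsilon>>0. \<exists>R. \<forall>\<alpha>\<in>I. pair_tail (\<delta> \<alpha>) (m \<alpha>) R \<le> \<epsilon>)"

lemma finite_measure_law: "\<alpha> \<in> I \<Longrightarrow> finite_measure (law \<alpha>)"
  and sets_law: "\<alpha> \<in> I \<Longrightarrow> sets (law \<alpha>) = sets borel"
  and space_law: "\<alpha> \<in> I \<Longrightarrow> space (law \<alpha>) = UNIV"
proof -
  assume "\<alpha> \<in> I"
  then have "law \<alpha> \<in> prob_measures"
    using kernel by (auto intro: sample_kernel.tau_infinity_prob distance_kernel.axioms)
  then show "finite_measure (law \<alpha>)" and s: "sets (law \<alpha>) = sets borel"
    by (auto simp: prob_measures_iff prob_space.finite_measure)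
  show "space (law \<alpha>) = UNIV"
    using sets_eq_imp_space_eq[OF s] by simp
qed

lemma tight_variables_matrix_iff:
  "tight_variables I \<Omega> (\<lambda>\<alpha> \<omega>. dist_matrix (\<delta> \<alpha>) (\<lambda>k. \<xi> \<alpha> k \<omega>)) \<longleftrightarrow> tight_measures (law ` I)"
proof -
  have "measure (\<Omega> \<alpha>) {\<omega> \<in> space (\<Omega> \<alpha>). dist_matrix (\<delta> \<alpha>) (\<lambda>k. \<xi> \<alpha> k \<omega>) \<notin> K} =
      measure (law \<alpha>) (space (law \<alpha>) - K)"
    if "\<alpha> \<in> I" "compact K" for \<alpha> and K :: "(nat \<Rightarrow> nat \<Rightarrow> real) set"
  proof -
    interpret distance_kernel "m \<alpha>" "\<delta> \<alpha>" using kernel that by simp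
    have K: "- K \<in> sets borel"
      using compact_imp_closed[OF that(2)] by (simp add: borel_open)
    have "measure (law \<alpha>) (- K) = measure (\<Omega> \<alpha>)
        ((\<lambda>\<omega>. dist_matrix (\<delta> \<alpha>) (\<lambda>k. \<xi> \<alpha> k \<omega>)) -` (- K) \<inter> space (\<Omega> \<alpha>))"
      unfolding tau_infinity_sample(2)[OF iid[OF that(1)]]
      by (rule measure_distr[OF tau_infinity_sample(1)[OF iid[OF that(1)]] K])
    also have "(\<lambda>\<omega>. dist_matrix (\<delta> \<alpha>) (\<lambda>k. \<xi> \<alpha> k \<omega>)) -` (- K) \<inter> space (\<Omega> \<alpha>) =
        {\<omega> \<in> space (\<Omega> \<alpha>). dist_matrix (\<delta> \<alpha>) (\<lambda>k. \<xi> \<alpha> k \<omega>) \<notin> K}" by auto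
    finally show ?thesis
      using that by (simp add: space_law Compl_eq_Diff_UNIV)
  qed
  then have "(\<forall>\<alpha>\<in>I. measure (\<Omega> \<alpha>) {\<omega> \<in> space (\<Omega> \<alpha>). dist_matrix (\<delta> \<alpha>) (\<lambda>k. \<xi> \<alpha> k \<omega>) \<notin> K} < \<epsilon>) \<longleftrightarrow>
      (\<forall>\<mu>\<in>law ` I. measure \<mu> (space \<mu> - K) < \<epsilon>)"
    if "compact K" for K and \<epsilon> :: real
    using that by simp
  then show ?thesis
    unfolding tight_variables_def tight_measures_def
    by (intro all_cong1 imp_cong refl ex_cong1 conj_cong)
qed

text \<open>A single entry is a continuous function of the matrix, hence bounded on a compact set of
  matrices.\<close>

lemma tight_measures_imp_uniform_tails:
  assumes "tight_measures (law ` I)"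
  shows uniform_tails
  unfolding uniform_tails_def
proof (intro allI impI)
  fix \<epsilon> :: real assume "0 < \<epsilon>"
  with assms have "\<exists>K. compact K \<and> (\<forall>\<mu>\<in>law ` I. measure \<mu> (space \<mu> - K) < \<epsilon>)"
    unfolding tight_measures_def by simp
  then obtain K where K: "compact K" "\<And>\<alpha>. \<alpha> \<in> I \<Longrightarrow> measure (law \<alpha>) (space (law \<alpha>) - K) < \<epsilon>"
    by auto
  have "compact ((\<lambda>A. A 0 1) ` K)"
    by (intro compact_continuous_image K continuous_on_subset[OF continuous_on_entry]) auto
  then obtain R where R: "\<And>A. A \<in> K \<Longrightarrow> \<bar>A 0 1\<bar> \<le> R"
    by (rule compact_real_bounded) blast
  have "pair_tail (\<delta> \<alpha>) (m \<alpha>) R \<le> \<epsilon>" if "\<alpha> \<in> I" for \<alpha>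
  proof -
    interpret distance_kernel "m \<alpha>" "\<delta> \<alpha>" using kernel that by simp
    have "pair_tail (\<delta> \<alpha>) (m \<alpha>) R = measure (law \<alpha>) {A. R < \<bar>A 0 1\<bar>}"
      by (rule measure_tau_infinity_tail[symmetric]) simp
    also have "\<dots> \<le> measure (law \<alpha>) (space (law \<alpha>) - K)"
    proof (rule finite_measure.finite_measure_mono[OF finite_measure_law[OF that]])
      show "{A. R < \<bar>A 0 1\<bar>} \<subseteq> space (law \<alpha>) - K"
        using R that by (fastforce simp: space_law)
      show "space (law \<alpha>) - K \<in> sets (law \<alpha>)"
        using that compact_imp_closed[OF K(1)]
        by (simp add: sets_law space_law borel_open flip: Compl_eq_Diff_UNIV)
    qed
    finally show ?thesis using K(2)[OF that] by simp
  qed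
  then show "\<exists>R. \<forall>\<alpha>\<in>I. pair_tail (\<delta> \<alpha>) (m \<alpha>) R \<le> \<epsilon>" by blast
qed

lemma uniform_tails_imp_tight_measures:
  assumes uniform_tails
  shows "tight_measures (law ` I)"
  unfolding tight_measures_def
proof (intro allI impI)
  fix \<epsilon> :: real assume \<epsilon>: "0 < \<epsilon>"
  \<comment> \<open>These budgets add up to \<epsilon> / 2; the other half makes the final
    inequality strict.\<close>
  define e where "e n = \<epsilon> * (1/4) * (1/2) ^ n" for n :: nat
  have "\<forall>n. \<exists>R\<ge>0. \<forall>\<alpha>\<in>I. pair_tail (\<delta> \<alpha>) (m \<alpha>) R \<le> e n"
  proof
    fix n
    have "0 < e n" using \<epsilon> by (simp add: e_def)
    then obtain R where R: "\<And>\<alpha>. \<alpha> \<in> I \<Longrightarrow> pair_tail (\<delta> \<alpha>) (m \<alpha>) R \<le> e n"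
      using assms unfolding uniform_tails_def by blast
    have "pair_tail (\<delta> \<alpha>) (m \<alpha>) (max 0 R) \<le> e n" if "\<alpha> \<in> I" for \<alpha>
      using distance_kernel.pair_tail_antimono[OF kernel[OF that], of R "max 0 R"] R[OF that] by simp
    then show "\<exists>R\<ge>0. \<forall>\<alpha>\<in>I. pair_tail (\<delta> \<alpha>) (m \<alpha>) R \<le> e n"
      by (intro exI[of _ "max 0 R"]) auto
  qed
  then obtain R where R: "\<And>n. 0 \<le> R n" "\<And>n \<alpha>. \<alpha> \<in> I \<Longrightarrow> pair_tail (\<delta> \<alpha>) (m \<alpha>) (R n) \<le> e n"
    by metis
  \<comment> \<open>Entry (i, j) gets its own radius, chosen for the budget with number
    \<open>prod_encode (i, j)\<close>; the complement of the box is then covered by countably many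
    tail events.\<close>
  define K where "K = {A :: nat \<Rightarrow> nat \<Rightarrow> real. \<forall>i j. \<bar>A i j\<bar> \<le> R (prod_encode (i, j))}"
  have sums: "e sums (\<epsilon> / 2)"
    using sums_mult[OF geometric_sums[of "1/2 :: real"], of "\<epsilon> * (1/4)"] by (simp add: e_def [abs_def])
  have "measure (law \<alpha>) (space (law \<alpha>) - K) < \<epsilon>" if \<alpha>: "\<alpha> \<in> I" for \<alpha>
  proof -
    interpret distance_kernel "m \<alpha>" "\<delta> \<alpha>" using kernel \<alpha> by simp
    interpret law: finite_measure "law \<alpha>" using \<alpha> by (rule finite_measure_law)
    define B where "B n = {A :: nat \<Rightarrow> nat \<Rightarrow> real. R n < \<bar>A (fst (prod_decode n)) (snd (prod_decode n))\<bar>}" for n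
    have B: "B n \<in> sets (law \<alpha>)" for n
      using \<alpha> by (simp add: B_def sets_law sets_large_entry)
    have le: "measure (law \<alpha>) (B n) \<le> e n" for n
      using measure_tau_infinity_tail_le[OF R(1)] R(2)[OF \<alpha>] unfolding B_def by (rule order_trans)
    have "space (law \<alpha>) - K \<subseteq> (\<Union>n. B n)"
    proof
      fix A assume "A \<in> space (law \<alpha>) - K"
      then obtain i j where "R (prod_encode (i, j)) < \<bar>A i j\<bar>"
        by (auto simp: K_def not_le)
      then have "A \<in> B (prod_encode (i, j))" by (simp add: B_def)
      then show "A \<in> (\<Union>n. B n)" by blast
    qed
    then have "measure (law \<alpha>) (space (law \<alpha>) - K) \<le> measure (law \<alpha>) (\<Union>n. B n)"
      using B by (intro law.finite_measure_mono) auto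
    also have "\<dots> \<le> (\<Sum>n. measure (law \<alpha>) (B n))"
      using B le sums_summable[OF sums]
      by (intro law.finite_measure_subadditive_countably summable_comparison_test'[OF sums_summable[OF sums]]) auto
    also have "\<dots> \<le> (\<Sum>n. e n)"
      using le by (intro suminf_le summable_comparison_test'[OF sums_summable[OF sums]] sums_summable[OF sums]) auto
    also have "\<dots> = \<epsilon> / 2" using sums by (rule sums_unique[symmetric])
    finally show ?thesis using \<epsilon> by simp
  qed
  moreover have "compact K"
    unfolding K_def by (rule compact_matrix_box)
  ultimately show "\<exists>K. compact K \<and> (\<forall>\<mu>\<in>law ` I. measure \<mu> (space \<mu> - K) < \<epsilon>)"
    by blast
qed

text \<open>Compact sets of reals are bounded, and for nonnegative variables the intervals [0, R]
  can serve as the compact sets.\<close>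

lemma tight_variables_tail:
  fixes Z :: "'i \<Rightarrow> 'w \<Rightarrow> real"
  assumes Z: "\<And>\<alpha>. \<alpha> \<in> I \<Longrightarrow> Z \<alpha> \<in> borel_measurable (\<Omega> \<alpha>)"
    and nonneg: "\<And>\<alpha> \<omega>. \<alpha> \<in> I \<Longrightarrow> \<omega> \<in> space (\<Omega> \<alpha>) \<Longrightarrow> 0 \<le> Z \<alpha> \<omega>"
  shows "tight_variables I \<Omega> Z \<longleftrightarrow>
    (\<forall>\<epsilon>>0. \<exists>R. \<forall>\<alpha>\<in>I. sample_tail Z \<alpha> R < \<epsilon>)"
proof
  assume tight: "tight_variables I \<Omega> Z"
  show "\<forall>\<epsilon>>0. \<exists>R. \<forall>\<alpha>\<in>I. sample_tail Z \<alpha> R < \<epsilon>"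
  proof (intro allI impI)
    fix \<epsilon> :: real assume "0 < \<epsilon>"
    with tight have "\<exists>K. compact K \<and> (\<forall>\<alpha>\<in>I. measure (\<Omega> \<alpha>) {\<omega> \<in> space (\<Omega> \<alpha>). Z \<alpha> \<omega> \<notin> K} < \<epsilon>)"
      unfolding tight_variables_def by simp
    then obtain K where K: "compact K" "\<And>\<alpha>. \<alpha> \<in> I \<Longrightarrow> measure (\<Omega> \<alpha>) {\<omega> \<in> space (\<Omega> \<alpha>). Z \<alpha> \<omega> \<notin> K} < \<epsilon>"
      by auto
    obtain R where R: "\<And>x. x \<in> K \<Longrightarrow> \<bar>x\<bar> \<le> R"
      using compact_real_bounded[OF K(1)] by blast
    have "sample_tail Z \<alpha> R < \<epsilon>" if "\<alpha> \<in> I" for \<alpha>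
    proof -
      interpret prob_space "\<Omega> \<alpha>" using iid[OF that] by (simp add: iid_sequence_def)
      have "{\<omega> \<in> space (\<Omega> \<alpha>). Z \<alpha> \<omega> \<notin> K} = Z \<alpha> -` (- K) \<inter> space (\<Omega> \<alpha>)" by auto
      also have "\<dots> \<in> sets (\<Omega> \<alpha>)"
        using compact_imp_closed[OF K(1)] by (intro measurable_sets[OF Z[OF that]]) (simp add: borel_open)
      finally have "{\<omega> \<in> space (\<Omega> \<alpha>). Z \<alpha> \<omega> \<notin> K} \<in> sets (\<Omega> \<alpha>)" .
      then have "sample_tail Z \<alpha> R \<le>
          measure (\<Omega> \<alpha>) {\<omega> \<in> space (\<Omega> \<alpha>). Z \<alpha> \<omega> \<notin> K}"
        using R by (intro finite_measure_mono) force+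
      with K(2)[OF that] show ?thesis by simp
    qed
    then show "\<exists>R. \<forall>\<alpha>\<in>I. sample_tail Z \<alpha> R < \<epsilon>" by blast
  qed
next
  assume tails: "\<forall>\<epsilon>>0. \<exists>R. \<forall>\<alpha>\<in>I. sample_tail Z \<alpha> R < \<epsilon>"
  show "tight_variables I \<Omega> Z"
    unfolding tight_variables_def
  proof (intro allI impI)
    fix \<epsilon> :: real assume "0 < \<epsilon>"
    then obtain R where R: "\<And>\<alpha>. \<alpha> \<in> I \<Longrightarrow> sample_tail Z \<alpha> R < \<epsilon>"
      using tails by blast
    have "{\<omega> \<in> space (\<Omega> \<alpha>). Z \<alpha> \<omega> \<notin> {0..R}} = {\<omega> \<in> space (\<Omega> \<alpha>). R < Z \<alpha> \<omega>}" if "\<alpha> \<in> I" for \<alpha>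
      using nonneg[OF that] by auto
    with R show "\<exists>K. compact K \<and> (\<forall>\<alpha>\<in>I. measure (\<Omega> \<alpha>) {\<omega> \<in> space (\<Omega> \<alpha>). Z \<alpha> \<omega> \<notin> K} < \<epsilon>)"
      by (intro exI[of _ "{0..R}"]) simp
  qed
qed

lemma strict_tails_iff:
  "(\<forall>\<epsilon>>0. \<exists>R. \<forall>\<alpha>\<in>I. t \<alpha> R < \<epsilon>) \<longleftrightarrow> (\<forall>\<epsilon>>0. \<exists>R. \<forall>\<alpha>\<in>I. t \<alpha> R \<le> (\<epsilon> :: real))"
proof
  assume R: "\<forall>\<epsilon>>0. \<exists>R. \<forall>\<alpha>\<in>I. t \<alpha> R \<le> \<epsilon>"
  show "\<forall>\<epsilon>>0. \<exists>R. \<forall>\<alpha>\<in>I. t \<alpha> R < \<epsilon>"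
  proof (intro allI impI)
    fix \<epsilon> :: real assume "0 < \<epsilon>"
    then obtain R' where "\<forall>\<alpha>\<in>I. t \<alpha> R' \<le> \<epsilon> / 2"
      using R[rule_format, of "\<epsilon> / 2"] by auto
    with \<open>0 < \<epsilon>\<close> show "\<exists>R. \<forall>\<alpha>\<in>I. t \<alpha> R < \<epsilon>"
      by (intro exI[of _ R']) fastforce
  qed
qed (blast intro: less_imp_le)

lemma tight_variables_pair_iff:
  "tight_variables I \<Omega> (\<lambda>\<alpha> \<omega>. \<delta> \<alpha> (\<xi> \<alpha> 0 \<omega>) (\<xi> \<alpha> 1 \<omega>)) \<longleftrightarrow> uniform_tails"
proof (subst tight_variables_tail)
  fix \<alpha> assume \<alpha>: "\<alpha> \<in> I"
  interpret distance_kernel "m \<alpha>" "\<delta> \<alpha>" using kernel \<alpha> by simp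
  have "(\<lambda>\<omega>. (\<xi> \<alpha> 0 \<omega>, \<xi> \<alpha> 1 \<omega>)) \<in> \<Omega> \<alpha> \<rightarrow>\<^sub>M m \<alpha> \<Otimes>\<^sub>M m \<alpha>"
    by (intro measurable_Pair measurable_sample iid \<alpha>)
  from measurable_compose[OF this measurable_kernel]
  show "(\<lambda>\<omega>. \<delta> \<alpha> (\<xi> \<alpha> 0 \<omega>) (\<xi> \<alpha> 1 \<omega>)) \<in> borel_measurable (\<Omega> \<alpha>)" by simp
  show "0 \<le> \<delta> \<alpha> (\<xi> \<alpha> 0 \<omega>) (\<xi> \<alpha> 1 \<omega>)" if "\<omega> \<in> space (\<Omega> \<alpha>)" for \<omega>
    by (intro nonneg sample_in_space[OF iid[OF \<alpha>] that])
next
  have "measure (\<Omega> \<alpha>) {\<omega> \<in> space (\<Omega> \<alpha>). R < \<delta> \<alpha> (\<xi> \<alpha> 0 \<omega>) (\<xi> \<alpha> 1 \<omega>)} = pair_tail (\<delta> \<alpha>) (m \<alpha>) R"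
    if "\<alpha> \<in> I" for \<alpha> R
    by (rule distance_kernel.prob_sample_pair[OF kernel[OF that] iid[OF that]])
  then show "(\<forall>\<epsilon>>0. \<exists>R. \<forall>\<alpha>\<in>I. measure (\<Omega> \<alpha>) {\<omega> \<in> space (\<Omega> \<alpha>). R < \<delta> \<alpha> (\<xi> \<alpha> 0 \<omega>) (\<xi> \<alpha> 1 \<omega>)} < \<epsilon>)
      \<longleftrightarrow> uniform_tails"
    unfolding uniform_tails_def strict_tails_iff by simp
qed

lemma tight_variables_section_iff:
  assumes x: "\<And>\<alpha>. \<alpha> \<in> I \<Longrightarrow> x \<alpha> \<in> X \<alpha>"
  shows "tight_variables I \<Omega> (\<lambda>\<alpha> \<omega>. \<delta> \<alpha> (\<xi> \<alpha> 0 \<omega>) (x \<alpha>)) \<longleftrightarrow>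
    (\<forall>\<epsilon>>0. \<exists>R. \<forall>\<alpha>\<in>I. section_tail \<alpha> (x \<alpha>) R < \<epsilon>)"
proof (subst tight_variables_tail)
  fix \<alpha> assume \<alpha>: "\<alpha> \<in> I"
  interpret distance_kernel "m \<alpha>" "\<delta> \<alpha>" using kernel \<alpha> by simp
  have z: "x \<alpha> \<in> space (m \<alpha>)" using x \<alpha> by (simp add: space_eq)
  show "(\<lambda>\<omega>. \<delta> \<alpha> (\<xi> \<alpha> 0 \<omega>) (x \<alpha>)) \<in> borel_measurable (\<Omega> \<alpha>)"
    by (rule measurable_compose[OF measurable_sample[OF iid[OF \<alpha>]] measurable_section[OF z]])
  show "0 \<le> \<delta> \<alpha> (\<xi> \<alpha> 0 \<omega>) (x \<alpha>)" if "\<omega> \<in> space (\<Omega> \<alpha>)" for \<omega>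
    by (intro nonneg sample_in_space[OF iid[OF \<alpha>] that] z)
next
  have "measure (\<Omega> \<alpha>) {\<omega> \<in> space (\<Omega> \<alpha>). R < \<delta> \<alpha> (\<xi> \<alpha> 0 \<omega>) (x \<alpha>)} =
      section_tail \<alpha> (x \<alpha>) R"
    if "\<alpha> \<in> I" for \<alpha> R
    using x space_eq that
    by (intro distance_kernel.prob_sample_section[OF kernel[OF that] iid[OF that]]) auto
  then show "(\<forall>\<epsilon>>0. \<exists>R. \<forall>\<alpha>\<in>I. measure (\<Omega> \<alpha>) {\<omega> \<in> space (\<Omega> \<alpha>). R < \<delta> \<alpha> (\<xi> \<alpha> 0 \<omega>) (x \<alpha>)} < \<epsilon>)
      \<longleftrightarrow> (\<forall>\<epsilon>>0. \<exists>R. \<forall>\<alpha>\<in>I. section_tail \<alpha> (x \<alpha>) R < \<epsilon>)"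
    by simp
qed

text \<open>One direction is the triangle inequality. In the other the base point must not depend on
  \<epsilon>: radii \<open>R n\<close> common to all \<alpha> are fixed beforehand, and then for
  each \<alpha> a single point is chosen that works for all of them.\<close>

lemma ex_tight_section_iff:
  "(\<exists>x. (\<forall>\<alpha>\<in>I. x \<alpha> \<in> X \<alpha>) \<and> tight_variables I \<Omega> (\<lambda>\<alpha> \<omega>. \<delta> \<alpha> (\<xi> \<alpha> 0 \<omega>) (x \<alpha>))) \<longleftrightarrow> uniform_tails"
proof
  assume "\<exists>x. (\<forall>\<alpha>\<in>I. x \<alpha> \<in> X \<alpha>) \<and> tight_variables I \<Omega> (\<lambda>\<alpha> \<omega>. \<delta> \<alpha> (\<xi> \<alpha> 0 \<omega>) (x \<alpha>))"
  then obtain x where x: "\<And>\<alpha>. \<alpha> \<in> I \<Longrightarrow> x \<alpha> \<in> X \<alpha>"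
    and tight: "tight_variables I \<Omega> (\<lambda>\<alpha> \<omega>. \<delta> \<alpha> (\<xi> \<alpha> 0 \<omega>) (x \<alpha>))"
    by blast
  have tails: "\<forall>\<epsilon>>0. \<exists>R. \<forall>\<alpha>\<in>I. section_tail \<alpha> (x \<alpha>) R < \<epsilon>"
    using tight_variables_section_iff[of x] x tight by simp
  show uniform_tails
    unfolding uniform_tails_def
  proof (intro allI impI)
    fix \<epsilon> :: real assume "0 < \<epsilon>"
    then obtain R where R: "\<And>\<alpha>. \<alpha> \<in> I \<Longrightarrow> section_tail \<alpha> (x \<alpha>) R < \<epsilon> / 2"
      using tails[rule_format, of "\<epsilon> / 2"] by auto
    have "pair_tail (\<delta> \<alpha>) (m \<alpha>) (2 * R) \<le> \<epsilon>" if "\<alpha> \<in> I" for \<alpha>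
      using distance_kernel.pair_tail_le_section[OF kernel[OF that], of "x \<alpha>" R] R[OF that] x[OF that]
        space_eq[OF that] by simp
    then show "\<exists>R. \<forall>\<alpha>\<in>I. pair_tail (\<delta> \<alpha>) (m \<alpha>) R \<le> \<epsilon>" by blast
  qed
next
  assume U: uniform_tails
  have "\<exists>R. \<forall>\<alpha>\<in>I. pair_tail (\<delta> \<alpha>) (m \<alpha>) R \<le> (1/4) ^ (n + 2)" for n
    using U[unfolded uniform_tails_def, rule_format, of "(1/4) ^ (n + 2)"] by simp
  then obtain R where R: "\<And>n \<alpha>. \<alpha> \<in> I \<Longrightarrow> pair_tail (\<delta> \<alpha>) (m \<alpha>) (R n) \<le> (1/4) ^ (n + 2)"
    by metis
  have "\<forall>\<alpha>\<in>I. \<exists>z\<in>X \<alpha>. \<forall>n. section_tail \<alpha> z (R n) < (1/2) ^ (n + 2)"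
    using distance_kernel.exists_good_point[OF kernel R] space_eq by simp
  then obtain x where x: "\<And>\<alpha>. \<alpha> \<in> I \<Longrightarrow> x \<alpha> \<in> X \<alpha>"
    and tails: "\<And>\<alpha> n. \<alpha> \<in> I \<Longrightarrow> section_tail \<alpha> (x \<alpha>) (R n) < (1/2) ^ (n + 2)"
    by metis
  have "\<forall>\<epsilon>>0. \<exists>R. \<forall>\<alpha>\<in>I. section_tail \<alpha> (x \<alpha>) R < \<epsilon>"
  proof (intro allI impI)
    fix \<epsilon> :: real assume "0 < \<epsilon>"
    then obtain n where n: "(1/2) ^ n < \<epsilon>"
      using real_arch_pow_inv[of \<epsilon> "1/2"] by auto
    have "(1/2 :: real) ^ (n + 2) \<le> (1/2) ^ n" by (simp add: power_add)
    then have "section_tail \<alpha> (x \<alpha>) (R n) < \<epsilon>" if "\<alpha> \<in> I" for \<alpha>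
      using tails[OF that, of n] n by linarith
    then show "\<exists>R. \<forall>\<alpha>\<in>I. section_tail \<alpha> (x \<alpha>) R < \<epsilon>"
      by blast
  qed
  then have "tight_variables I \<Omega> (\<lambda>\<alpha> \<omega>. \<delta> \<alpha> (\<xi> \<alpha> 0 \<omega>) (x \<alpha>))"
    using tight_variables_section_iff[of x] x by simp
  with x show "\<exists>x. (\<forall>\<alpha>\<in>I. x \<alpha> \<in> X \<alpha>) \<and> tight_variables I \<Omega> (\<lambda>\<alpha> \<omega>. \<delta> \<alpha> (\<xi> \<alpha> 0 \<omega>) (x \<alpha>))"
    by blast
qed

lemma uniform_tails_imp_relatively_compact:
  assumes uniform_tails
  shows "relatively_compact_in tree_limits (law ` I)"
  unfolding relatively_compact_in_def
proof (intro conjI allI impI)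
  show "law ` I \<subseteq> topspace tree_limits" using tree_limit by blast
  fix s :: "nat \<Rightarrow> (nat \<Rightarrow> nat \<Rightarrow> real) measure" assume s: "range s \<subseteq> law ` I"
  then have "\<forall>n. \<exists>\<alpha>\<in>I. s n = law \<alpha>" by blast
  then obtain a where a: "\<And>n. a n \<in> I" "\<And>n. s n = law (a n)" by metis
  have "s n \<in> prob_measures" for n
    using a kernel sample_kernel.tau_infinity_prob distance_kernel.axioms(1) by metis
  moreover have "\<exists>R. \<forall>n. measure (s n) {A. R < \<bar>A i j\<bar>} \<le> \<epsilon>" if \<epsilon>: "0 < \<epsilon>" for i j \<epsilon>
  proof -
    obtain R where R: "\<And>\<alpha>. \<alpha> \<in> I \<Longrightarrow> pair_tail (\<delta> \<alpha>) (m \<alpha>) R \<le> \<epsilon>"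
      using assms \<epsilon> unfolding uniform_tails_def by blast
    \<comment> \<open>Diagonal entries are 0, so making the radius nonnegative covers them by the
      same bound.\<close>
    have "measure (s n) {A. max 0 R < \<bar>A i j\<bar>} \<le> \<epsilon>" for n
      using distance_kernel.measure_tau_infinity_tail_le[OF kernel[OF a(1)], of "max 0 R" n i j]
        distance_kernel.pair_tail_antimono[OF kernel[OF a(1)], of R "max 0 R" n] R[OF a(1)[of n]]
      unfolding a(2) by simp
    then show ?thesis by blast
  qed
  ultimately obtain r l where r: "strict_mono r" and lim: "limitin weak_topology (s \<circ> r) l sequentially"
    by (rule tight_imp_convergent_subsequence)
  have mem: "(s \<circ> r) n \<in> topspace tree_limits" for n
    using tree_limit a by simp
  have "limitin tree_limits (s \<circ> r) l sequentially"
    using lim mem tree_limits_sequentially_closed[OF lim mem]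
    unfolding topspace_tree_limits tree_limits_def limitin_subtopology by simp
  with r show "\<exists>l r. strict_mono r \<and> limitin tree_limits (s \<circ> r) l sequentially" by blast
qed

text \<open>Without uniform tails there are members of the family with mass more than \<epsilon>
  beyond radius \<open>n\<close>, for every \<open>n\<close>. Along a weakly convergent subsequence
  mass \<epsilon> would survive beyond every radius in the limit, which is a probability measure on
  matrices with real entries.\<close>

lemma relatively_compact_imp_uniform_tails:
  assumes rc: "relatively_compact_in tree_limits (law ` I)"
  shows uniform_tails
proof (rule ccontr)
  assume "\<not> uniform_tails"
  then obtain \<epsilon> where \<epsilon>: "0 < \<epsilon>" and "\<forall>R. \<exists>\<alpha>\<in>I. \<epsilon> < pair_tail (\<delta> \<alpha>) (m \<alpha>) R"
    unfolding uniform_tails_def by (auto simp: not_le)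
  then have "\<forall>n. \<exists>\<alpha>\<in>I. \<epsilon> < pair_tail (\<delta> \<alpha>) (m \<alpha>) (real n)" by blast
  then obtain a where a: "\<And>n. a n \<in> I" "\<And>n. \<epsilon> < pair_tail (\<delta> (a n)) (m (a n)) (real n)" by metis
  have "range (\<lambda>n. law (a n)) \<subseteq> law ` I" using a(1) by blast
  then obtain l r where r: "strict_mono r" and "limitin tree_limits ((\<lambda>n. law (a n)) \<circ> r) l sequentially"
    using rc unfolding relatively_compact_in_def by blast
  then have lim: "limitin weak_topology (\<lambda>n. law (a (r n))) l sequentially"
    by (simp add: tree_limits_def limitin_subtopology comp_def)
  then have l: "l \<in> prob_measures" by (simp add: limitin_weak_topology)
  then interpret l: prob_space l by (simp add: prob_measures_iff)
  \<comment> \<open>A continuous cut-off, 0 up to modulus \<open>k\<close> and 1 from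
    \<open>k + 1\<close> on, through which weak convergence controls a tail.\<close>
  define u where "u k A = max 0 (min 1 (\<bar>A 0 1\<bar> - real k))" for k and A :: "nat \<Rightarrow> nat \<Rightarrow> real"
  have u_cont: "continuous_on UNIV (u k)" for k
    unfolding u_def by (intro continuous_on_max continuous_on_min continuous_on_diff continuous_on_const
        continuous_on_rabs continuous_on_entry)
  have u_meas: "u k \<in> borel_measurable borel" for k
    by (rule borel_measurable_continuous_onI[OF u_cont])
  have u01: "0 \<le> u k A" "u k A \<le> 1" for k A
    by (auto simp: u_def)
  have "(\<lambda>k. integral\<^sup>L l (u k)) \<longlonglongrightarrow> integral\<^sup>L l (\<lambda>_. 0)"
  proof (rule integral_dominated_convergence[where w="\<lambda>_. 1"])
    show "AE A in l. (\<lambda>k. u k A) \<longlonglongrightarrow> 0"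
    proof (rule AE_I2)
      fix A :: "nat \<Rightarrow> nat \<Rightarrow> real"
      obtain k0 where "\<bar>A 0 1\<bar> \<le> real k0" using real_arch_simple by blast
      then have "\<forall>\<^sub>F k in sequentially. u k A = 0"
        unfolding eventually_sequentially by (intro exI[of _ k0]) (auto simp: u_def)
      then show "(\<lambda>k. u k A) \<longlonglongrightarrow> 0" by (rule tendsto_eventually)
    qed
  qed (use l u_meas u01 in \<open>auto simp: prob_measures_iff cong: measurable_cong_sets\<close>)
  then have "\<forall>\<^sub>F k in sequentially. integral\<^sup>L l (u k) < \<epsilon>"
    using \<epsilon> by (intro order_tendstoD(2)) auto
  then obtain k where k: "integral\<^sup>L l (u k) < \<epsilon>"
    by (auto simp: eventually_sequentially)
  have "bounded (range (u k))"
    using u01[of k] by (intro boundedI[of _ 1]) (auto simp: abs_le_iff intro: order_trans[of _ 0])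
  then have "(\<lambda>n. integral\<^sup>L (law (a (r n))) (u k)) \<longlonglongrightarrow> integral\<^sup>L l (u k)"
    using lim u_cont by (simp add: limitin_weak_topology)
  moreover have "\<epsilon> \<le> integral\<^sup>L (law (a (r n))) (u k)" if n: "k + 1 \<le> n" for n
  proof -
    let ?\<alpha> = "a (r n)"
    interpret distance_kernel "m ?\<alpha>" "\<delta> ?\<alpha>" using kernel a(1) by simp
    have big: "{A :: nat \<Rightarrow> nat \<Rightarrow> real. real k + 1 < \<bar>A 0 1\<bar>} \<in> sets borel"
      by (rule sets_large_entry)
    have "real k + 1 \<le> real (r n)"
      using n seq_suble[OF r, of n] by linarith
    then have "\<epsilon> \<le> pair_tail (\<delta> ?\<alpha>) (m ?\<alpha>) (real k + 1)"
      using a(2)[of "r n"] pair_tail_antimono[of "real k + 1" "real (r n)"] by linarith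
    also have "\<dots> = measure (law ?\<alpha>) {A. real k + 1 < \<bar>A 0 1\<bar>}"
      by (rule measure_tau_infinity_tail[symmetric]) simp
    also have "\<dots> = integral\<^sup>L (law ?\<alpha>) (indicator {A. real k + 1 < \<bar>A 0 1\<bar>})"
      using big a(1) by (simp add: sets_law space_law)
    also have "\<dots> \<le> integral\<^sup>L (law ?\<alpha>) (u k)"
    proof (rule integral_mono)
      show "integrable (law ?\<alpha>) (indicator {A. real k + 1 < \<bar>A 0 1\<bar>} :: _ \<Rightarrow> real)"
        using big by (intro integrable_bounded[where B=1] tau_infinity_prob borel_measurable_indicator)
          (auto simp: indicator_def)
      show "integrable (law ?\<alpha>) (u k)"
        using u01 u_meas by (intro integrable_bounded[where B=1] tau_infinity_prob) auto
      show "indicator {A. real k + 1 < \<bar>A 0 1\<bar>} A \<le> u k A" for A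
        by (auto simp: indicator_def u_def)
    qed
    finally show ?thesis .
  qed
  ultimately have "\<epsilon> \<le> integral\<^sup>L l (u k)"
    by (intro LIMSEQ_le_const) blast+
  with k show False by simp
qed

lemma conditions_equivalent: "tightness_conditions_equivalent I X \<delta> m \<Omega> \<xi>"
  unfolding tightness_conditions_equivalent_def Let_def
    tight_variables_matrix_iff tight_variables_pair_iff ex_tight_section_iff
  using tight_measures_imp_uniform_tails uniform_tails_imp_tight_measures
    uniform_tails_imp_relatively_compact relatively_compact_imp_uniform_tails by blast

end

section \<open>Combinatorial trees\<close>

text \<open>The space of tree limits is generated by trees on natural numbers, while given trees and
  those constructed below have vertices of other types. This and the following lemmas transport
  walks, distances and cycles along an injection.\<close>

lemma walk_map_iff:
  assumes inj: "inj_on f V" and E: "E \<subseteq> Pow V" and p: "set p \<subseteq> V" and uv: "u \<in> V" "v \<in> V"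
  shows "walk (f ` V) ((`) f ` E) (f u) (map f p) (f v) \<longleftrightarrow> walk V E u p v"
proof (cases "p = []")
  case False
  have edge: "{f x, f y} \<in> (`) f ` E \<longleftrightarrow> {x, y} \<in> E" if "x \<in> set p" "y \<in> set p" for x y
  proof
    assume "{f x, f y} \<in> (`) f ` E"
    then obtain e where e: "e \<in> E" "f ` e = f ` {x, y}" by auto
    moreover have "{x, y} \<subseteq> V" "e \<subseteq> V" using that p e(1) E by auto
    ultimately have "e = {x, y}" using inj_on_image_eq_iff[OF inj] by blast
    with e show "{x, y} \<in> E" by simp
  next
    assume "{x, y} \<in> E"
    then have "f ` {x, y} \<in> (`) f ` E" by (rule imageI)
    then show "{f x, f y} \<in> (`) f ` E" by simp
  qed
  have "successively (\<lambda>x y. {x, y} \<in> (`) f ` E) (map f p) \<longleftrightarrow> successively (\<lambda>x y. {x, y} \<in> E) p"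
    unfolding successively_map using edge by (intro successively_cong) auto
  moreover have "hd p \<in> V" "last p \<in> V" using False p by auto
  ultimately show ?thesis
    using False p uv inj by (auto simp: walk_def hd_map last_map inj_on_eq_iff)
qed (simp add: walk_def)

lemma walk_image_obtain:
  assumes "walk (f ` V) E' u' p' v'"
  obtains p where "set p \<subseteq> V" "p' = map f p"
proof -
  have "set p' \<subseteq> f ` V" using assms by (simp add: walk_def)
  then have "set (map (inv_into V f) p') \<subseteq> V" and "map f (map (inv_into V f) p') = p'"
    by (auto intro: inv_into_into simp: f_inv_into_f subset_iff map_idI)
  then show ?thesis using that[of "map (inv_into V f) p'"] by simp
qed

lemma finite_tree_edges:
  assumes "finite_tree V E" shows "E \<subseteq> Pow V"
proof
  have "\<forall>e\<in>E. \<exists>u\<in>V. \<exists>v\<in>V. u \<noteq> v \<and> e = {u, v}"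
    using assms by (simp add: finite_tree_def)
  moreover fix e assume "e \<in> E"
  ultimately obtain u v where "u \<in> V" "v \<in> V" "e = {u, v}"
    by blast
  then show "e \<in> Pow V" by simp
qed

lemma graph_dist_image:
  assumes inj: "inj_on f V" and E: "E \<subseteq> Pow V" and uv: "u \<in> V" "v \<in> V"
  shows "graph_dist (f ` V) ((`) f ` E) (f u) (f v) = graph_dist V E u v"
proof -
  have "(\<exists>p'. walk (f ` V) ((`) f ` E) (f u) p' (f v) \<and> length p' = Suc n) \<longleftrightarrow>
      (\<exists>p. walk V E u p v \<and> length p = Suc n)" for n
  proof
    assume "\<exists>p'. walk (f ` V) ((`) f ` E) (f u) p' (f v) \<and> length p' = Suc n"
    then obtain p' where p': "walk (f ` V) ((`) f ` E) (f u) p' (f v)" "length p' = Suc n" by blast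
    from p'(1) obtain p where "set p \<subseteq> V" "p' = map f p" by (rule walk_image_obtain)
    with p' show "\<exists>p. walk V E u p v \<and> length p = Suc n"
      using walk_map_iff[OF inj E _ uv] by auto
  next
    assume "\<exists>p. walk V E u p v \<and> length p = Suc n"
    then obtain p where p: "walk V E u p v" "length p = Suc n" by blast
    then have "set p \<subseteq> V" by (simp add: walk_def)
    with p show "\<exists>p'. walk (f ` V) ((`) f ` E) (f u) p' (f v) \<and> length p' = Suc n"
      using walk_map_iff[OF inj E _ uv, of p] by (intro exI[of _ "map f p"]) simp
  qed
  then show ?thesis by (simp add: graph_dist_def)
qed

lemma finite_tree_image:
  assumes tree: "finite_tree V E" and inj: "inj_on f V"
  shows "finite_tree (f ` V) ((`) f ` E)"
proof -
  note E = finite_tree_edges[OF tree]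
  have edges: "\<exists>u\<in>V. \<exists>v\<in>V. u \<noteq> v \<and> e = {u, v}" if "e \<in> E" for e
    using tree that unfolding finite_tree_def by blast
  have conn: "\<exists>p. walk V E u p v" if "u \<in> V" "v \<in> V" for u v
    using tree that unfolding finite_tree_def by blast
  have "\<exists>u\<in>f ` V. \<exists>v\<in>f ` V. u \<noteq> v \<and> e' = {u, v}" if e': "e' \<in> (`) f ` E" for e'
  proof -
    obtain e where "e \<in> E" "e' = f ` e" using e' by auto
    moreover from edges[OF this(1)] obtain u v where "u \<in> V" "v \<in> V" "u \<noteq> v" "e = {u, v}" by blast
    ultimately show ?thesis
      using inj by (intro bexI[of _ "f u"] bexI[of _ "f v"]) (auto simp: inj_on_eq_iff)
  qed
  moreover have "\<exists>p. walk (f ` V) ((`) f ` E) u' p v'" if u'v': "u' \<in> f ` V" "v' \<in> f ` V" for u' v'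
  proof -
    obtain u v where uv: "u \<in> V" "v \<in> V" and eq: "u' = f u" "v' = f v" using u'v' by blast
    obtain p where p: "walk V E u p v" using conn[OF uv] by blast
    then have "set p \<subseteq> V" by (simp add: walk_def)
    with p show ?thesis
      using walk_map_iff[OF inj E _ uv, of p] by (intro exI[of _ "map f p"]) (simp add: eq)
  qed
  moreover have "\<nexists>p. graph_cycle (f ` V) ((`) f ` E) p"
  proof
    assume "\<exists>p. graph_cycle (f ` V) ((`) f ` E) p"
    then obtain p' where p': "graph_cycle (f ` V) ((`) f ` E) p'" ..
    then have w': "walk (f ` V) ((`) f ` E) (hd p') p' (last p')"
      by (simp add: graph_cycle_def)
    then obtain p where p: "set p \<subseteq> V" "p' = map f p" by (rule walk_image_obtain)
    have len: "length p \<ge> 3" using p' p by (simp add: graph_cycle_def)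
    then have ne: "p \<noteq> []" by auto
    then have ends: "hd p \<in> V" "last p \<in> V" using p(1) by auto
    have "walk V E (hd p) p (last p)"
      using w' walk_map_iff[OF inj E p(1) ends] ne by (simp add: p(2) hd_map last_map)
    moreover have "distinct p"
      using p' p(2) by (simp add: graph_cycle_def distinct_map)
    moreover have "{last p, hd p} \<in> E"
    proof -
      have "{f (last p), f (hd p)} \<in> (`) f ` E"
        using p' p ne by (simp add: graph_cycle_def hd_map last_map)
      then obtain e where e: "e \<in> E" "f ` {last p, hd p} = f ` e" by auto
      have "{last p, hd p} \<subseteq> V" "e \<subseteq> V" using ends e(1) E by auto
      then have "{last p, hd p} = e" using inj_on_image_eq_iff[OF inj] e(2) by blast
      then show ?thesis using e(1) by simp
    qed
    ultimately have "graph_cycle V E p"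
      using len by (simp add: graph_cycle_def)
    then show False using tree unfolding finite_tree_def by blast
  qed
  ultimately show ?thesis
    using tree unfolding finite_tree_def by simp
qed

text \<open>The two vertices are the successor and the predecessor on the cycle, with wrap-around at
  the ends. They differ because a cycle has at least three vertices.\<close>

lemma graph_cycle_neighbours:
  assumes cyc: "graph_cycle V E p" and i: "i < length p"
  obtains a b where "a \<in> set p" "b \<in> set p" "a \<noteq> b" "{p ! i, a} \<in> E" "{p ! i, b} \<in> E"
proof -
  let ?n = "length p"
  have n: "?n \<ge> 3" and dist: "distinct p" and close: "{last p, hd p} \<in> E"
    and succ: "\<And>k. Suc k < ?n \<Longrightarrow> {p ! k, p ! Suc k} \<in> E"
    using cyc unfolding graph_cycle_def walk_def successively_conv_nth by auto
  have ends: "{p ! (?n - 1), p ! 0} \<in> E"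
    using close n by (simp add: last_conv_nth hd_conv_nth flip: length_greater_0_conv)
  define nxt where "nxt = (if Suc i = ?n then 0 else Suc i)"
  define prv where "prv = (if i = 0 then ?n - 1 else i - 1)"
  have "nxt < ?n" "prv < ?n" "nxt \<noteq> prv"
    using i n by (auto simp: nxt_def prv_def)
  moreover have "{p ! i, p ! nxt} \<in> E"
  proof (cases "Suc i = ?n")
    case True
    then have "i = ?n - 1" by simp
    with ends True show ?thesis by (simp add: nxt_def)
  next
    case False
    with succ[of i] i show ?thesis by (simp add: nxt_def)
  qed
  moreover have "{p ! i, p ! prv} \<in> E"
  proof (cases "i = 0")
    case True
    with ends show ?thesis by (simp add: prv_def insert_commute)
  next
    case False
    with succ[of "i - 1"] i show ?thesis by (simp add: prv_def insert_commute)
  qed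
  ultimately show ?thesis
    using that[of "p ! nxt" "p ! prv"] dist by (simp add: nth_eq_iff_index_eq)
qed

text \<open>\<open>H x x\<close> plays the depth of \<open>x\<close>, and \<open>H x y\<close> the
  depth at which the paths from the root to \<open>x\<close> and to \<open>y\<close> part. By the
  last condition \<open>x\<close> and \<open>z\<close> stay together at least as long as both stay
  with \<open>y\<close>.\<close>

locale ultrametric_levels =
  fixes J :: "'j set" and H :: "'j \<Rightarrow> 'j \<Rightarrow> nat"
  assumes finite_J: "finite J" and J_ne: "J \<noteq> {}"
    and H_sym: "x \<in> J \<Longrightarrow> y \<in> J \<Longrightarrow> H x y = H y x"
    and H_le: "x \<in> J \<Longrightarrow> y \<in> J \<Longrightarrow> H x y \<le> H x x"
    and H_ultra: "x \<in> J \<Longrightarrow> y \<in> J \<Longrightarrow> z \<in> J \<Longrightarrow> min (H x y) (H y z) \<le> H x z"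
begin

text \<open>Cutting the ultrametric at level \<open>k\<close> leaves the vertices of depth \<open>k\<close>: the pair \<open>(x, k)\<close> is identified
  with \<open>(y, k)\<close> if \<open>k \<le> H x y\<close>.\<close>

definition node :: "'j \<Rightarrow> nat \<Rightarrow> nat \<times> 'j set" where
  "node x k = (k, {y \<in> J. k \<le> H x y})"

definition nodes :: "(nat \<times> 'j set) set" where
  "nodes = {node x k |x k. x \<in> J \<and> k \<le> H x x}"

definition edges :: "(nat \<times> 'j set) set set" where
  "edges = {{node x k, node x (Suc k)} |x k. x \<in> J \<and> k < H x x}"

lemma fst_node [simp]: "fst (node x k) = k"
  by (simp add: node_def)

lemma node_eqI:
  assumes "x \<in> J" "y \<in> J" "k \<le> H x y"
  shows "node x k = node y k"
proof -
  have "k \<le> H x z \<longleftrightarrow> k \<le> H y z" if "z \<in> J" for z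
    using H_ultra[of x y z] H_ultra[of y x z] H_sym[of x y] assms that by linarith
  then show ?thesis by (auto simp: node_def)
qed

text \<open>By \<open>l \<le> H y y\<close> the point \<open>y\<close> belongs to its own class,
  hence to the class of \<open>x\<close>.\<close>

lemma node_eqD:
  assumes "x \<in> J" "y \<in> J" "l \<le> H y y" "node x k = node y l"
  shows "k = l" "k \<le> H x y"
proof -
  show "k = l" using assms(4) by (metis fst_node)
  have "y \<in> {z \<in> J. l \<le> H y z}" using assms by simp
  then have "y \<in> {z \<in> J. k \<le> H x z}" using assms(4) unfolding node_def by blast
  then show "k \<le> H x y" by simp
qed

lemma finite_nodes: "finite nodes"
proof (rule finite_subset)
  show "nodes \<subseteq> (\<lambda>(x, k). node x k) ` (SIGMA x:J. {..H x x})"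
    unfolding nodes_def by auto
qed (use finite_J in auto)

lemma edge_cases:
  assumes "{a, b} \<in> edges"
  obtains x k where "x \<in> J" "k < H x x" "a = node x k" "b = node x (Suc k)"
  | x k where "x \<in> J" "k < H x x" "b = node x k" "a = node x (Suc k)"
proof -
  obtain x k where x: "x \<in> J" "k < H x x" and "{a, b} = {node x k, node x (Suc k)}"
    using assms by (auto simp: edges_def)
  then have "a = node x k \<and> b = node x (Suc k) \<or> b = node x k \<and> a = node x (Suc k)"
    unfolding doubleton_eq_iff by blast
  with x that show thesis by blast
qed

text \<open>A class at depth \<open>Suc k\<close> is contained in a single class at depth
  \<open>k\<close>. Comparing first components singles out the end point nearer to the root.\<close>

lemma parent_unique:
  assumes "{a, b} \<in> edges" "{a, b'} \<in> edges" "fst b \<le> fst a" "fst b' \<le> fst a"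
  shows "b = b'"
proof -
  obtain x k where x: "x \<in> J" "k < H x x" "b = node x k" "a = node x (Suc k)"
    using assms(1,3) by (auto elim: edge_cases)
  obtain y l where y: "y \<in> J" "l < H y y" "b' = node y l" "a = node y (Suc l)"
    using assms(2,4) by (auto elim: edge_cases)
  have "Suc k = Suc l" "Suc k \<le> H x y"
    using node_eqD[of x y "Suc l" "Suc k"] x y by auto
  then show ?thesis using node_eqI[of x y k] x y by simp
qed

text \<open>The walk goes from depth \<open>k\<close> towards the root down to depth
  \<open>j\<close> along \<open>x\<close> and away from it to depth \<open>l\<close> along
  \<open>y\<close>; at depth \<open>j\<close> both paths are at the same node.\<close>

lemma walk_via:
  assumes "x \<in> J" "y \<in> J" "k \<le> H x x" "l \<le> H y y" "j \<le> k" "j \<le> l" "j \<le> H x y"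
  shows "\<exists>p. walk nodes edges (node x k) p (node y l) \<and> length p = Suc ((k - j) + (l - j))"
proof -
  \<comment> \<open>The second part starts at \<open>Suc j\<close> because the common node at depth
    \<open>j\<close> already ends the first one.\<close>
  let ?up = "rev (map (node x) [j..<Suc k])" and ?down = "map (node y) [Suc j..<Suc l]"
  let ?E = "\<lambda>a b. {a, b} \<in> edges"
  have edge: "{node z i, node z (Suc i)} \<in> edges" if "z \<in> J" "i < H z z" for z i
    using that unfolding edges_def by blast
  have up: "successively ?E ?up"
    unfolding successively_rev
    using assms edge[of x] by (auto simp: successively_conv_nth insert_commute simp del: upt_Suc)
  have down: "successively ?E ?down"
    using assms edge[of y] by (auto simp: successively_conv_nth simp del: upt_Suc)
  have last_up: "last ?up = node y j"
    using assms node_eqI[of x y j] by (simp add: hd_map last_rev del: upt_Suc)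
  have "successively ?E (?up @ ?down)"
  proof (cases "j = l")
    case False
    then have "hd ?down = node y (Suc j)"
      using assms by (simp add: hd_map hd_upt del: upt_Suc)
    then show ?thesis
      using up down last_up edge[of y j] False assms by (simp add: successively_append_iff del: upt_Suc)
  qed (use up in \<open>simp del: upt_Suc\<close>)
  moreover have "hd (?up @ ?down) = node x k"
    using assms by (simp add: hd_append hd_rev last_map)
  moreover have "last (?up @ ?down) = node y l"
  proof (cases "j = l")
    case True
    then show ?thesis using last_up by (simp del: upt_Suc)
  next
    case False
    then have "?down \<noteq> []" "last ?down = node y l" using assms by (auto simp: last_map)
    then show ?thesis by (simp add: last_append del: upt_Suc)
  qed
  moreover have "set (?up @ ?down) \<subseteq> nodes"
  proof -
    have "node x i \<in> nodes" if "i < Suc k" for i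
      using that assms unfolding nodes_def by (intro CollectI exI[of _ x] exI[of _ i]) auto
    moreover have "node y i \<in> nodes" if "i < Suc l" for i
      using that assms unfolding nodes_def by (intro CollectI exI[of _ y] exI[of _ i]) auto
    ultimately show ?thesis by (auto simp del: upt_Suc)
  qed
  moreover have len: "length (?up @ ?down) = Suc ((k - j) + (l - j))"
    using assms by (cases "Suc j \<le> l") (simp_all del: upt_Suc)
  moreover from len have "?up @ ?down \<noteq> []"
    by (metis list.size(3) nat.distinct(2))
  ultimately have "walk nodes edges (node x k) (?up @ ?down) (node y l)"
    unfolding walk_def by (intro conjI)
  with len show ?thesis by (intro exI[of _ "?up @ ?down"] conjI)
qed

lemma min_level_eq:
  assumes "x \<in> J" "z \<in> J" "y \<in> J" "i \<le> H x z"
  shows "min i (H x y) = min i (H z y)"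
  using H_ultra[of x z y] H_ultra[of z x y] H_sym[of x z] assms by linarith

text \<open>The quantity \<open>k + H y y - 2 * min k (H x y)\<close>, the expected distance to the
  target, drops by at most 1 along an edge: away from the root \<open>k\<close> grows by 1 and the
  minimum by at most 1, towards the root \<open>k\<close> drops by 1 and the minimum does not grow.
  An edge may name its node by another representative, which \<open>min_level_eq\<close>
  absorbs.\<close>

lemma walk_length_ge:
  assumes "walk nodes edges (node x k) p (node y (H y y))" "x \<in> J" "y \<in> J" "k \<le> H x x"
  shows "k + H y y + 1 \<le> length p + 2 * min k (H x y)"
  using assms
proof (induction p arbitrary: x k)
  case (Cons a q)
  show ?case
  proof (cases q)
    case Nil
    then have "node x k = node y (H y y)" using Cons.prems(1) unfolding walk_def by fastforce
    with Cons.prems node_eqD[of x y "H y y" k] Nil show ?thesis by simp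
  next
    case (Cons b q')
    have a: "a = node x k" and ab: "{a, b} \<in> edges"
      using Cons.prems Cons by (auto simp: walk_def)
    have w: "walk nodes edges b q (node y (H y y))"
      using Cons.prems(1) Cons by (auto simp: walk_def)
    from ab show ?thesis
    proof (cases rule: edge_cases)
      case (1 z i)
      then have "k = i" "i \<le> H x z"
        using node_eqD[of x z i k] a Cons.prems by auto
      moreover have "Suc i + H y y + 1 \<le> length q + 2 * min (Suc i) (H z y)"
        using Cons.IH[of z "Suc i"] w 1 Cons.prems(3) by simp
      moreover have "min i (H x y) = min i (H z y)"
        using min_level_eq[of x z y i] calculation(2) 1(1) Cons.prems(2,3) by simp
      moreover have "min (Suc i) (H z y) \<le> Suc (min i (H z y))" by simp
      ultimately show ?thesis by simp
    next
      case (2 z i)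
      then have k: "k = Suc i" and "Suc i \<le> H x z"
        using node_eqD[of x z "Suc i" k] a Cons.prems by auto
      have "i + H y y + 1 \<le> length q + 2 * min i (H z y)"
        using Cons.IH[of z i] w 2 Cons.prems(3) by simp
      moreover have "min (Suc i) (H x y) = min (Suc i) (H z y)"
        using min_level_eq[of x z y "Suc i"] \<open>Suc i \<le> H x z\<close> 2(1) Cons.prems(2,3) by simp
      moreover have "min i (H z y) \<le> min (Suc i) (H z y)" by (rule min.mono) simp_all
      moreover define u w where "u = min i (H z y)" and "w = min (Suc i) (H x y)"
      ultimately have "Suc i + H y y + 1 \<le> Suc (length q) + 2 * w"
        by linarith
      then show ?thesis by (simp add: k w_def)
    qed
  qed
qed (simp add: walk_def)

text \<open>All nodes of depth 0 coincide, so any two nodes are connected through the root. On a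
  cycle, a vertex of maximal depth would have its two neighbours as two different parents.\<close>

lemma finite_tree_nodes: "finite_tree nodes edges"
  unfolding finite_tree_def
proof (intro conjI ballI finite_nodes)
  show "nodes \<noteq> {}" using J_ne unfolding nodes_def by blast
  show "\<exists>u\<in>nodes. \<exists>v\<in>nodes. u \<noteq> v \<and> e = {u, v}" if e: "e \<in> edges" for e
  proof -
    obtain x k where x: "x \<in> J" "k < H x x" "e = {node x k, node x (Suc k)}"
      using e unfolding edges_def by auto
    moreover have "node x k \<noteq> node x (Suc k)" by (metis fst_node n_not_Suc_n)
    moreover have "node x k \<in> nodes" "node x (Suc k) \<in> nodes"
      using x unfolding nodes_def by (force intro: less_imp_le Suc_leI)+
    ultimately show ?thesis by blast
  qed
  show "\<exists>p. walk nodes edges u p v" if "u \<in> nodes" "v \<in> nodes" for u v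
    using that walk_via[where j=0] unfolding nodes_def by blast
  show "\<nexists>p. graph_cycle nodes edges p"
  proof
    assume "\<exists>p. graph_cycle nodes edges p"
    then obtain p where p: "graph_cycle nodes edges p" ..
    define D where "D = Max (fst ` set p)"
    have ne: "set p \<noteq> {}" using p by (auto simp: graph_cycle_def)
    then have "D \<in> fst ` set p" unfolding D_def by (intro Max_in) auto
    then obtain i where i: "i < length p" "fst (p ! i) = D" by (auto simp: in_set_conv_nth)
    have max: "fst a \<le> fst (p ! i)" if "a \<in> set p" for a
      using that unfolding i(2) D_def by (intro Max_ge) auto
    from graph_cycle_neighbours[OF p i(1)] obtain a b
      where "a \<in> set p" "b \<in> set p" "a \<noteq> b" "{p ! i, a} \<in> edges" "{p ! i, b} \<in> edges" .
    then show False using parent_unique max by blast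
  qed
qed

lemma graph_dist_tops:
  assumes "x \<in> J" "y \<in> J"
  shows "real (graph_dist nodes edges (node x (H x x)) (node y (H y y))) =
    real (H x x) + real (H y y) - 2 * real (H x y)"
proof -
  let ?P = "\<lambda>n. \<exists>p. walk nodes edges (node x (H x x)) p (node y (H y y)) \<and> length p = Suc n"
  have le: "H x y \<le> H x x" "H x y \<le> H y y"
    using assms H_le[of x y] H_le[of y x] H_sym[of x y] by auto
  have "graph_dist nodes edges (node x (H x x)) (node y (H y y)) = (H x x - H x y) + (H y y - H x y)"
    unfolding graph_dist_def
  proof (rule Least_equality)
    show "?P ((H x x - H x y) + (H y y - H x y))"
      using walk_via[of x y "H x x" "H y y" "H x y"] assms le by blast
    fix n assume "?P n"
    then obtain p where "walk nodes edges (node x (H x x)) p (node y (H y y))" "length p = Suc n" by blast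
    from walk_length_ge[OF this(1) assms] this(2) le
    show "(H x x - H x y) + (H y y - H x y) \<le> n" by simp
  qed
  with le show ?thesis by (simp add: of_nat_diff)
qed

end

section \<open>Laws in the closure of finite trees\<close>

declare space_uniform_count_measure [simp] sets_uniform_count_measure [simp]

lemma sets_uniform_count_pair:
  assumes "finite V"
  shows "sets (uniform_count_measure V \<Otimes>\<^sub>M uniform_count_measure V) = Pow (V \<times> V)"
proof -
  have "sets (uniform_count_measure V \<Otimes>\<^sub>M uniform_count_measure V) =
      sets (count_space V \<Otimes>\<^sub>M count_space V)"
    by (intro sets_pair_measure_cong) simp_all
  also have "\<dots> = sets (count_space (V \<times> V))"
    by (subst pair_measure_countable) (use assms in \<open>auto intro: countable_finite\<close>)
  finally show ?thesis by simp
qed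

lemma sample_kernel_finite:
  assumes "finite V" "V \<noteq> {}"
  shows "sample_kernel (uniform_count_measure V) \<delta>"
  unfolding sample_kernel_def sample_kernel_axioms_def
proof
  show "prob_space (uniform_count_measure V)"
    using assms by (rule prob_space_uniform_count_measure)
  show "(\<lambda>(x, y). \<delta> x y) \<in> borel_measurable (uniform_count_measure V \<Otimes>\<^sub>M uniform_count_measure V)"
    by (rule measurableI) (auto simp: sets_uniform_count_pair[OF assms(1)] space_pair_measure)
qed

lemma tau_infinity_cong:
  assumes "\<And>x y. x \<in> space m \<Longrightarrow> y \<in> space m \<Longrightarrow> \<delta> x y = \<delta>' x y"
  shows "tau_infinity \<delta> m = tau_infinity \<delta>' m"
  unfolding tau_infinity_def
  by (rule distr_cong) (use assms in \<open>auto simp: dist_matrix_def space_PiM PiE_iff fun_eq_iff\<close>)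

lemma distr_uniform_count_measure:
  assumes V: "finite V" and f: "bij_betw f V W"
  shows "distr (uniform_count_measure V) (uniform_count_measure W) f = uniform_count_measure W"
proof (rule measure_eqI)
  have W: "finite W" "card V = card W" "W = f ` V" and inj: "inj_on f V"
    using f V by (auto simp: bij_betw_def card_image)
  have meas: "f \<in> uniform_count_measure V \<rightarrow>\<^sub>M uniform_count_measure W"
    using f by (intro measurableI) (auto simp: bij_betw_def)
  fix A assume "A \<in> sets (distr (uniform_count_measure V) (uniform_count_measure W) f)"
  then have A: "A \<subseteq> W" by simp
  have "f ` (f -` A \<inter> V) = A" using A W by auto
  then have "card (f -` A \<inter> V) = card A"
    by (metis card_image inj inf_le2 inj_on_subset)
  then show "emeasure (distr (uniform_count_measure V) (uniform_count_measure W) f) A =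
      emeasure (uniform_count_measure W) A"
    using A V W(1) by (simp add: emeasure_distr[OF meas] emeasure_uniform_count_measure W(2))
qed simp

lemma tau_infinity_finite_comp:
  assumes m: "prob_space m" and f: "f \<in> m \<rightarrow>\<^sub>M uniform_count_measure V"
    and law: "distr m (uniform_count_measure V) f = uniform_count_measure V"
    and V: "finite V" "V \<noteq> {}"
  shows "tau_infinity (\<lambda>x y. \<delta> (f x) (f y)) m = tau_infinity \<delta> (uniform_count_measure V)"
  using tau_infinity_comp[OF m f, of \<delta>] sample_kernel_finite[OF V, of \<delta>] by (simp add: law)

lemma finite_tree_law_in_tree_limits:
  assumes tree: "finite_tree (V :: 'v set) E" and c: "c > 0"
  shows "tau_infinity (rescaled_dist c V E) (uniform_count_measure V) \<in> topspace tree_limits"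
proof -
  have V: "finite V" "V \<noteq> {}" using tree by (auto simp: finite_tree_def)
  obtain f :: "'v \<Rightarrow> nat" where f: "inj_on f V"
    using finite_imp_inj_to_nat_seg[OF V(1)] by blast
  define W where "W = f ` V"
  have W: "finite W" "W \<noteq> {}" using V by (auto simp: W_def)
  have bij: "bij_betw f V W" using f by (simp add: W_def bij_betw_def)
  have "tau_infinity (rescaled_dist c W ((`) f ` E)) (uniform_count_measure W) =
      tau_infinity (\<lambda>x y. rescaled_dist c W ((`) f ` E) (f x) (f y)) (uniform_count_measure V)"
  proof (rule tau_infinity_finite_comp[symmetric, OF _ _ distr_uniform_count_measure[OF V(1) bij] W])
    show "prob_space (uniform_count_measure V)"
      using V by (rule prob_space_uniform_count_measure)
    show "f \<in> uniform_count_measure V \<rightarrow>\<^sub>M uniform_count_measure W"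
      by (rule measurableI) (auto simp: W_def)
  qed
  also have "\<dots> = tau_infinity (rescaled_dist c V E) (uniform_count_measure V)"
    using graph_dist_image[OF f finite_tree_edges[OF tree]]
    by (intro tau_infinity_cong) (simp add: rescaled_dist_def W_def)
  finally have eq: "tau_infinity (rescaled_dist c V E) (uniform_count_measure V) =
      tau_infinity (rescaled_dist c W ((`) f ` E)) (uniform_count_measure W)" ..
  have "tau_infinity (rescaled_dist c V E) (uniform_count_measure V) \<in>
     {tau_infinity (rescaled_dist c V E) (uniform_count_measure V) |c (V :: nat set) E. finite_tree V E \<and> c > 0}"
    using finite_tree_image[OF tree f] c unfolding eq by (auto simp: W_def)
  moreover have "{tau_infinity (rescaled_dist c V E) (uniform_count_measure V) |c (V :: nat set) E.
      finite_tree V E \<and> c > 0} \<subseteq> topspace weak_topology"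
  proof (rule subsetI, elim CollectE exE conjE)
    fix \<mu> c E and V :: "nat set"
    assume "\<mu> = tau_infinity (rescaled_dist c V E) (uniform_count_measure V)" "finite_tree V E"
    then show "\<mu> \<in> topspace weak_topology"
      using sample_kernel.tau_infinity_prob[OF sample_kernel_finite[of V]]
      by (simp add: topspace_weak_topology finite_tree_def)
  qed
  ultimately show ?thesis
    unfolding topspace_tree_limits using closure_of_subset by blast
qed

section \<open>Uniform variables and trees with many leaves\<close>

abbreviation unif :: "real measure" where
  "unif \<equiv> restrict_space lborel {0<..<1}"

lemma prob_space_unif: "prob_space unif"
  by (auto simp: emeasure_restrict_space space_restrict_space intro!: prob_spaceI)

lemma space_unif: "space unif = {0<..<1}"
  by (simp add: space_restrict_space)

lemma borel_measurable_unif: "f \<in> borel \<rightarrow>\<^sub>M N \<Longrightarrow> f \<in> unif \<rightarrow>\<^sub>M N"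
  by (intro measurable_restrict_space1) simp

lemma distr_unif_floor:
  assumes "0 < M"
  shows "(\<lambda>u. nat \<lfloor>u * real M\<rfloor>) \<in> unif \<rightarrow>\<^sub>M uniform_count_measure {..<M}"
    and "distr unif (uniform_count_measure {..<M}) (\<lambda>u. nat \<lfloor>u * real M\<rfloor>) = uniform_count_measure {..<M}"
proof -
  let ?f = "\<lambda>u. nat \<lfloor>u * real M\<rfloor>"
  \<comment> \<open>The sample space is the open interval, so the first of the \<open>M\<close>
    pieces loses its left end point 0.\<close>
  have pre: "?f -` {k} \<inter> space unif = {real k / real M..<(real k + 1) / real M} - {0}" if "k < M" for k
  proof -
    have iff: "nat \<lfloor>u * real M\<rfloor> = k \<longleftrightarrow> real k / real M \<le> u \<and> u < (real k + 1) / real M" if "0 < u" for u :: real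
    proof -
      have "nat \<lfloor>u * real M\<rfloor> = k \<longleftrightarrow> \<lfloor>u * real M\<rfloor> = int k"
        using that by auto
      also have "\<dots> \<longleftrightarrow> real k \<le> u * real M \<and> u * real M < real k + 1"
        by (simp add: floor_eq_iff)
      finally show ?thesis using assms by (simp add: field_simps)
    qed
    have lt1: "u < 1" if "u < (real k + 1) / real M" for u
    proof -
      have "(real k + 1) / real M \<le> 1"
        using \<open>k < M\<close> by (simp add: field_simps)
      with that show ?thesis by linarith
    qed
    have pos: "0 < u" if "real k / real M \<le> u" "u \<noteq> 0" for u
    proof -
      have "0 \<le> real k / real M" by simp
      with that show ?thesis by linarith
    qed
    show ?thesis
    proof (rule set_eqI)
      fix u
      have "u \<in> ?f -` {k} \<inter> space unif \<longleftrightarrow> 0 < u \<and> u < 1 \<and> nat \<lfloor>u * real M\<rfloor> = k"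
        by (auto simp: space_unif)
      also have "\<dots> \<longleftrightarrow> 0 < u \<and> u < 1 \<and> real k / real M \<le> u \<and> u < (real k + 1) / real M"
        using iff by blast
      also have "\<dots> \<longleftrightarrow> u \<in> {real k / real M..<(real k + 1) / real M} - {0}"
        using lt1[of u] pos[of u] by fastforce
      finally show "u \<in> ?f -` {k} \<inter> space unif \<longleftrightarrow> u \<in> {real k / real M..<(real k + 1) / real M} - {0}" .
    qed
  qed
  have in_range: "?f u < M" if "u \<in> space unif" for u
  proof -
    have "u * real M < real M" using that assms by (simp add: space_unif)
    then show ?thesis using that by (simp add: space_unif nat_less_iff floor_less_iff)
  qed
  have "(\<lambda>u. u * real M) \<in> borel_measurable borel" by simp
  from measurable_compose[OF measurable_compose[OF this measurable_real_floor]]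
  have "?f \<in> borel \<rightarrow>\<^sub>M count_space UNIV" by simp
  then have "?f \<in> unif \<rightarrow>\<^sub>M count_space UNIV"
    by (rule borel_measurable_unif)
  then show f: "?f \<in> unif \<rightarrow>\<^sub>M uniform_count_measure {..<M}"
    using in_range by (auto simp: measurable_def)
  show "distr unif (uniform_count_measure {..<M}) ?f = uniform_count_measure {..<M}"
  proof (rule measure_eqI_finite)
    show "finite {..<M}" by simp
    fix k assume k: "k \<in> {..<M}"
    have sub: "{real k / real M..<(real k + 1) / real M} - {0} \<subseteq> {0<..<1 :: real}"
      using pre[of k] k by (auto simp: space_unif)
    have "emeasure (distr unif (uniform_count_measure {..<M}) ?f) {k} = emeasure unif ({real k / real M..<(real k + 1) / real M} - {0})"
      using k pre[of k] by (simp add: emeasure_distr[OF f])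
    also have "\<dots> = emeasure lborel ({real k / real M..<(real k + 1) / real M} - {0})"
      using sub by (intro emeasure_restrict_space) auto
    also have "\<dots> = emeasure lborel {real k / real M..<(real k + 1) / real M}"
      by (rule emeasure_Diff_null_set) auto
    also have "\<dots> = ennreal (1 / real M)"
      by (subst emeasure_lborel_Ico) (auto simp: add_divide_distrib divide_right_mono)
    also have "\<dots> = emeasure (uniform_count_measure {..<M}) {k}"
      using k by (simp add: emeasure_uniform_count_measure)
    finally show "emeasure (distr unif (uniform_count_measure {..<M}) ?f) {k} = emeasure (uniform_count_measure {..<M}) {k}" .
  qed auto
qed

text \<open>\<open>L\<close> leaves are hung on each of \<open>N\<close> tree vertices, where \<open>L\<close> bounds the number of inner vertices. Leaves
  are numbered in blocks of length \<open>L\<close>, before all inner vertices, so that a uniform vertex is the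
  leaf of a nearly uniform block.\<close>

lemma leaf_tree:
  fixes N :: nat
  assumes "ultrametric_levels {..<N} G"
  shows "\<exists>(V :: (nat \<times> (nat \<times> nat) set) set) E M L e.
    finite_tree V E \<and> 0 < L \<and> N * L \<le> M \<and> M \<le> (N + 1) * L \<and> bij_betw e {..<M} V \<and>
    (\<forall>a<N * L. \<forall>b<N * L. a div L \<noteq> b div L \<longrightarrow>
      real (graph_dist V E (e a) (e b)) =
        real (G (a div L) (a div L)) + real (G (b div L) (b div L)) + 2 - 2 * real (G (a div L) (b div L)))"
proof -
  interpret G: ultrametric_levels "{..<N}" G by fact
  \<comment> \<open>The number of pairs (i, k) with \<open>k \<le> G i i\<close>; every inner node
    comes from such a pair.\<close>
  define L where "L = (\<Sum>i<N. G i i + 1)"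
  have "0 < N" using G.J_ne by (cases "N = 0") auto
  then have L: "0 < L" unfolding L_def by (intro sum_pos) auto
  define J where "J = {..<N} \<times> {..<L}"
  \<comment> \<open>A leaf of block \<open>i\<close> hangs one edge beyond depth
    \<open>G i i\<close>, and two leaves of one block part exactly at that depth. For leaves of
    different blocks the two extra edges give the 2 in the distance formula.\<close>
  define H where "H x y = (if x = y then G (fst x) (fst x) + 1 else G (fst x) (fst y))" for x y :: "nat \<times> nat"
  interpret T: ultrametric_levels J H
  proof
    show "finite J" "J \<noteq> {}" using \<open>0 < N\<close> L by (auto simp: J_def)
    fix x y assume xy: "x \<in> J" "y \<in> J"
    then have N: "fst x < N" "fst y < N" by (auto simp: J_def)
    show "H x y = H y x" using G.H_sym N by (simp add: H_def)
    show "H x y \<le> H x x" using G.H_le[of "fst x" "fst y"] N by (simp add: H_def)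
    fix z assume "z \<in> J"
    then have N': "fst z < N" by (auto simp: J_def)
    show "min (H x y) (H y z) \<le> H x z"
    proof (cases "x = z")
      case True
      then show ?thesis using G.H_le[of "fst x" "fst y"] N by (auto simp: H_def min_def)
    next
      case False
      then show ?thesis
        using G.H_ultra[of "fst x" "fst y" "fst z"] N N' by (auto simp: H_def)
    qed
  qed
  define top where "top x = T.node x (H x x)" for x
  have top_inj: "inj_on top J"
  proof (rule inj_onI, rule ccontr)
    fix x y assume xy: "x \<in> J" "y \<in> J" "top x = top y" and ne: "x \<noteq> y"
    from T.node_eqD[of x y "H y y" "H x x"] xy have "H x x \<le> H x y"
      by (simp add: top_def)
    moreover have "G (fst x) (fst y) \<le> G (fst x) (fst x)"
      using xy by (intro G.H_le) (auto simp: J_def)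
    ultimately show False using ne by (simp add: H_def)
  qed
  have top_nodes: "top ` J \<subseteq> T.nodes"
    by (auto simp: top_def T.nodes_def)
  define R where "R = T.nodes - top ` J"
  have fin: "finite R" using T.finite_nodes by (simp add: R_def)
  \<comment> \<open>An inner node over block \<open>i\<close> has depth at most
    \<open>G i i\<close>, where the leaves of the block are not yet told apart; so the leaf with
    number 0 represents it.\<close>
  have "R \<subseteq> (\<lambda>(i, k). T.node (i, 0) k) ` (SIGMA i:{..<N}. {..G i i})"
  proof
    fix w assume w: "w \<in> R"
    then obtain x k where x: "x \<in> J" "k \<le> H x x" "w = T.node x k"
      by (auto simp: R_def T.nodes_def)
    have "k \<noteq> H x x"
      using w x by (auto simp: R_def top_def)
    then have k: "k \<le> G (fst x) (fst x)" using x by (simp add: H_def)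
    have mem: "(fst x, 0) \<in> J" "fst x < N" using x(1) L by (auto simp: J_def)
    have "k \<le> H x (fst x, 0)" using k by (simp add: H_def)
    then have "w = T.node (fst x, 0) k"
      unfolding x(3) by (rule T.node_eqI[OF x(1) mem(1)])
    then show "w \<in> (\<lambda>(i, k). T.node (i, 0) k) ` (SIGMA i:{..<N}. {..G i i})"
      using k mem(2) by (intro image_eqI[of _ _ "(fst x, k)"]) auto
  qed
  then have "card R \<le> card (SIGMA i:{..<N}. {..G i i})"
    by (intro surj_card_le) auto
  also have "\<dots> = L" by (simp add: L_def)
  finally have card_R: "card R \<le> L" .
  define M where "M = N * L + card R"
  obtain b where b: "bij_betw b {N * L..<M} R"
    using finite_same_card_bij[of "{N * L..<M}" R] fin by (auto simp: M_def)
  define e where "e a = (if a < N * L then top (a div L, a mod L) else b a)" for a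
  have "bij_betw (\<lambda>a. (a div L, a mod L)) {..<N * L} J"
  proof (rule bij_betw_byWitness[where f'="\<lambda>(i, l). i * L + l"])
    show "(\<lambda>(i, l). i * L + l) ` J \<subseteq> {..<N * L}"
    proof
      fix a assume "a \<in> (\<lambda>(i, l). i * L + l) ` J"
      then obtain i l where il: "i < N" "l < L" "a = i * L + l" by (auto simp: J_def)
      then have "a < (i + 1) * L" by simp
      also have "\<dots> \<le> N * L" using il(1) by (intro mult_le_mono1) simp
      finally show "a \<in> {..<N * L}" by simp
    qed
  qed (use L in \<open>auto simp: J_def less_mult_imp_div_less\<close>)
  then have "bij_betw (top \<circ> (\<lambda>a. (a div L, a mod L))) {..<N * L} (top ` J)"
    using top_inj by (intro bij_betw_trans) (auto simp: bij_betw_def)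
  then have "bij_betw e {..<N * L} (top ` J)"
    by (rule bij_betw_cong[THEN iffD1, rotated]) (simp add: e_def)
  moreover have "bij_betw e {N * L..<M} R"
    using b by (rule bij_betw_cong[THEN iffD1, rotated]) (simp add: e_def)
  moreover have "top ` J \<inter> R = {}" by (auto simp: R_def)
  ultimately have "bij_betw e ({..<N * L} \<union> {N * L..<M}) (top ` J \<union> R)"
    by (rule bij_betw_combine)
  moreover have "{..<N * L} \<union> {N * L..<M} = {..<M}" by (auto simp: M_def)
  moreover have "top ` J \<union> R = T.nodes" using top_nodes by (auto simp: R_def)
  ultimately have bij: "bij_betw e {..<M} T.nodes" by simp
  have dist: "real (graph_dist T.nodes T.edges (e a) (e b)) =
      real (G (a div L) (a div L)) + real (G (b div L) (b div L)) + 2 - 2 * real (G (a div L) (b div L))"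
    if ab: "a < N * L" "b < N * L" "a div L \<noteq> b div L" for a b
  proof -
    have "(a div L, a mod L) \<in> J" "(b div L, b mod L) \<in> J"
      using ab L by (auto simp: J_def less_mult_imp_div_less)
    from T.graph_dist_tops[OF this] show ?thesis
      using ab by (simp add: e_def top_def H_def)
  qed
  show ?thesis
    using T.finite_tree_nodes L bij dist card_R
    by (intro exI[of _ T.nodes] exI[of _ T.edges] exI[of _ M] exI[of _ L] exI[of _ e]) (auto simp: M_def)
qed

lemma sample_kernel_comp:
  assumes m: "prob_space m" and \<phi>: "\<phi> \<in> m \<rightarrow>\<^sub>M m'" and "sample_kernel (distr m m' \<phi>) \<delta>"
  shows "sample_kernel m (\<lambda>x y. \<delta> (\<phi> x) (\<phi> y))"
  unfolding sample_kernel_def sample_kernel_axioms_def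
proof
  have "sets (distr m m' \<phi> \<Otimes>\<^sub>M distr m m' \<phi>) = sets (m' \<Otimes>\<^sub>M m')"
    by (intro sets_pair_measure_cong) simp_all
  then have "(\<lambda>(x, y). \<delta> x y) \<in> borel_measurable (m' \<Otimes>\<^sub>M m')"
    using assms(3) by (simp add: sample_kernel_def sample_kernel_axioms_def cong: measurable_cong_sets)
  moreover have "(\<lambda>p. (\<phi> (fst p), \<phi> (snd p))) \<in> m \<Otimes>\<^sub>M m \<rightarrow>\<^sub>M m' \<Otimes>\<^sub>M m'"
    by (intro measurable_Pair measurable_compose[OF measurable_fst \<phi>] measurable_compose[OF measurable_snd \<phi>])
  ultimately have "(\<lambda>p. case (\<phi> (fst p), \<phi> (snd p)) of (x, y) \<Rightarrow> \<delta> x y) \<in> borel_measurable (m \<Otimes>\<^sub>M m)"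
    by (rule measurable_compose[rotated])
  then show "(\<lambda>(x, y). \<delta> (\<phi> x) (\<phi> y)) \<in> borel_measurable (m \<Otimes>\<^sub>M m)"
    by (simp add: case_prod_beta)
qed (rule m)

lemma sample_kernel_countable:
  fixes m :: "'a::countable measure"
  assumes "prob_space m" "sets m = UNIV"
  shows "sample_kernel m \<delta>"
  unfolding sample_kernel_def sample_kernel_axioms_def
proof
  have "sets (m \<Otimes>\<^sub>M m) = sets (count_space UNIV \<Otimes>\<^sub>M count_space UNIV)"
    using assms(2) by (intro sets_pair_measure_cong) simp_all
  also have "\<dots> = sets (count_space UNIV)"
    by (subst pair_measure_countable) auto
  finally show "(\<lambda>(x, y). \<delta> x y) \<in> borel_measurable (m \<Otimes>\<^sub>M m)"
    by (intro measurableI) simp_all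
qed (rule assms(1))

lemma AE_pair_marginals:
  assumes m: "prob_space m" and P: "AE x in m. P x"
  shows "AE p in m \<Otimes>\<^sub>M m. P (fst p) \<and> P (snd p)"
proof -
  interpret prob_space m by fact
  have 1: "distr (m \<Otimes>\<^sub>M m) m fst = m"
    by (rule measure_eqI)
      (auto simp: emeasure_distr space_pair_measure emeasure_pair_measure_Times emeasure_space_1
        vimage_fst sets.sets_into_space Times_Int_Times Int_absorb2)
  have 2: "distr (m \<Otimes>\<^sub>M m) m snd = m"
    by (rule measure_eqI)
      (auto simp: emeasure_distr space_pair_measure emeasure_pair_measure_Times emeasure_space_1
        vimage_snd sets.sets_into_space Times_Int_Times Int_absorb2)
  have "AE x in distr (m \<Otimes>\<^sub>M m) m fst. P x" "AE x in distr (m \<Otimes>\<^sub>M m) m snd. P x"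
    unfolding 1 2 by (rule P)+
  then show ?thesis
    using AE_distrD[OF measurable_fst] AE_distrD[OF measurable_snd] by auto
qed

text \<open>Distinct values select different blocks of leaves once the trees are large, and it is
  for different blocks that \<open>leaf_tree\<close> states a distance.\<close>

lemma AE_unif_distinct: "AE p in unif \<Otimes>\<^sub>M unif. fst p \<noteq> snd p"
proof -
  interpret prob_space unif by (rule prob_space_unif)
  interpret pair_prob_space unif unif ..
  have "{p \<in> space (unif \<Otimes>\<^sub>M unif). fst p \<noteq> snd p} \<in> sets (unif \<Otimes>\<^sub>M unif)"
  proof (rule borel_measurable_neq)
    show "fst \<in> borel_measurable (unif \<Otimes>\<^sub>M unif)"
      using measurable_compose[OF measurable_fst borel_measurable_unif[OF measurable_ident]] by simp
    show "snd \<in> borel_measurable (unif \<Otimes>\<^sub>M unif)"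
      using measurable_compose[OF measurable_snd borel_measurable_unif[OF measurable_ident]] by simp
  qed
  moreover have "AE v in unif. u \<noteq> v" for u
    using AE_lborel_singleton[of u] by (subst AE_restrict_space_iff) (auto elim: eventually_mono)
  ultimately show ?thesis
    by (intro AE_pair_measure) auto
qed

section \<open>Approximation of discrete laws by finite trees\<close>

lemma floor_scaled_tendsto:
  assumes "0 \<le> x"
  shows "(\<lambda>n. real (nat \<lfloor>real (Suc n) * x\<rfloor>) / real (Suc n)) \<longlonglongrightarrow> x"
proof (rule tendsto_sandwich)
  show "\<forall>\<^sub>F n in sequentially. x - 1 / real (Suc n) \<le> real (nat \<lfloor>real (Suc n) * x\<rfloor>) / real (Suc n)"
  proof (rule always_eventually, rule allI)
    fix n
    have "real (Suc n) * x - 1 \<le> real (nat \<lfloor>real (Suc n) * x\<rfloor>)" by linarith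
    then have "(real (Suc n) * x - 1) / real (Suc n) \<le> real (nat \<lfloor>real (Suc n) * x\<rfloor>) / real (Suc n)"
      by (rule divide_right_mono) simp
    then show "x - 1 / real (Suc n) \<le> real (nat \<lfloor>real (Suc n) * x\<rfloor>) / real (Suc n)"
      by (simp add: diff_divide_distrib del: of_nat_Suc)
  qed
  show "\<forall>\<^sub>F n in sequentially. real (nat \<lfloor>real (Suc n) * x\<rfloor>) / real (Suc n) \<le> x"
  proof (rule always_eventually, rule allI)
    fix n
    have "0 \<le> real (Suc n) * x" using assms by simp
    then have "real (nat \<lfloor>real (Suc n) * x\<rfloor>) \<le> real (Suc n) * x" by linarith
    then show "real (nat \<lfloor>real (Suc n) * x\<rfloor>) / real (Suc n) \<le> x"
      by (simp add: pos_divide_le_eq mult.commute del: of_nat_Suc)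
  qed
  have "(\<lambda>n. x - 1 / real (Suc n)) \<longlonglongrightarrow> x - 0"
    by (intro tendsto_intros LIMSEQ_Suc[OF lim_1_over_n])
  then show "(\<lambda>n. x - 1 / real (Suc n)) \<longlonglongrightarrow> x" by simp
qed simp

text \<open>There are \<open>N\<close> blocks of \<open>L\<close> leaves and at most
  \<open>L\<close> further vertices, so \<open>M / L\<close> lies between \<open>N\<close> and
  \<open>N + 1\<close>; the rest of the error comes from rounding down.\<close>

lemma nat_floor_div_bounds:
  assumes u: "0 < u" "u < 1" and L: "0 < L" and M: "N * L \<le> M" "M \<le> (N + 1) * L"
  shows "\<bar>real (nat \<lfloor>u * real M\<rfloor> div L) - u * real N\<bar> \<le> 2"
proof -
  define a where "a = nat \<lfloor>u * real M\<rfloor>"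
  define i where "i = a div L"
  have M': "real N * real L \<le> real M" "real M \<le> (real N + 1) * real L"
    using M by (metis of_nat_le_iff of_nat_mult, metis of_nat_1 of_nat_add of_nat_le_iff of_nat_mult)
  have "0 \<le> u * real M" using u by simp
  then have a: "real a \<le> u * real M" "u * real M < real a + 1"
    unfolding a_def by linarith+
  have "a = i * L + a mod L" "a mod L < L" "(i + 1) * L = i * L + L"
    using L by (simp_all add: i_def)
  then have "i * L \<le> a" "a < (i + 1) * L" by linarith+
  then have i: "real i * real L \<le> real a" "real a + 1 \<le> (real i + 1) * real L"
    by (metis of_nat_le_iff of_nat_mult, metis Suc_leI of_nat_1 of_nat_Suc of_nat_add of_nat_le_iff of_nat_mult add.commute)
  have "real i * real L \<le> (u * (real N + 1)) * real L"
    using i(1) a(1) mult_left_mono[OF M'(2) less_imp_le[OF u(1)]] unfolding mult.assoc by linarith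
  then have 1: "real i \<le> u * (real N + 1)" using L by simp
  have "(u * real N) * real L \<le> (real i + 1) * real L"
    using i(2) a(2) mult_left_mono[OF M'(1) less_imp_le[OF u(1)]] unfolding mult.assoc by linarith
  then have 2: "u * real N \<le> real i + 1" using L by simp
  from 1 2 u show ?thesis unfolding a_def[symmetric] i_def[symmetric] by (simp add: algebra_simps)
qed

text \<open>Height and Gromov product as seen from a root. For a point (x, a) of a long dendron the
  height is that of \<open>x\<close> plus \<open>a\<close>, while the product with itself is only
  the height of \<open>x\<close>; so \<open>g x x < h x\<close> is allowed, and then
  \<open>dist_of x x\<close> is positive.\<close>

locale gromov_product =
  fixes X :: "'x set" and h :: "'x \<Rightarrow> real" and g :: "'x \<Rightarrow> 'x \<Rightarrow> real"
  assumes g_nonneg: "x \<in> X \<Longrightarrow> y \<in> X \<Longrightarrow> 0 \<le> g x y"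
    and g_le: "x \<in> X \<Longrightarrow> y \<in> X \<Longrightarrow> g x y \<le> h x"
    and g_sym: "x \<in> X \<Longrightarrow> y \<in> X \<Longrightarrow> g x y = g y x"
    and g_ultra: "x \<in> X \<Longrightarrow> y \<in> X \<Longrightarrow> z \<in> X \<Longrightarrow> min (g x y) (g y z) \<le> g x z"
begin

definition dist_of :: "'x \<Rightarrow> 'x \<Rightarrow> real" where
  "dist_of x y = h x + h y - 2 * g x y"

lemma h_nonneg: "x \<in> X \<Longrightarrow> 0 \<le> h x"
  using g_nonneg[of x x] g_le[of x x] by simp

text \<open>The diagonal uses the height instead of \<open>g (q i) (q i)\<close>: two indices that
  name the same point count as two samples, which part at level \<open>g\<close> and not at their
  full height.\<close>

definition level :: "real \<Rightarrow> (nat \<Rightarrow> 'x) \<Rightarrow> nat \<Rightarrow> nat \<Rightarrow> nat" where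
  "level c q i j = nat \<lfloor>c * (if i = j then h (q i) else g (q i) (q j))\<rfloor>"

text \<open>Rounding down is monotone, so it preserves the ultrametric inequality.\<close>

lemma ultrametric_levels_level:
  assumes q: "\<And>i. q i \<in> X" and c: "0 \<le> c" and N: "0 < N"
  shows "ultrametric_levels {..<N} (level c q)"
proof
  have mono: "nat \<lfloor>c * a\<rfloor> \<le> nat \<lfloor>c * b\<rfloor>" if "a \<le> b" for a b :: real
    using that c by (intro nat_mono floor_mono mult_left_mono)
  show "finite {..<N}" "{..<N} \<noteq> {}" using N by (auto simp: lessThan_empty_iff)
  fix i j
  show "level c q i j = level c q j i"
    using g_sym[OF q q] by (simp add: level_def)
  have le: "level c q i j \<le> level c q i i" for i j
    using g_le[OF q q, of i j] unfolding level_def by (auto intro: mono)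
  then show "level c q i j \<le> level c q i i" .
  fix k
  show "min (level c q i j) (level c q j k) \<le> level c q i k"
  proof (cases "i = k \<or> i = j \<or> j = k")
    case True
    then show ?thesis using le[of i j] by auto
  next
    case False
    have "min (g (q i) (q j)) (g (q j) (q k)) \<le> g (q i) (q k)"
      by (rule g_ultra[OF q q q])
    then have "g (q i) (q j) \<le> g (q i) (q k) \<or> g (q j) (q k) \<le> g (q i) (q k)"
      by linarith
    then have "level c q i j \<le> level c q i k \<or> level c q j k \<le> level c q i k"
      using False unfolding level_def by (auto intro: mono)
    then show ?thesis by linarith
  qed
qed

text \<open>Tree number \<open>n\<close> carries the values of \<open>p \<circ> s\<close> at the
  grid points \<open>i / Suc n\<close> and has edges of length \<open>1 / Suc n\<close>. A uniform
  vertex is eventually a leaf over a grid point close to the uniform variable \<open>u\<close>, and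
  as \<open>s\<close> is locally constant the value there is \<open>p (s u)\<close>. The rounding
  errors in distances are of the order of an edge.\<close>

lemma step_law_in_tree_limits:
  fixes p :: "nat \<Rightarrow> 'x" and s :: "real \<Rightarrow> nat"
  assumes p: "\<And>i. p i \<in> X" and s: "s \<in> unif \<rightarrow>\<^sub>M count_space UNIV"
    and loc: "AE u in unif. \<forall>\<^sub>F v in nhds u. s v = s u"
  shows "tau_infinity (\<lambda>u v. dist_of (p (s u)) (p (s v))) unif \<in> topspace tree_limits"
proof -
  define q where "q n i = p (s (real i / real (Suc n)))" for n i
  have q: "q n i \<in> X" for n i by (simp add: q_def p)
  define G where "G n = level (real (Suc n)) (q n)" for n
  have "ultrametric_levels {..<Suc n} (G n)" for n
    unfolding G_def by (rule ultrametric_levels_level[OF q]) auto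
  note leaf = leaf_tree[OF this]
  obtain V :: "nat \<Rightarrow> (nat \<times> (nat \<times> nat) set) set" and E M L e where
    tree: "\<And>n. finite_tree (V n) (E n)" and L: "\<And>n. 0 < L n" and
    M: "\<And>n. Suc n * L n \<le> M n" "\<And>n. M n \<le> (Suc n + 1) * L n" and
    bij: "\<And>n. bij_betw (e n) {..<M n} (V n)" and
    dist: "\<And>n a b. a < Suc n * L n \<Longrightarrow> b < Suc n * L n \<Longrightarrow> a div L n \<noteq> b div L n \<Longrightarrow>
      real (graph_dist (V n) (E n) (e n a) (e n b)) =
        real (G n (a div L n) (a div L n)) + real (G n (b div L n) (b div L n)) + 2
        - 2 * real (G n (a div L n) (b div L n))"
    using leaf by metis
  define a where "a n u = nat \<lfloor>u * real (M n)\<rfloor>" for n u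
  define \<kappa> where "\<kappa> n u v = rescaled_dist (1 / real (Suc n)) (V n) (E n) (e n (a n u)) (e n (a n v))" for n u v
  have V: "finite (V n)" "V n \<noteq> {}" for n using tree[of n] by (auto simp: finite_tree_def)
  have M_pos: "0 < M n" for n
    using M(1)[of n] L[of n] by (metis less_le_trans mult_pos_pos zero_less_Suc)
  have ea: "(\<lambda>u. e n (a n u)) \<in> unif \<rightarrow>\<^sub>M uniform_count_measure (V n)"
    and law: "distr unif (uniform_count_measure (V n)) (\<lambda>u. e n (a n u)) = uniform_count_measure (V n)" for n
  proof -
    have e: "e n \<in> uniform_count_measure {..<M n} \<rightarrow>\<^sub>M uniform_count_measure (V n)"
      using bij[of n] by (intro measurableI) (auto simp: bij_betw_def)
    note floor = distr_unif_floor[OF M_pos[of n], folded a_def]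
    show "(\<lambda>u. e n (a n u)) \<in> unif \<rightarrow>\<^sub>M uniform_count_measure (V n)"
      by (rule measurable_compose[OF floor(1) e])
    have "distr unif (uniform_count_measure (V n)) (\<lambda>u. e n (a n u)) =
        distr (distr unif (uniform_count_measure {..<M n}) (a n)) (uniform_count_measure (V n)) (e n)"
      by (simp add: distr_distr[OF e floor(1)] comp_def)
    also have "\<dots> = uniform_count_measure (V n)"
      unfolding floor(2) by (rule distr_uniform_count_measure[OF _ bij]) simp
    finally show "distr unif (uniform_count_measure (V n)) (\<lambda>u. e n (a n u)) = uniform_count_measure (V n)" .
  qed
  have law_\<kappa>: "tau_infinity (\<kappa> n) unif \<in> topspace tree_limits" for n
  proof -
    have "tau_infinity (\<kappa> n) unif =
        tau_infinity (rescaled_dist (1 / real (Suc n)) (V n) (E n)) (uniform_count_measure (V n))"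
      unfolding \<kappa>_def by (rule tau_infinity_finite_comp[OF prob_space_unif ea law V])
    then show ?thesis
      using finite_tree_law_in_tree_limits[OF tree[of n]] by simp
  qed
  have lim: "limitin weak_topology (\<lambda>n. tau_infinity (\<kappa> n) unif)
      (tau_infinity (\<lambda>u v. dist_of (p (s u)) (p (s v))) unif) sequentially"
  proof (rule limitin_tau_infinity)
    show "sample_kernel unif (\<kappa> n)" for n
      unfolding \<kappa>_def
      by (rule sample_kernel_comp[OF prob_space_unif ea]) (simp add: law sample_kernel_finite V)
    have "prob_space (distr unif (count_space UNIV) s)"
      by (rule prob_space.prob_space_distr[OF prob_space_unif s])
    then have "sample_kernel (distr unif (count_space UNIV) s) (\<lambda>i j. dist_of (p i) (p j))"
      by (rule sample_kernel_countable) simp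
    then show "sample_kernel unif (\<lambda>u v. dist_of (p (s u)) (p (s v)))"
      by (rule sample_kernel_comp[OF prob_space_unif s])
    have "AE u in unif. 0 < u \<and> u < 1 \<and> (\<forall>\<^sub>F v in nhds u. s v = s u)"
      using loc AE_space[of unif] by eventually_elim (simp add: space_unif)
    from AE_pair_marginals[OF prob_space_unif this] AE_unif_distinct
    show "AE w in unif \<Otimes>\<^sub>M unif. (\<lambda>n. \<kappa> n (fst w) (snd w)) \<longlonglongrightarrow>
        dist_of (p (s (fst w))) (p (s (snd w)))"
    proof eventually_elim
      case (elim w)
      obtain u v where w: "w = (u, v)" by (cases w)
      have uv: "0 < u" "u < 1" "0 < v" "v < 1" "u \<noteq> v"
        and loc_u: "\<forall>\<^sub>F t in nhds u. s t = s u" and loc_v: "\<forall>\<^sub>F t in nhds v. s t = s v"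
        using elim by (simp_all add: w)
      \<comment> \<open>The grid point of the block selected by \<open>t\<close>.\<close>
      define x where "x n t = real (a n t div L n) / real (Suc n)" for n t
      have x_lim: "(\<lambda>n. x n t) \<longlonglongrightarrow> t" if t: "0 < t" "t < 1" for t
      proof (rule LIM_zero_cancel, rule Lim_null_comparison)
        show "\<forall>\<^sub>F n in sequentially. norm (x n t - t) \<le> 2 * (1 / real (Suc n))"
        proof (rule always_eventually, rule allI)
          fix n
          have "\<bar>real (a n t div L n) - t * real (Suc n)\<bar> / real (Suc n) \<le> 2 / real (Suc n)"
            using nat_floor_div_bounds[OF t L M] unfolding a_def by (intro divide_right_mono) auto
          moreover have "x n t - t = (real (a n t div L n) - t * real (Suc n)) / real (Suc n)"
            by (simp add: x_def diff_divide_distrib del: of_nat_Suc)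
          ultimately show "norm (x n t - t) \<le> 2 * (1 / real (Suc n))"
            by (simp del: of_nat_Suc)
        qed
        have "(\<lambda>n. 2 * (1 / real (Suc n))) \<longlonglongrightarrow> 2 * 0"
          by (intro tendsto_intros LIMSEQ_Suc[OF lim_1_over_n])
        then show "(\<lambda>n. 2 * (1 / real (Suc n))) \<longlonglongrightarrow> 0" by simp
      qed
      \<comment> \<open>Inner vertices come last in the numbering and at most fill the part of (0,
        1) beyond \<open>N / (N + 1)\<close>, with \<open>N = Suc n\<close>. Every fixed
        \<open>t\<close> is eventually outside of it.\<close>
      have leaf: "\<forall>\<^sub>F n in sequentially. a n t < Suc n * L n" if t: "0 < t" "t < 1" for t
      proof -
        obtain n0 :: nat where n0: "t / (1 - t) < real n0" using reals_Archimedean2 by blast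
        have "a n t < Suc n * L n" if n: "n \<ge> n0" for n
        proof -
          have "t / (1 - t) < real (Suc n)" using n n0 by simp
          then have "t * (real (Suc n) + 1) < real (Suc n)"
            using t by (simp add: field_simps)
          then have "(t * (real (Suc n) + 1)) * real (L n) < real (Suc n) * real (L n)"
            using L[of n] by (intro mult_strict_right_mono) auto
          moreover have "t * real (M n) \<le> t * ((real (Suc n) + 1) * real (L n))"
            using M(2)[of n] t
            by (intro mult_left_mono) (metis of_nat_1 of_nat_add of_nat_le_iff of_nat_mult, simp)
          ultimately have "t * real (M n) < real (Suc n * L n)"
            unfolding mult.assoc of_nat_mult by linarith
          then show ?thesis
            unfolding a_def using t by (simp add: nat_less_iff floor_less_iff del: mult_Suc)
        qed
        then show ?thesis by (auto simp: eventually_sequentially)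
      qed
      have s_u: "\<forall>\<^sub>F n in sequentially. s (x n u) = s u"
        using eventually_compose_filterlim[OF loc_u x_lim[OF uv(1,2)]] .
      have s_v: "\<forall>\<^sub>F n in sequentially. s (x n v) = s v"
        using eventually_compose_filterlim[OF loc_v x_lim[OF uv(3,4)]] .
      have "(\<lambda>n. x n u - x n v) \<longlonglongrightarrow> u - v"
        by (intro tendsto_diff x_lim uv)
      then have "\<forall>\<^sub>F n in sequentially. x n u - x n v \<noteq> 0"
        using uv(5) by (intro tendsto_imp_eventually_ne) auto
      \<comment> \<open>This holds even if \<open>s u = s v\<close>. The limit is then
        \<open>dist_of\<close> of a point and itself, as it should be for two samples from an
        atom.\<close>
      then have distinct: "\<forall>\<^sub>F n in sequentially. a n u div L n \<noteq> a n v div L n"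
        by eventually_elim (auto simp: x_def)
      let ?F = "\<lambda>y n. real (nat \<lfloor>real (Suc n) * y\<rfloor>) / real (Suc n)"
      \<comment> \<open>The summand \<open>2 * (1 / real (Suc n))\<close> is the length of the two
        edges that end in leaves.\<close>
      have "\<forall>\<^sub>F n in sequentially. ?F (h (p (s u))) n + ?F (h (p (s v))) n + 2 * (1 / real (Suc n))
          - 2 * ?F (g (p (s u)) (p (s v))) n = \<kappa> n u v"
        using s_u s_v distinct leaf[OF uv(1,2)] leaf[OF uv(3,4)]
      proof eventually_elim
        case (elim n)
        have q_uv: "q n (a n u div L n) = p (s u)" "q n (a n v div L n) = p (s v)"
          using elim(1,2) by (simp_all add: q_def x_def)
        have "\<kappa> n u v = 1 / real (Suc n) * (real (nat \<lfloor>real (Suc n) * h (p (s u))\<rfloor>)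
            + real (nat \<lfloor>real (Suc n) * h (p (s v))\<rfloor>) + 2
            - 2 * real (nat \<lfloor>real (Suc n) * g (p (s u)) (p (s v))\<rfloor>))"
          unfolding \<kappa>_def rescaled_dist_def dist[OF elim(4,5,3)] G_def level_def
          using elim(3) by (simp add: q_uv del: of_nat_Suc)
        then show ?case
          by (simp add: add_divide_distrib diff_divide_distrib del: of_nat_Suc)
      qed
      moreover have "(\<lambda>n. ?F (h (p (s u))) n + ?F (h (p (s v))) n + 2 * (1 / real (Suc n))
          - 2 * ?F (g (p (s u)) (p (s v))) n) \<longlonglongrightarrow>
          h (p (s u)) + h (p (s v)) + 2 * 0 - 2 * g (p (s u)) (p (s v))"
        by (intro tendsto_intros floor_scaled_tendsto LIMSEQ_Suc[OF lim_1_over_n] h_nonneg g_nonneg p)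
      ultimately have "(\<lambda>n. \<kappa> n u v) \<longlonglongrightarrow>
          h (p (s u)) + h (p (s v)) + 2 * 0 - 2 * g (p (s u)) (p (s v))"
        by (rule Lim_transform_eventually[rotated])
      then show ?case by (simp add: w dist_of_def)
    qed
  qed
  show ?thesis
    by (rule tree_limits_sequentially_closed[OF lim law_\<kappa>])
qed

end

text \<open>The rounded quantile function does it. Being monotone, the quantile function has only
  countably many discontinuities, and almost surely its value is a natural number; near a continuity
  point with such a value its rounding is constant.\<close>

lemma nat_law_representation:
  fixes \<mu> :: "nat measure"
  assumes \<mu>: "prob_space \<mu>" "sets \<mu> = UNIV"
  obtains s where "s \<in> unif \<rightarrow>\<^sub>M count_space UNIV" "distr unif (count_space UNIV) s = \<mu>"
    "AE u in unif. \<forall>\<^sub>F v in nhds u. s v = s u"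
proof -
  have real_meas: "real \<in> borel_measurable \<mu>"
    by (rule measurableI) (simp_all add: \<mu>(2))
  define R where "R = distr \<mu> borel real"
  have "real_distribution R"
    unfolding R_def by (rule prob_space.real_distribution_distr[OF \<mu>(1) real_meas])
  then interpret R: cdf_distribution R by (simp add: cdf_distribution_def)
  define Q where "Q = R.I"
  have Q_distr: "distr unif borel Q = R"
    unfolding Q_def by (rule R.distr_I_eq_M)
  have Q: "Q \<in> borel_measurable unif"
    using R.measurable_CI unfolding Q_def
    by (simp cong: measurable_cong_sets add: sets_restrict_space)
  \<comment> \<open>The law is unaffected, since \<open>rnd\<close> is the identity on natural
    numbers, and being within 1/2 of \<open>k\<close> becomes equality with
    \<open>k\<close>.\<close>
  define rnd where "rnd x = nat (round x)" for x :: real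
  have rnd: "rnd \<in> borel \<rightarrow>\<^sub>M count_space UNIV"
  proof -
    have "(\<lambda>x :: real. x + 1/2) \<in> borel_measurable borel" by simp
    from measurable_compose[OF measurable_compose[OF this measurable_real_floor], of nat "count_space UNIV"]
    show ?thesis by (simp add: rnd_def[abs_def] round_def)
  qed
  define s where "s u = rnd (Q u)" for u
  have s: "s \<in> unif \<rightarrow>\<^sub>M count_space UNIV"
    unfolding s_def by (rule measurable_compose[OF Q rnd])
  have "distr unif (count_space UNIV) s = distr R (count_space UNIV) rnd"
    unfolding Q_distr[symmetric] by (simp add: distr_distr[OF rnd Q] comp_def s_def[abs_def])
  also have "\<dots> = distr \<mu> (count_space UNIV) (\<lambda>i. i)"
    unfolding R_def by (simp add: distr_distr[OF rnd real_meas] comp_def rnd_def)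
  also have "\<dots> = \<mu>"
    by (rule distr_id2) (simp add: \<mu>(2))
  finally have law: "distr unif (count_space UNIV) s = \<mu>" .
  have "AE x in distr unif borel Q. x \<in> range real"
  proof -
    have "range real \<in> sets borel"
      by (rule sets.countable) auto
    then show ?thesis
      unfolding Q_distr R_def by (subst AE_distr_iff[OF real_meas]) auto
  qed
  from AE_distrD[OF Q this] have 1: "AE u in unif. Q u \<in> range real" .
  have "countable {u \<in> {0<..<1}. \<not> isCont Q u}"
    unfolding Q_def using mono_on_ctble_discont[OF R.mono_I]
    by (simp add: at_within_open[of _ "{0 <..< 1}"] cong: conj_cong)
  from AE_not_in[OF countable_imp_null_set_lborel[OF this]]
  have "AE u in lborel. u \<in> {0<..<1} \<longrightarrow> isCont Q u"
    by (rule eventually_mono) simp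
  then have 2: "AE u in unif. isCont Q u"
    by (subst AE_restrict_space_iff) simp_all
  from 1 2 have "AE u in unif. \<forall>\<^sub>F v in nhds u. s v = s u"
  proof eventually_elim
    case (elim u)
    then obtain k where k: "Q u = real k" by blast
    have "(Q \<longlongrightarrow> Q u) (nhds u)"
      using elim(2) by (simp add: isCont_def tendsto_nhds_iff)
    then have "\<forall>\<^sub>F v in nhds u. dist (Q v) (Q u) < 1/2"
      by (rule tendstoD) simp
    then show ?case
    proof eventually_elim
      case (elim v)
      have "\<bar>Q v - real k\<bar> < 1/2"
        using elim unfolding k dist_real_def .
      then have "Q v - 1/2 < real_of_int (int k)" "real_of_int (int k) \<le> Q v + 1/2"
        unfolding of_int_of_nat_eq by linarith+
      then have "round (Q v) = int k"
        by (rule round_unique)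
      then show ?case by (simp add: s_def rnd_def k)
    qed
  qed
  with s law that show ?thesis by blast
qed

lemma (in gromov_product) discrete_law_in_tree_limits:
  fixes \<mu> :: "nat measure"
  assumes \<mu>: "prob_space \<mu>" "sets \<mu> = UNIV" and p: "\<And>i. p i \<in> X"
  shows "tau_infinity (\<lambda>i j. dist_of (p i) (p j)) \<mu> \<in> topspace tree_limits"
proof -
  obtain s where s: "s \<in> unif \<rightarrow>\<^sub>M count_space UNIV" and law: "distr unif (count_space UNIV) s = \<mu>"
    and loc: "AE u in unif. \<forall>\<^sub>F v in nhds u. s v = s u"
    using nat_law_representation[OF \<mu>] .
  have "tau_infinity (\<lambda>u v. dist_of (p (s u)) (p (s v))) unif = tau_infinity (\<lambda>i j. dist_of (p i) (p j)) \<mu>"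
    using tau_infinity_comp[OF prob_space_unif s, of "\<lambda>i j. dist_of (p i) (p j)"]
      sample_kernel_countable[OF \<mu>, of "\<lambda>i j. dist_of (p i) (p j)"] by (simp add: law)
  then show ?thesis
    using step_law_in_tree_limits[of p s, OF p s loc] by simp
qed

text \<open>\<open>r\<close> is an auxiliary distance in which the points \<open>p i\<close> are
  dense. \<open>dist_of\<close> cannot take this part, as in a long dendron it does not become small
  when two points approach each other; the Lipschitz bound ties it to \<open>r\<close>.\<close>

locale separable_gromov_kernel = gromov_product "space m" h g + prob_space m
  for m :: "'x measure" and h and g +
  fixes r :: "'x \<Rightarrow> 'x \<Rightarrow> real" and p :: "nat \<Rightarrow> 'x"
  assumes p_in: "p i \<in> space m"
    and r_meas: "(\<lambda>x. r x (p i)) \<in> borel_measurable m"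
    and p_dense: "x \<in> space m \<Longrightarrow> 0 < e \<Longrightarrow> \<exists>i. r x (p i) < e"
    and r_nonneg: "x \<in> space m \<Longrightarrow> y \<in> space m \<Longrightarrow> 0 \<le> r x y"
    and dist_of_le: "x \<in> space m \<Longrightarrow> y \<in> space m \<Longrightarrow> x' \<in> space m \<Longrightarrow> y' \<in> space m \<Longrightarrow>
      \<bar>dist_of x y - dist_of x' y'\<bar> \<le> r x x' + r y y'"
begin

text \<open>Ties go to the least index, which makes the choice a measurable function of the
  point.\<close>

definition nearest :: "nat \<Rightarrow> 'x \<Rightarrow> nat" where
  "nearest n x = (LEAST i. i \<le> n \<and> (\<forall>j\<in>{..n}. r x (p i) \<le> r x (p j)))"

lemma nearest_le:
  assumes "j \<le> n"
  shows "r x (p (nearest n x)) \<le> r x (p j)"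
proof -
  have "Min ((\<lambda>i. r x (p i)) ` {..n}) \<in> (\<lambda>i. r x (p i)) ` {..n}"
    by (intro Min_in) auto
  then obtain i where i: "Min ((\<lambda>i. r x (p i)) ` {..n}) = r x (p i)" "i \<in> {..n}"
    by (rule imageE)
  have "Min ((\<lambda>i. r x (p i)) ` {..n}) \<le> r x (p j)" if "j \<le> n" for j
    using that by (intro Min_le) auto
  then have "\<exists>i. i \<le> n \<and> (\<forall>j\<in>{..n}. r x (p i) \<le> r x (p j))"
    using i by (intro exI[of _ i]) simp
  from LeastI_ex[OF this] show ?thesis
    using assms unfolding nearest_def by auto
qed

lemma measurable_nearest: "nearest n \<in> m \<rightarrow>\<^sub>M count_space UNIV"
  unfolding nearest_def
proof (rule measurable_Least)
  fix i
  have "Measurable.pred m (\<lambda>x. r x (p i) \<le> r x (p j))" for j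
    using borel_measurable_le[OF r_meas r_meas, of i j] by (simp add: pred_def)
  then show "(\<lambda>x. i \<le> n \<and> (\<forall>j\<in>{..n}. r x (p i) \<le> r x (p j))) \<in> m \<rightarrow>\<^sub>M count_space UNIV"
    by (intro pred_intros_logic pred_intros_finite) auto
qed

lemma nearest_tendsto:
  assumes x: "x \<in> space m"
  shows "(\<lambda>n. r x (p (nearest n x))) \<longlonglongrightarrow> 0"
proof (rule LIMSEQ_I)
  fix e :: real assume "0 < e"
  then obtain i where i: "r x (p i) < e" using p_dense[OF x] by blast
  have "norm (r x (p (nearest n x)) - 0) < e" if "i \<le> n" for n
    using nearest_le[OF that, of x] i r_nonneg[OF x p_in, of "nearest n x"] by simp
  then show "\<exists>no. \<forall>n\<ge>no. norm (r x (p (nearest n x)) - 0) < e" by blast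
qed

abbreviation quantised :: "nat \<Rightarrow> 'x \<Rightarrow> 'x \<Rightarrow> real" where
  "quantised n x y \<equiv> dist_of (p (nearest n x)) (p (nearest n y))"

lemma quantised_tendsto:
  assumes x: "x \<in> space m" and y: "y \<in> space m"
  shows "(\<lambda>n. quantised n x y) \<longlonglongrightarrow> dist_of x y"
proof (rule LIM_zero_cancel, rule Lim_null_comparison)
  show "\<forall>\<^sub>F n in sequentially. norm (quantised n x y - dist_of x y) \<le>
      r x (p (nearest n x)) + r y (p (nearest n y))"
    using dist_of_le[OF x y p_in p_in] by (intro always_eventually allI) (simp add: abs_minus_commute)
  show "(\<lambda>n. r x (p (nearest n x)) + r y (p (nearest n y))) \<longlonglongrightarrow> 0"
    using tendsto_add[OF nearest_tendsto[OF x] nearest_tendsto[OF y]] by simp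
qed

lemma nearest_law: "prob_space (distr m (count_space UNIV) (nearest n))"
  by (rule prob_space_distr[OF measurable_nearest])

lemma sample_kernel_quantised: "sample_kernel m (quantised n)"
  by (rule sample_kernel_comp[OF prob_space_axioms measurable_nearest
        sample_kernel_countable[OF nearest_law, of n "\<lambda>i j. dist_of (p i) (p j)"]]) simp

text \<open>Measurability is asked for the product of the \<sigma>-algebras, not for a topology on
  pairs. It is inherited as a pointwise limit from the quantised kernels, which factor through
  \<open>nat\<close>.\<close>

lemma sample_kernel_dist_of: "sample_kernel m dist_of"
  unfolding sample_kernel_def sample_kernel_axioms_def
proof
  show "(\<lambda>(x, y). dist_of x y) \<in> borel_measurable (m \<Otimes>\<^sub>M m)"
  proof (rule borel_measurable_LIMSEQ_real)
    show "(\<lambda>(x, y). quantised n x y) \<in> borel_measurable (m \<Otimes>\<^sub>M m)" for n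
      using sample_kernel_quantised[of n] by (simp add: sample_kernel_def sample_kernel_axioms_def)
    show "(\<lambda>n. (case w of (x, y) \<Rightarrow> quantised n x y)) \<longlonglongrightarrow> (case w of (x, y) \<Rightarrow> dist_of x y)"
      if "w \<in> space (m \<Otimes>\<^sub>M m)" for w
      using that quantised_tendsto by (auto simp: space_pair_measure)
  qed
qed (rule prob_space_axioms)

lemma law_in_tree_limits: "tau_infinity dist_of m \<in> topspace tree_limits"
proof (rule tree_limits_sequentially_closed)
  show "limitin weak_topology (\<lambda>n. tau_infinity (quantised n) m) (tau_infinity dist_of m) sequentially"
    using quantised_tendsto
    by (intro limitin_tau_infinity sample_kernel_quantised sample_kernel_dist_of AE_I2)
      (auto simp: space_pair_measure)
  show "tau_infinity (quantised n) m \<in> topspace tree_limits" for n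
  proof -
    have "tau_infinity (quantised n) m =
        tau_infinity (\<lambda>i j. dist_of (p i) (p j)) (distr m (count_space UNIV) (nearest n))"
      by (rule tau_infinity_comp[OF prob_space_axioms measurable_nearest
            sample_kernel_countable[OF nearest_law, of n "\<lambda>i j. dist_of (p i) (p j)"]]) simp
    also have "\<dots> \<in> topspace tree_limits"
      by (rule discrete_law_in_tree_limits[of _ p, OF nearest_law _ p_in]) simp
    finally show ?thesis .
  qed
qed

end

section \<open>Geometry of real trees\<close>

locale rooted_real_tree = Metric_space T d for T :: "'a set" and d +
  fixes \<rho> :: 'a
  assumes tree: "real_tree T d" and root: "\<rho> \<in> T"
begin

definition between :: "'a \<Rightarrow> 'a \<Rightarrow> 'a \<Rightarrow> bool" where
  "between x p y \<longleftrightarrow> d x p + d p y = d x y"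

abbreviation joined :: "'a \<Rightarrow> 'a \<Rightarrow> 'a \<Rightarrow> bool" where
  "joined p \<equiv> connected_component_of (subtopology mtopology (T - {p}))"

lemma joined_sym: "joined p x y \<Longrightarrow> joined p y x"
  by (simp add: connected_component_of_sym)

lemma joined_trans: "joined p x y \<Longrightarrow> joined p y z \<Longrightarrow> joined p x z"
  by (rule connected_component_of_trans)

lemma geodesicE:
  assumes "x \<in> T" "y \<in> T"
  obtains \<gamma> where "geodesic T d x y \<gamma>"
proof (cases "x = y")
  case True
  have "geodesic T d x y (\<lambda>s\<in>{0..d x y}. x)"
    using assms True by (auto simp: geodesic_def PiE_iff extensional_def)
  then show ?thesis by (rule that)
next
  case False
  then have "\<exists>!\<gamma>. geodesic T d x y \<gamma>"
    using tree assms unfolding real_tree_def by blast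
  then show ?thesis using that by blast
qed

lemma geodesic_separates:
  assumes "x \<in> T" "y \<in> T" "geodesic T d x y \<gamma>" "0 < s" "s < d x y"
  shows "\<not> joined (\<gamma> s) x y"
proof -
  have "x \<noteq> y" using assms by auto
  then have "\<forall>\<gamma>. geodesic T d x y \<gamma> \<longrightarrow> (\<forall>s\<in>{0<..<d x y}. \<not> joined (\<gamma> s) x y)"
    using tree assms(1,2) unfolding real_tree_def by simp
  then show ?thesis using assms by auto
qed

lemma geodesic_in: "geodesic T d x y \<gamma> \<Longrightarrow> 0 \<le> s \<Longrightarrow> s \<le> d x y \<Longrightarrow> \<gamma> s \<in> T"
  by (auto simp: geodesic_def PiE_iff)

lemma geodesic_dist:
  assumes "geodesic T d x y \<gamma>" "0 \<le> s" "s \<le> d x y"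
  shows "d x (\<gamma> s) = s" "d (\<gamma> s) y = d x y - s"
proof -
  have "\<forall>s\<in>{0..d x y}. \<forall>t\<in>{0..d x y}. d (\<gamma> s) (\<gamma> t) = \<bar>s - t\<bar>" "\<gamma> 0 = x" "\<gamma> (d x y) = y"
    using assms(1) by (simp_all add: geodesic_def)
  moreover have "s \<in> {0..d x y}" "0 \<in> {0..d x y}" "d x y \<in> {0..d x y}"
    using assms(2,3) by auto
  ultimately have "d (\<gamma> 0) (\<gamma> s) = \<bar>0 - s\<bar>" "d (\<gamma> s) (\<gamma> (d x y)) = \<bar>s - d x y\<bar>"
    by blast+
  with \<open>\<gamma> 0 = x\<close> \<open>\<gamma> (d x y) = y\<close> assms(2,3)
  show "d x (\<gamma> s) = s" "d (\<gamma> s) y = d x y - s" by simp_all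
qed

lemma ex_between:
  assumes "x \<in> T" "y \<in> T" "0 \<le> s" "s \<le> d x y"
  obtains p where "p \<in> T" "between x p y" "d x p = s"
proof -
  obtain \<gamma> where \<gamma>: "geodesic T d x y \<gamma>" using geodesicE[OF assms(1,2)] .
  show ?thesis
    using that[of "\<gamma> s"] geodesic_in[OF \<gamma> assms(3,4)] geodesic_dist[OF \<gamma> assms(3,4)]
    by (simp add: between_def)
qed

text \<open>The geodesic from \<open>x\<close> to \<open>y\<close> consists of points between them,
  so it is a connected set that avoids \<open>p\<close>.\<close>

lemma joined_if_not_between:
  assumes x: "x \<in> T" and y: "y \<in> T" and "\<not> between x p y"
  shows "joined p x y"
proof -
  obtain \<gamma> where \<gamma>: "geodesic T d x y \<gamma>" using geodesicE[OF x y] .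
  let ?I = "{0..d x y}"
  have "continuous_map (top_of_set ?I) mtopology \<gamma>"
    unfolding continuous_map_to_metric
  proof (intro ballI allI impI)
    fix s \<epsilon> :: real assume s: "s \<in> topspace (top_of_set ?I)" and \<epsilon>: "0 < \<epsilon>"
    have "\<gamma> t \<in> mball (\<gamma> s) \<epsilon>" if "t \<in> ?I \<inter> ball s \<epsilon>" for t
    proof -
      have "d (\<gamma> s) (\<gamma> t) = \<bar>s - t\<bar>"
        using \<gamma> s that by (simp add: geodesic_def)
      then show ?thesis
        using that s geodesic_in[OF \<gamma>] by (auto simp: dist_real_def)
    qed
    moreover have "openin (top_of_set ?I) (?I \<inter> ball s \<epsilon>)" "s \<in> ?I \<inter> ball s \<epsilon>"
      using s \<epsilon> by (auto simp: openin_open_Int)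
    ultimately show "\<exists>U. openin (top_of_set ?I) U \<and> s \<in> U \<and> (\<forall>t\<in>U. \<gamma> t \<in> mball (\<gamma> s) \<epsilon>)"
      by blast
  qed
  moreover have "connectedin (top_of_set ?I) ?I"
    by (simp add: connectedin_subtopology connectedin_iff_connected)
  ultimately have "connectedin mtopology (\<gamma> ` ?I)"
    by (rule connectedin_continuous_map_image)
  moreover have "\<gamma> ` ?I \<subseteq> T - {p}"
  proof
    fix q assume "q \<in> \<gamma> ` ?I"
    then obtain s where s: "0 \<le> s" "s \<le> d x y" "q = \<gamma> s" by auto
    then have "between x q y"
      using geodesic_dist[OF \<gamma>] by (simp add: between_def)
    then show "q \<in> T - {p}"
      using assms(3) s geodesic_in[OF \<gamma>] by auto
  qed
  ultimately have "connectedin (subtopology mtopology (T - {p})) (\<gamma> ` ?I)"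
    by (simp add: connectedin_subtopology)
  moreover have "x \<in> \<gamma> ` ?I"
    using \<gamma> by (intro image_eqI[of _ _ 0]) (auto simp: geodesic_def)
  moreover have "y \<in> \<gamma> ` ?I"
    using \<gamma> by (intro image_eqI[of _ _ "d x y"]) (auto simp: geodesic_def)
  ultimately show ?thesis
    unfolding connected_component_of_def by blast
qed

text \<open>The geodesic has a point \<open>z\<close> at the same distance from \<open>x\<close> as
  \<open>p\<close>. If \<open>p\<close> were different from \<open>z\<close>, the detour from
  \<open>x\<close> over \<open>p\<close> to \<open>y\<close> would avoid \<open>z\<close> and join
  \<open>x\<close> to \<open>y\<close> in its complement, against the separation axiom.\<close>

lemma between_unique:
  assumes xy: "x \<in> T" "y \<in> T" and p: "p \<in> T" "between x p y" and q: "q \<in> T" "between x q y"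
    and eq: "d x p = d x q"
  shows "p = q"
proof -
  obtain \<gamma> where \<gamma>: "geodesic T d x y \<gamma>" using geodesicE[OF xy] .
  have unique: "p = \<gamma> (d x p)" if p: "p \<in> T" "between x p y" for p
  proof (rule ccontr)
    define s where "s = d x p"
    define z where "z = \<gamma> s"
    assume "p \<noteq> \<gamma> (d x p)"
    then have ne: "p \<noteq> z" by (simp add: z_def s_def)
    have s: "0 \<le> s" "s \<le> d x y"
      using p(2) nonneg[of x p] nonneg[of p y] unfolding s_def between_def by linarith+
    have z: "z \<in> T" "d x z = s" "d z y = d x y - s"
      using geodesic_in[OF \<gamma> s] geodesic_dist[OF \<gamma> s] by (simp_all add: z_def)
    have d_pz: "0 < d p z" using p(1) z(1) ne mdist_pos_eq by blast
    \<comment> \<open>\<open>p\<close> and \<open>z\<close> agree in their distances to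
      \<open>x\<close> and to \<open>y\<close>, so either relation would force \<open>d p z\<close>
      to be 0.\<close>
    have "\<not> between x z p" "\<not> between p z y"
      using d_pz p(2) z commute[of z p] by (auto simp: between_def s_def)
    then have "joined z x p" "joined z p y"
      using xy p(1) by (auto intro: joined_if_not_between)
    then have joined: "joined z x y" by (rule joined_trans)
    \<comment> \<open>Joined points lie in the complement of \<open>z\<close>; hence
      \<open>z\<close> is an inner point of the geodesic, the case to which the axiom
      applies.\<close>
    have "x \<noteq> z" "y \<noteq> z"
      using connected_component_of_equiv[THEN iffD1, OF joined] by (auto simp: topspace_subtopology)
    then have "0 < s" "s < d x y"
      using xy z mdist_pos_eq[of x z] mdist_pos_eq[of z y] by auto
    then show False
      using geodesic_separates[OF xy \<gamma>] joined by (simp add: z_def)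
  qed
  show ?thesis using unique[OF p] unique[OF q] eq by simp
qed

text \<open>By uniqueness \<open>p\<close> is an inner point of the geodesic, where the separation
  axiom applies.\<close>

lemma not_joined_if_between:
  assumes xy: "x \<in> T" "y \<in> T" and p: "p \<in> T" "between x p y" and ne: "p \<noteq> x" "p \<noteq> y"
  shows "\<not> joined p x y"
proof -
  obtain \<gamma> where \<gamma>: "geodesic T d x y \<gamma>" using geodesicE[OF xy] .
  have "0 < d x p" "0 < d p y"
    using p(1) xy ne by auto
  then have s: "0 < d x p" "d x p < d x y"
    using p(2) unfolding between_def by linarith+
  have "\<gamma> (d x p) = p"
    using geodesic_in[OF \<gamma>] geodesic_dist[OF \<gamma>] s
    by (intro between_unique[OF xy _ _ p]) (auto simp: between_def)
  then show ?thesis using geodesic_separates[OF xy \<gamma> s] by simp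
qed

definition height :: "'a \<Rightarrow> real" where
  "height x = d \<rho> x"

definition meet :: "'a \<Rightarrow> 'a \<Rightarrow> real" where
  "meet x y = (height x + height y - d x y) / 2"

text \<open>Otherwise \<open>y\<close> is on the same side of \<open>p\<close> as the root and
  \<open>x\<close> is beyond \<open>p\<close>. The way from \<open>x\<close> to \<open>y\<close>
  then passes through \<open>p\<close>, which makes \<open>meet x y\<close> at most the height of
  \<open>p\<close>.\<close>

lemma below_meet:
  assumes xy: "x \<in> T" "y \<in> T" and p: "p \<in> T" "between \<rho> p x" and h: "0 < height p" "height p < meet x y"
  shows "between \<rho> p y"
proof (rule ccontr)
  assume "\<not> between \<rho> p y"
  then have 1: "joined p \<rho> y" by (rule joined_if_not_between[OF root xy(2)])
  have "height y \<le> height x + d x y"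
    using triangle[OF root xy] by (simp add: height_def)
  then have "height p < height x" using h(2) by (simp add: meet_def)
  then have "p \<noteq> x" by auto
  moreover have "p \<noteq> \<rho>" using h(1) root by (auto simp: height_def)
  ultimately have 2: "\<not> joined p \<rho> x"
    by (intro not_joined_if_between root xy p)
  have "between x p y"
  proof (rule ccontr)
    assume "\<not> between x p y"
    then have "joined p x y" by (rule joined_if_not_between[OF xy])
    then show False using joined_trans[OF 1 joined_sym] 2 by blast
  qed
  then have "d x p + d p y = d x y" by (simp add: between_def)
  moreover have "height p + d p x = height x"
    using p(2) by (simp add: between_def height_def)
  moreover have "height y \<le> height p + d p y"
    using triangle[OF root p(1) xy(2)] by (simp add: height_def)
  ultimately show False
    using h(2) commute[of x p] by (simp add: meet_def)
qed

lemma meet_bounds: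
  assumes "x \<in> T" "y \<in> T"
  shows "0 \<le> meet x y" "meet x y \<le> height x"
  using triangle[OF assms(1) root assms(2)] triangle[OF root assms] commute[of x \<rho>]
  by (simp_all add: meet_def height_def)

lemma meet_sym: "meet x y = meet y x"
  by (simp add: meet_def commute)

text \<open>The point at height \<open>s\<close> on the path from the root to \<open>y\<close> lies
  also on the paths to \<open>x\<close> and to \<open>z\<close>, so these agree up to
  \<open>s\<close> at least. The level \<open>s\<close> stays strictly below both products because
  \<open>below_meet\<close> demands it.\<close>

lemma meet_ultra:
  assumes xyz: "x \<in> T" "y \<in> T" "z \<in> T"
  shows "min (meet x y) (meet y z) \<le> meet x z"
proof (rule ccontr)
  assume "\<not> ?thesis"
  then obtain s where "meet x z < s" "s < min (meet x y) (meet y z)"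
    using dense[of "meet x z" "min (meet x y) (meet y z)"] by (meson not_le)
  then have s: "meet x z < s" "s < meet x y" "s < meet y z" by simp_all
  have s0: "0 < s" using s(1) meet_bounds(1)[OF xyz(1,3)] by simp
  have "s \<le> d \<rho> y"
    using s(3) meet_bounds(2)[OF xyz(2,3)] by (simp add: height_def)
  with s0 obtain p where p: "p \<in> T" "between \<rho> p y" "d \<rho> p = s"
    using ex_between[OF root xyz(2)] by (metis less_imp_le)
  have "between \<rho> p x" "between \<rho> p z"
    using below_meet[OF xyz(2,1) p(1,2)] below_meet[OF xyz(2,3) p(1,2)] s s0 p(3)
    by (simp_all add: height_def meet_sym)
  moreover have "d x z \<le> d x p + d p z" by (rule triangle[OF xyz(1) p(1) xyz(3)])
  ultimately have "s \<le> meet x z"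
    using p(3) commute[of x p] by (simp add: between_def meet_def height_def)
  then show False using s(1) by simp
qed

end

section \<open>Measured real trees and long dendrons\<close>

lemma space_borel_of: "space (borel_of X) = topspace X"
  by (simp add: borel_of_def space_measure_of_conv)

lemma sets_borel_of_openin: "openin X U \<Longrightarrow> U \<in> sets (borel_of X)"
  unfolding borel_of_def by (subst sets_measure_of) (auto dest: openin_subset intro: sigma_sets.Basic)

lemma continuous_map_imp_measurable:
  assumes "continuous_map X euclideanreal f" "sets m = sets (borel_of X)"
  shows "f \<in> borel_measurable m"
proof (rule borel_measurableI)
  fix S :: "real set" assume "open S"
  then have "openin X {x \<in> topspace X. f x \<in> S}"
    using assms(1) by (intro openin_continuous_map_preimage) auto
  moreover have "f -` S \<inter> space m = {x \<in> topspace X. f x \<in> S}"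
    using sets_eq_imp_space_eq[OF assms(2)] by (auto simp: space_borel_of)
  ultimately show "f -` S \<inter> space m \<in> sets m"
    using sets_borel_of_openin assms(2) by simp
qed

context rooted_real_tree
begin

lemma gromov_product_meet: "gromov_product T height meet"
  using meet_bounds meet_sym meet_ultra by unfold_locales auto

lemma dist_of_meet: "gromov_product.dist_of height meet x y = d x y"
  unfolding gromov_product.dist_of_def[OF gromov_product_meet] by (simp add: meet_def field_simps)

lemma continuous_map_dist:
  assumes y: "y \<in> T"
  shows "continuous_map mtopology euclideanreal (\<lambda>x. d x y)"
  unfolding continuous_map_def
proof (intro conjI allI impI)
  fix U :: "real set" assume "openin euclideanreal U"
  then have U: "open U" by simp
  show "openin mtopology {x \<in> topspace mtopology. d x y \<in> U}"
    unfolding openin_mtopology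
  proof (intro conjI allI impI)
    fix x assume "x \<in> {x \<in> topspace mtopology. d x y \<in> U}"
    then have x: "x \<in> T" "d x y \<in> U" by simp_all
    then obtain e where e: "0 < e" "ball (d x y) e \<subseteq> U"
      using U open_contains_ball by blast
    have "d x' y \<in> U" if x': "x' \<in> T" "d x x' < e" for x'
    proof -
      have "\<bar>d x y - d x' y\<bar> < e"
        using triangle[OF x(1) x'(1) y] triangle[OF x'(1) x(1) y] commute[of x' x] x'(2) by linarith
      then show ?thesis using e(2) by (auto simp: dist_real_def)
    qed
    then show "\<exists>r>0. mball x r \<subseteq> {x \<in> topspace mtopology. d x y \<in> U}"
      using e(1) by (intro exI[of _ e]) auto
  qed auto
qed simp

lemma dense_sequence:
  assumes "separable_space mtopology"
  obtains p :: "nat \<Rightarrow> 'a" where "\<And>i. p i \<in> T" "\<And>x e. x \<in> T \<Longrightarrow> 0 < e \<Longrightarrow> \<exists>i. d x (p i) < e"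
proof -
  obtain C where C: "countable C" "C \<subseteq> T" "mtopology closure_of C = T"
    using assms unfolding separable_space_def by auto
  have "C \<noteq> {}" using C(3) root by auto
  then have range: "range (from_nat_into C) = C" using C(1) by (rule range_from_nat_into)
  show ?thesis
  proof (rule that[of "from_nat_into C"])
    show "from_nat_into C i \<in> T" for i using range C(2) by blast
    fix x and e :: real assume "x \<in> T" "0 < e"
    then have "x \<in> mtopology closure_of C" using C(3) by simp
    then obtain y where "y \<in> C" "y \<in> mball x e"
      using \<open>0 < e\<close> unfolding metric_closure_of by auto
    moreover then obtain i where "y = from_nat_into C i" using range by (metis rangeE)
    ultimately show "\<exists>i. d x (from_nat_into C i) < e" by auto
  qed
qed

lemma dist_lipschitz:
  assumes "x \<in> T" "y \<in> T" "x' \<in> T" "y' \<in> T"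
  shows "\<bar>d x y - d x' y'\<bar> \<le> d x x' + d y y'"
  using triangle[of x x' y] triangle[of x' y' y] triangle[of x' x y'] triangle[of x y y'] assms
    commute[of x' x] commute[of y' y] by linarith

section \<open>Separability of the base of a long dendron\<close>

definition branch_points :: "real \<Rightarrow> 'a set" where
  "branch_points r = {p \<in> T. height p = r \<and> (\<exists>x\<in>T. between \<rho> p x \<and> p \<noteq> x)}"

text \<open>The branches above distinct points of the same positive height are disjoint, so only countably
  many of them can carry mass.\<close>

lemma countable_branch_points:
  fixes \<nu> :: "('a \<times> real) measure"
  assumes \<nu>: "prob_space \<nu>" and pos: "\<And>B. B \<in> branches T d \<Longrightarrow> 0 < measure \<nu> (B \<times> {0..})" and r: "0 < r"
  shows "countable (branch_points r)"
proof -
  interpret \<nu>: prob_space \<nu> by fact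
  have "\<forall>p\<in>branch_points r. \<exists>x\<in>T. between \<rho> p x \<and> p \<noteq> x"
    by (simp add: branch_points_def)
  then obtain f where f: "\<And>p. p \<in> branch_points r \<Longrightarrow> f p \<in> T \<and> between \<rho> p (f p) \<and> p \<noteq> f p"
    by metis
  \<comment> \<open>A branch at \<open>p\<close> that points away from the root.\<close>
  define B where "B p = Collect (joined p (f p))" for p
  have mem: "p \<in> T" "height p = r" "p \<noteq> \<rho>" if "p \<in> branch_points r" for p
    using that r root by (auto simp: branch_points_def height_def)
  have B_branch: "B p \<in> branches T d" if "p \<in> branch_points r" for p
    unfolding branches_def B_def connected_components_of_def
    using f[OF that] mem[OF that] by (auto intro!: bexI[of _ p])
  \<comment> \<open>Every point of this branch has \<open>p\<close> on its way to the root, and that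
    way contains only one point of height \<open>r\<close>; this yields disjointness.\<close>
  have B_between: "between \<rho> p z" if p: "p \<in> branch_points r" and z: "z \<in> B p" for p z
  proof (rule ccontr)
    assume not: "\<not> between \<rho> p z"
    have pz: "joined p (f p) z" using z by (simp add: B_def)
    then have "z \<in> T"
      using connected_component_of_equiv[THEN iffD1, OF pz] by simp
    then have "joined p \<rho> z" by (intro joined_if_not_between root not)
    then have "joined p \<rho> (f p)" using joined_sym[OF pz] by (rule joined_trans)
    then show False
      using not_joined_if_between[OF root _ mem(1)[OF p]] f[OF p] mem(3)[OF p] by blast
  qed
  have disj: "disjoint_family_on (\<lambda>p. B p \<times> {0::real..}) (branch_points r)"
  proof (unfold disjoint_family_on_def, intro ballI impI)
    fix p q assume pq: "p \<in> branch_points r" "q \<in> branch_points r" "p \<noteq> q"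
    have False if z: "z \<in> B p" "z \<in> B q" for z
    proof -
      have pz: "joined p (f p) z" using z by (simp add: B_def)
      have "z \<in> T" using connected_component_of_equiv[THEN iffD1, OF pz] by simp
      then have "p = q"
        using between_unique[OF root, of z p q] B_between[OF pq(1) z(1)] B_between[OF pq(2) z(2)]
          mem[OF pq(1)] mem[OF pq(2)] by (simp add: height_def)
      with pq(3) show False by simp
    qed
    then show "(B p \<times> {0::real..}) \<inter> (B q \<times> {0..}) = {}" by blast
  qed
  define w where "w p = measure \<nu> (B p \<times> {0..})" for p
  have w: "0 < w p" if "p \<in> branch_points r" for p
    unfolding w_def by (rule pos[OF B_branch[OF that]])
  have "sum w F \<le> 1" if F: "F \<subseteq> branch_points r" "finite F" for F
  proof -
    \<comment> \<open>Measurability comes from the positive mass: \<open>measure\<close> is 0 on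
      sets outside the \<sigma>-algebra.\<close>
    have "B p \<times> {0..} \<in> sets \<nu>" if "p \<in> F" for p
    proof (rule ccontr)
      assume "B p \<times> {0..} \<notin> sets \<nu>"
      then have "w p = 0" unfolding w_def by (rule measure_notin_sets)
      moreover have "0 < w p" using that F(1) by (intro w) auto
      ultimately show False by simp
    qed
    then have "sum w F = measure \<nu> (\<Union>p\<in>F. B p \<times> {0..})"
      unfolding w_def using F(2) disjoint_family_on_mono[OF F(1) disj]
      by (intro \<nu>.finite_measure_finite_Union[symmetric]) auto
    then show ?thesis by simp
  qed
  then have "w summable_on branch_points r"
    using w by (intro nonneg_bdd_above_summable_on) (auto simp: bdd_above_def less_imp_le)
  moreover have "(\<lambda>p. norm (w p)) summable_on branch_points r \<longleftrightarrow> w summable_on branch_points r"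
    using w by (intro summable_on_cong) (simp add: less_imp_le)
  ultimately have "countable {p \<in> branch_points r. w p \<noteq> 0}"
    by (intro Infinite_Sum.abs_summable_countable) simp
  moreover have "{p \<in> branch_points r. w p \<noteq> 0} = branch_points r"
    using w by force
  ultimately show ?thesis by simp
qed

text \<open>On the path from the root to \<open>x\<close> there are points of rational height
  arbitrarily close to \<open>x\<close>. They are branch points, with \<open>x\<close> itself as the
  witness beyond them, and over all positive rational heights there are only countably many of
  these.\<close>

lemma separable_if_branches_positive:
  fixes \<nu> :: "('a \<times> real) measure"
  assumes "prob_space \<nu>" "\<And>B. B \<in> branches T d \<Longrightarrow> 0 < measure \<nu> (B \<times> {0..})"
  shows "separable_space mtopology"
proof -
  define D where "D = insert \<rho> (\<Union>r\<in>\<rat> \<inter> {0<..}. branch_points r)"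
  have "countable D"
    unfolding D_def using countable_rat
    by (intro countable_insert countable_UN countable_branch_points[OF assms]) auto
  moreover have D: "D \<subseteq> T"
    using root by (auto simp: D_def branch_points_def)
  moreover have "mtopology closure_of D = T"
  proof
    show "T \<subseteq> mtopology closure_of D"
    proof
      fix x assume x: "x \<in> T"
      have "\<exists>p\<in>D. p \<in> mball x e" if e: "0 < e" for e
      proof (cases "x = \<rho>")
        case True
        then show ?thesis using e root by (intro bexI[of _ \<rho>]) (auto simp: D_def)
      next
        case False
        then have pos: "0 < d \<rho> x" using x root by simp
        obtain r where r: "r \<in> \<rat>" "max 0 (d \<rho> x - e) < r" "r < d \<rho> x"
          using Rats_dense_in_real[of "max 0 (d \<rho> x - e)" "d \<rho> x"] pos e by auto
        obtain p where p: "p \<in> T" "between \<rho> p x" "d \<rho> p = r"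
          using ex_between[OF root x, of r] r by auto
        have "p \<noteq> x" using p(3) r(3) by auto
        then have "p \<in> D"
          using p r x unfolding D_def branch_points_def by (auto simp: height_def)
        moreover have "d x p < e"
          using p r(2) commute[of x p] by (simp add: between_def)
        ultimately show ?thesis using x p(1) by auto
      qed
      then show "x \<in> mtopology closure_of D"
        using x by (auto simp: metric_closure_of)
    qed
  qed (auto simp: metric_closure_of)
  ultimately show ?thesis
    unfolding separable_space_def by auto
qed

end

section \<open>Real trees and long dendrons as distance kernels\<close>

lemma real_tree_rooted:
  assumes "real_tree T d"
  obtains \<rho> where "rooted_real_tree T d \<rho>"
proof -
  have "Metric_space T d" "T \<noteq> {}" using assms by (auto simp: real_tree_def)
  then show ?thesis
    using assms that by (auto simp: rooted_real_tree_def rooted_real_tree_axioms_def)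
qed

lemma measured_real_tree_kernel:
  assumes "measured_real_tree T d \<mu>"
  shows "distance_kernel \<mu> d" "space \<mu> = T" "tau_infinity d \<mu> \<in> topspace tree_limits"
proof -
  have tree: "real_tree T d" and sep: "separable_space (Metric_space.mtopology T d)"
    and prob: "prob_space \<mu>" and sets: "sets \<mu> = sets (borel_of (Metric_space.mtopology T d))"
    using assms by (auto simp: measured_real_tree_def)
  obtain \<rho> where "rooted_real_tree T d \<rho>" using real_tree_rooted[OF tree] .
  then interpret rooted_real_tree T d \<rho> .
  interpret \<mu>: prob_space \<mu> by fact
  show space: "space \<mu> = T"
    using sets_eq_imp_space_eq[OF sets] by (simp add: space_borel_of)
  obtain p where p: "\<And>i :: nat. p i \<in> T" "\<And>x e. x \<in> T \<Longrightarrow> 0 < e \<Longrightarrow> \<exists>i. d x (p i) < e"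
    using dense_sequence[OF sep] by blast
  interpret G: gromov_product T height meet by (rule gromov_product_meet)
  have dist_of: "G.dist_of = d"
    by (intro ext dist_of_meet)
  interpret K: separable_gromov_kernel \<mu> height meet d p
    unfolding separable_gromov_kernel_def separable_gromov_kernel_axioms_def space dist_of
    using p dist_lipschitz continuous_map_imp_measurable[OF continuous_map_dist sets]
    by (intro conjI allI impI gromov_product_meet prob) auto
  show "tau_infinity d \<mu> \<in> topspace tree_limits"
    using K.law_in_tree_limits by (simp add: dist_of)
  have "sample_kernel \<mu> d" using K.sample_kernel_dist_of by (simp add: dist_of)
  moreover have "d x y \<le> d x z + d y z" if "x \<in> T" "y \<in> T" "z \<in> T" for x y z
    using triangle[of x z y] commute[of z y] that by simp
  ultimately show "distance_kernel \<mu> d"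
    unfolding distance_kernel_def distance_kernel_axioms_def space by simp
qed

text \<open>The product is that of the base and the second coordinate only adds to the height, so
  the ultrametric inequality is inherited. Approximation is measured by base distance plus
  difference of second coordinates, which unlike \<open>dendron_dist\<close> vanishes at equal
  points.\<close>

lemma long_dendron_kernel:
  assumes "long_dendron T d \<nu>"
  shows "distance_kernel \<nu> (dendron_dist d)" "space \<nu> = dendron_space T"
    "tau_infinity (dendron_dist d) \<nu> \<in> topspace tree_limits"
proof -
  have tree: "real_tree T d" and prob: "prob_space \<nu>"
    and sets: "sets \<nu> = sets (borel_of (prod_topology (Metric_space.mtopology T d) (top_of_set {0..})))"
    and pos: "\<And>B. B \<in> branches T d \<Longrightarrow> 0 < measure \<nu> (B \<times> {0..})"
    using assms by (auto simp: long_dendron_def)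
  obtain \<rho> where "rooted_real_tree T d \<rho>" using real_tree_rooted[OF tree] .
  then interpret rooted_real_tree T d \<rho> .
  interpret \<nu>: prob_space \<nu> by fact
  have space: "space \<nu> = T \<times> {0..}"
    using sets_eq_imp_space_eq[OF sets] by (simp add: space_borel_of)
  then show "space \<nu> = dendron_space T" by (simp add: dendron_space_def)
  obtain p where p: "\<And>i :: nat. p i \<in> T" "\<And>x e. x \<in> T \<Longrightarrow> 0 < e \<Longrightarrow> \<exists>i. d x (p i) < e"
    using dense_sequence[OF separable_if_branches_positive[OF prob pos]] by blast
  define H where "H z = height (fst z) + snd z" for z
  define G where "G z w = meet (fst z) (fst w)" for z w :: "'a \<times> real"
  define r where "r z w = d (fst z) (fst w) + \<bar>snd z - snd w\<bar>" for z w :: "'a \<times> real"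
  \<comment> \<open>Dense points of the base are paired with rationals, of which the negative ones
    are moved to 0 to stay in the half-line.\<close>
  define q where "q n = (p (fst (prod_decode n)), max 0 (real_of_rat (nat_to_rat_surj (snd (prod_decode n)))))" for n
  interpret G: gromov_product "T \<times> {0..}" H G
  proof
    fix z w v assume z: "z \<in> T \<times> {0::real..}" and w: "w \<in> T \<times> {0::real..}"
    show "0 \<le> G z w" using meet_bounds(1) z w by (auto simp: G_def)
    show "G z w \<le> H z"
      using meet_bounds(2)[of "fst z" "fst w"] z w by (auto simp: G_def H_def)
    show "G z w = G w z" by (simp add: G_def meet_sym)
    assume "v \<in> T \<times> {0::real..}"
    with z w show "min (G z w) (G w v) \<le> G z v"
      using meet_ultra[of "fst z" "fst w" "fst v"] by (auto simp: G_def)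
  qed
  have dist_of: "G.dist_of = dendron_dist d"
    by (intro ext) (auto simp: G.dist_of_def dendron_dist_def H_def G_def meet_def field_simps)
  have "separable_gromov_kernel \<nu> H G r q"
    unfolding separable_gromov_kernel_def separable_gromov_kernel_axioms_def space dist_of
  proof (intro conjI allI impI)
    show "gromov_product (T \<times> {0..}) H G" ..
    show "prob_space \<nu>" by (rule prob)
    show "q i \<in> T \<times> {0..}" for i by (simp add: q_def p)
    show "(\<lambda>z. r z (q i)) \<in> borel_measurable \<nu>" for i
    proof (rule continuous_map_imp_measurable[OF _ sets])
      have "continuous_map (prod_topology mtopology (top_of_set {0..})) euclideanreal (\<lambda>z. d (fst z) (fst (q i)))"
        using continuous_map_compose[OF continuous_map_fst continuous_map_dist[of "fst (q i)"]] p(1)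
        by (simp add: comp_def q_def)
      moreover have "continuous_map (prod_topology mtopology (top_of_set {0..})) euclideanreal snd"
        using continuous_map_snd[of mtopology "top_of_set {0::real..}"]
        by (rule continuous_map_into_fulltopology)
      ultimately show "continuous_map (prod_topology mtopology (top_of_set {0..})) euclideanreal (\<lambda>z. r z (q i))"
        unfolding r_def by (intro continuous_intros) auto
    qed
    show "\<exists>i. r z (q i) < e" if z: "z \<in> T \<times> {0..}" and e: "0 < e" for z and e :: real
    proof -
      obtain i where i: "d (fst z) (p i) < e / 2" using p(2)[of "fst z" "e / 2"] z e by auto
      \<comment> \<open>Chosen above \<open>snd z\<close>, the rational is positive and
        \<open>max 0\<close> leaves it unchanged.\<close>
      obtain s where s: "s \<in> \<rat>" "snd z < s" "s < snd z + e / 2"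
        using Rats_dense_in_real[of "snd z" "snd z + e / 2"] e by auto
      obtain j where j: "s = real_of_rat (nat_to_rat_surj j)"
        using s(1) by (metis Rats_cases surj_nat_to_rat_surj surjD)
      have "\<bar>snd z - max 0 (real_of_rat (nat_to_rat_surj j))\<bar> < e / 2"
        using s z unfolding j[symmetric] by auto
      then have "r z (q (prod_encode (i, j))) < e"
        using i by (simp add: r_def q_def)
      then show ?thesis ..
    qed
    show "0 \<le> r z w" for z w by (simp add: r_def)
    show "\<bar>dendron_dist d z w - dendron_dist d z' w'\<bar> \<le> r z z' + r w w'"
      if "z \<in> T \<times> {0..}" "w \<in> T \<times> {0..}" "z' \<in> T \<times> {0..}" "w' \<in> T \<times> {0..}" for z w z' w'
      using dist_lipschitz[of "fst z" "fst w" "fst z'" "fst w'"] that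
      by (auto simp: dendron_dist_def r_def)
  qed
  then interpret K: separable_gromov_kernel \<nu> H G r q .
  show "tau_infinity (dendron_dist d) \<nu> \<in> topspace tree_limits"
    using K.law_in_tree_limits by (simp add: dist_of)
  have "sample_kernel \<nu> (dendron_dist d)" using K.sample_kernel_dist_of by (simp add: dist_of)
  moreover have "dendron_dist d z w \<le> dendron_dist d z v + dendron_dist d w v"
    if "z \<in> T \<times> {0..}" "w \<in> T \<times> {0..}" "v \<in> T \<times> {0..}" for z w v
    using triangle[of "fst z" "fst v" "fst w"] commute[of "fst v" "fst w"] that
    by (auto simp: dendron_dist_def)
  moreover have "0 \<le> dendron_dist d z w" if "z \<in> T \<times> {0..}" "w \<in> T \<times> {0..}" for z w
    using that by (auto simp: dendron_dist_def)
  ultimately show "distance_kernel \<nu> (dendron_dist d)"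
    unfolding distance_kernel_def distance_kernel_axioms_def space by blast
qed

section \<open>Graph distance in finite trees and the three cases\<close>

lemma graph_dist_walk:
  assumes "finite_tree V E" "u \<in> V" "v \<in> V"
  obtains p where "walk V E u p v" "length p = Suc (graph_dist V E u v)"
proof -
  have conn: "\<exists>p. walk V E u p v"
    using assms by (simp add: finite_tree_def)
  obtain p where p: "walk V E u p v"
    using conn by blast
  then have "length p = Suc (length p - 1)" by (simp add: walk_def)
  with p have "\<exists>n p. walk V E u p v \<and> length p = Suc n" by blast
  from LeastI_ex[OF this] show ?thesis
    using that unfolding graph_dist_def by blast
qed

lemma graph_dist_le:
  assumes "walk V E u p v"
  shows "graph_dist V E u v \<le> length p - 1"
  unfolding graph_dist_def
  using assms by (intro Least_le) (auto simp: walk_def)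

lemma walk_rev: "walk V E u p v \<Longrightarrow> walk V E v (rev p) u"
  unfolding walk_def successively_rev by (simp add: hd_rev last_rev insert_commute)

text \<open>The vertex \<open>v\<close> ends \<open>p\<close> and starts \<open>q\<close>;
  \<open>tl\<close> removes one copy, so the lengths of the two walks, counted in edges, add
  up.\<close>

lemma walk_append:
  assumes p: "walk V E u p v" and q: "walk V E v q w"
  shows "walk V E u (p @ tl q) w"
proof (cases "tl q = []")
  case True
  then have "v = w" using q by (cases q) (auto simp: walk_def)
  with True p show ?thesis by simp
next
  case False
  then obtain x xs where "q = v # x # xs"
    using q by (cases q rule: remdups_adj.cases) (auto simp: walk_def)
  then show ?thesis
    using p q by (auto simp: walk_def successively_append_iff)
qed

lemma graph_dist_triangle:
  assumes tree: "finite_tree V E" and "u \<in> V" "v \<in> V" "w \<in> V"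
  shows "graph_dist V E u v \<le> graph_dist V E u w + graph_dist V E v w"
proof -
  obtain p where p: "walk V E u p w" "length p = Suc (graph_dist V E u w)"
    using graph_dist_walk[OF tree] assms by blast
  obtain q where q: "walk V E v q w" "length q = Suc (graph_dist V E v w)"
    using graph_dist_walk[OF tree] assms by blast
  show ?thesis
    using graph_dist_le[OF walk_append[OF p(1) walk_rev[OF q(1)]]] p(2) q(2) by simp
qed

lemma finite_tree_kernel:
  assumes tree: "finite_tree V E" and c: "c > 0"
  shows "distance_kernel (uniform_count_measure V) (rescaled_dist c V E)"
proof -
  have "finite V" "V \<noteq> {}" using tree by (auto simp: finite_tree_def)
  then have "sample_kernel (uniform_count_measure V) (rescaled_dist c V E)"
    by (rule sample_kernel_finite)
  moreover have "rescaled_dist c V E x y \<le> rescaled_dist c V E x z + rescaled_dist c V E y z"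
    if "x \<in> V" "y \<in> V" "z \<in> V" for x y z
  proof -
    have "real (graph_dist V E x y) \<le> real (graph_dist V E x z) + real (graph_dist V E y z)"
      using graph_dist_triangle[OF tree that] by linarith
    then have "c * real (graph_dist V E x y) \<le> c * (real (graph_dist V E x z) + real (graph_dist V E y z))"
      using c by simp
    then show ?thesis by (simp add: rescaled_dist_def distrib_left)
  qed
  ultimately show ?thesis
    using c unfolding distance_kernel_def distance_kernel_axioms_def
    by (auto simp: rescaled_dist_def)
qed

theorem theorem6p1:
  fixes I :: "'i set" and \<Omega> :: "'i \<Rightarrow> 'w measure"
  shows
    "(\<forall>(V :: 'i \<Rightarrow> 'a set) E c \<xi>.
        (\<forall>\<alpha>\<in>I. finite_tree (V \<alpha>) (E \<alpha>) \<and> c \<alpha> > 0 \<and>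
               iid_sequence (\<Omega> \<alpha>) (uniform_count_measure (V \<alpha>)) (\<xi> \<alpha>)) \<longrightarrow>
        tightness_conditions_equivalent I V (\<lambda>\<alpha>. rescaled_dist (c \<alpha>) (V \<alpha>) (E \<alpha>))
          (\<lambda>\<alpha>. uniform_count_measure (V \<alpha>)) \<Omega> \<xi>)
     \<and>
     (\<forall>(T :: 'i \<Rightarrow> 'b set) d \<mu> \<xi>.
        (\<forall>\<alpha>\<in>I. measured_real_tree (T \<alpha>) (d \<alpha>) (\<mu> \<alpha>) \<and>
               iid_sequence (\<Omega> \<alpha>) (\<mu> \<alpha>) (\<xi> \<alpha>)) \<longrightarrow>
        tightness_conditions_equivalent I T d \<mu> \<Omega> \<xi>)
     \<and>
     (\<forall>(T :: 'i \<Rightarrow> 'b set) d \<nu> \<xi>.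
        (\<forall>\<alpha>\<in>I. long_dendron (T \<alpha>) (d \<alpha>) (\<nu> \<alpha>) \<and>
               iid_sequence (\<Omega> \<alpha>) (\<nu> \<alpha>) (\<xi> \<alpha>)) \<longrightarrow>
        tightness_conditions_equivalent I (\<lambda>\<alpha>. dendron_space (T \<alpha>)) (\<lambda>\<alpha>. dendron_dist (d \<alpha>)) \<nu> \<Omega> \<xi>)"
proof (intro conjI allI impI)
  fix V :: "'i \<Rightarrow> 'a set" and E and c :: "'i \<Rightarrow> real" and \<xi>
  assume "\<forall>\<alpha>\<in>I. finite_tree (V \<alpha>) (E \<alpha>) \<and> c \<alpha> > 0 \<and>
    iid_sequence (\<Omega> \<alpha>) (uniform_count_measure (V \<alpha>)) (\<xi> \<alpha>)"
  then have "kernel_family I V (\<lambda>\<alpha>. rescaled_dist (c \<alpha>) (V \<alpha>) (E \<alpha>))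
      (\<lambda>\<alpha>. uniform_count_measure (V \<alpha>)) \<Omega> \<xi>"
    by (intro kernel_family.intro finite_tree_kernel finite_tree_law_in_tree_limits) auto
  then show "tightness_conditions_equivalent I V (\<lambda>\<alpha>. rescaled_dist (c \<alpha>) (V \<alpha>) (E \<alpha>))
      (\<lambda>\<alpha>. uniform_count_measure (V \<alpha>)) \<Omega> \<xi>"
    by (rule kernel_family.conditions_equivalent)
next
  fix T :: "'i \<Rightarrow> 'b set" and d \<mu> \<xi>
  assume "\<forall>\<alpha>\<in>I. measured_real_tree (T \<alpha>) (d \<alpha>) (\<mu> \<alpha>) \<and> iid_sequence (\<Omega> \<alpha>) (\<mu> \<alpha>) (\<xi> \<alpha>)"
  then have "kernel_family I T d \<mu> \<Omega> \<xi>"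
    by (intro kernel_family.intro) (auto dest: measured_real_tree_kernel)
  then show "tightness_conditions_equivalent I T d \<mu> \<Omega> \<xi>"
    by (rule kernel_family.conditions_equivalent)
next
  fix T :: "'i \<Rightarrow> 'b set" and d \<nu> \<xi>
  assume "\<forall>\<alpha>\<in>I. long_dendron (T \<alpha>) (d \<alpha>) (\<nu> \<alpha>) \<and> iid_sequence (\<Omega> \<alpha>) (\<nu> \<alpha>) (\<xi> \<alpha>)"
  then have "kernel_family I (\<lambda>\<alpha>. dendron_space (T \<alpha>)) (\<lambda>\<alpha>. dendron_dist (d \<alpha>)) \<nu> \<Omega> \<xi>"
    by (intro kernel_family.intro) (auto dest: long_dendron_kernel)
  then show "tightness_conditions_equivalent I (\<lambda>\<alpha>. dendron_space (T \<alpha>)) (\<lambda>\<alpha>. dendron_dist (d \<alpha>)) \<nu> \<Omega> \<xi>"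
    by (rule kernel_family.conditions_equivalent)
qed

end
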